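(* Let $k\ge2$ and $p_1\ge p_2\ge\cdots\ge p_k>0$ with $\sum_{l=1}^kp_l=1$. Let $\mathcal V=\{\mathcal V_{m,n}\}_{m,n\in\mathbb N}$ be the covariance of the Gaussian sequence $\xi=\{\xi_n\}_{n\in\mathbb N}$ defined by $\xi_1=g_1$, $\xi_n=\sum_{l=1}^kp_l\xi_{n-l}+g_n$ for $n\ge2$, where $\xi_i=0$ for all $i\le0$ and $g_1,g_2,\dots$ are independent standard normal random variables. Let $f=\mathcal Vh$ where $h\in\ell_1^+$, and assume in addition that $f_j=o(j^{1/2})$ as $j\to\infty$. For $\alpha>0$ let $\widetilde{\mathcal Y}_\alpha=\{\widetilde{\mathcal Y}_{\alpha,j}\}_{j\in\mathbb N}$ be an $\alpha$-permanental sequence with kernel $\widetilde{\mathcal V}_{j,k}=\mathcal V_{j,k}+f_k$, $j,k\in\mathbb N$. Then $$\limsup_{j\to\infty}\frac{\widetilde{\mathcal Y}_{\alpha,j}}{j\log\log j}=\frac1{\big(\sum_{l=1}^klp_l\big)^2}\quad\text{a.s.},\qquad\forall\,\alpha>0.$$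
   Context: $\mathbb N=\{1,2,\dots\}$; $\ell_1^+$ is the set of non-negative summable sequences; $(\mathcal Vh)_j=\sum_n\mathcal V_{j,n}h_n$. Permanental sequences: for $\alpha>0$ and a matrix $K=\{K_{i,j}\}_{i,j\in\mathbb N}$, an $\alpha$-permanental sequence with kernel $K$ is a sequence $\{Z_j\}_{j\in\mathbb N}$ of non-negative random variables such that for all $n$, all distinct $i_1,\dots,i_n\in\mathbb N$ and all $s_1,\dots,s_n>0$, $E\exp(-\sum_{m=1}^n s_mZ_{i_m})=\det(I+K'S)^{-\alpha}$, where $K'=\{K_{i_p,i_q}\}_{p,q=1}^n$ and $S=\mathrm{diag}(s_1,\dots,s_n)$. An $\alpha$-permanental sequence with kernel $\widetilde{\mathcal V}$ exists for every $\alpha>0$ because $\mathcal V$ is the strictly positive potential density of a symmetric transient Markov chain on $\mathbb N$ and $f=\mathcal Vh$ is a finite excessive function for it. *)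

theory Defs
  imports
    "HOL-Probability.Probability"
    "HOL-Library.Landau_Symbols"
    "Jordan_Normal_Form.Determinant"
begin

text \<open>Sequences over the positive integers are functions on \<^typ>\<open>nat\<close> of which only the
  values at arguments \<open>\<ge> 1\<close> matter.\<close>

definition covariance :: "'a measure \<Rightarrow> ('a \<Rightarrow> real) \<Rightarrow> ('a \<Rightarrow> real) \<Rightarrow> real" where
  "covariance M X Y =
     (LINT \<omega>|M. (X \<omega> - (LINT \<eta>|M. X \<eta>)) * (Y \<omega> - (LINT \<eta>|M. Y \<eta>)))"

definition diagonal_mat_of :: "nat \<Rightarrow> (nat \<Rightarrow> 'a :: zero) \<Rightarrow> 'a mat" where
  "diagonal_mat_of n s = mat n n (\<lambda>(p, q). if p = q then s p else 0)"

text \<open>The index tuples and the parameters are numbered from \<open>0\<close>, as are the rows and columns of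
  \<^typ>\<open>'a mat\<close>. The determinant below is automatically positive, so \<^term>\<open>(powr)\<close> has its usual
  meaning: as the parameters are scaled down to \<open>0\<close> it tends continuously to \<open>1\<close>, and it cannot
  vanish because \<open>0 powr (- \<alpha>) = 0\<close> while the expectation is positive.\<close>

definition permanental_sequence ::
    "'a measure \<Rightarrow> real \<Rightarrow> (nat \<Rightarrow> nat \<Rightarrow> real) \<Rightarrow> (nat \<Rightarrow> 'a \<Rightarrow> real) \<Rightarrow> bool" where
  "permanental_sequence M \<alpha> K Z \<longleftrightarrow>
     prob_space M \<and>
     (\<forall>j\<ge>1. Z j \<in> borel_measurable M \<and> (\<forall>\<omega>\<in>space M. 0 \<le> Z j \<omega>)) \<and>
     (\<forall>(n::nat) (i :: nat \<Rightarrow> nat) (s :: nat \<Rightarrow> real).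
        (\<forall>m<n. 1 \<le> i m) \<and> inj_on i {..<n} \<and> (\<forall>m<n. 0 < s m) \<longrightarrow>
        (LINT \<omega>|M. exp (- (\<Sum>m<n. s m * Z (i m) \<omega>))) =
          Determinant.det
            (1\<^sub>m n + mat n n (\<lambda>(p, q). K (i p) (i q)) * diagonal_mat_of n s) powr (- \<alpha>))"

end

theory Submission
  imports Defs
begin

text \<open>Only the one- and two-dimensional marginals of the permanental sequence enter. With
  \<open>K i j = V i j + f j\<close>, a single variable is gamma distributed with scale \<open>K j j\<close>, and a pair has
  Laplace transform
  \<open>((1 + s * K i i) * (1 + t * K j j) - s * t * (K i j * K j i)) powr (- \<alpha>)\<close>.
  The covariance is \<open>V m n = (\<Sum>i<m. u i * u (i + (n - m)))\<close> for \<open>m \<le> n\<close>, where \<open>u\<close> is the renewal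
  sequence of the weights \<open>p\<close>; as \<open>u\<close> converges geometrically to \<open>1 / (\<Sum>l=1..k. l * p l)\<close>, the scale
  \<open>K j j\<close> is asymptotic to \<open>j / (\<Sum>l=1..k. l * p l)\<^sup>2\<close>.

  Upper bound: \<open>Y i - Y j\<close> has exponential tails on the scale \<open>sqrt (j * (j - i))\<close>. Dyadic chaining
  reduces the maximum over \<open>[2^n, 2^(n+1))\<close> to a fixed number of nodes, to which the gamma tail and
  the first Borel--Cantelli lemma apply.

  Lower bound: expanding the bivariate Laplace transform in powers of
  \<open>r = K i j * K j i / (K i i * K j j)\<close> exhibits the pair as a mixture of products of gamma laws, so
  that tail events are independent up to an error of order \<open>r\<close>. This error is summable along
  \<open>n_i = i^(3 i)\<close>, and a second-moment argument gives infinitely many exceedances.\<close>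

section \<open>Uniqueness of Laplace transforms\<close>

text \<open>The parameter \<alpha> changes the gamma tail exp (- x) by subexponential factors only,
  hence it is invisible in the limit. The scale of \<open>Y i - Y j\<close> is that of a difference
  of squares: increment sqrt (j - i) times size sqrt j. Chaining loses a constant factor, so it is
  used only below a fixed depth, where it contributes a small multiple of j ln ln j; the sharp
  constant comes from the gamma tails at the nodes. In the lower bound the error r of a pair is not
  multiplied by the probabilities of the events, so it must be summable over all pairs; along a
  geometric sequence neighbouring indices would keep r of constant order, hence the faster growth.
  The growth condition enters as f j \<le> B sqrt j: it leaves the limit of V j j / j unchanged,
  fits f j - f i under the increment scale because j - i is at least 1, and adds a term of order 1 /
  sqrt j to r.\<close>

lemma eucl_less_prod_iff: "eucl_less a z \<longleftrightarrow> fst a < fst z \<and> snd a < snd z" for a z :: "real \<times> real"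
  by (cases a; cases z) (auto simp: eucl_less_def Basis_prod_def)

lemma integrable_continuous_on_unit_square:
  fixes \<mu> :: "(real \<times> real) measure" and F :: "real \<times> real \<Rightarrow> real"
  assumes "finite_measure \<mu>" "sets \<mu> = sets borel"
    and "AE z in \<mu>. z \<in> {0..1} \<times> {0..1}" "continuous_on UNIV F"
  shows "integrable \<mu> F"
proof -
  interpret finite_measure \<mu> by fact
  have "compact (F ` ({0..1} \<times> {0..1}))"
    using assms(4) by (intro compact_continuous_image compact_Times) (auto intro: continuous_on_subset)
  then obtain B where B: "\<And>z. z \<in> {0..1} \<times> {0..1} \<Longrightarrow> norm (F z) \<le> B"
    using compact_imp_bounded by (force simp: bounded_iff)
  have "F \<in> borel_measurable \<mu>"
    using borel_measurable_continuous_onI[OF assms(4)] by (simp add: measurable_cong_sets[OF assms(2) refl])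
  moreover have "AE z in \<mu>. norm (F z) \<le> B"
    using assms(3) by (rule eventually_mono) (rule B)
  ultimately show ?thesis
    by (intro integrable_const_bound)
qed

text \<open>Equal moments give equal integrals of polynomials, which are uniformly dense in the
  continuous functions on the compact square (Stone--Weierstrass).\<close>

lemma moments_eq_imp_integral_eq:
  fixes \<mu> \<nu> :: "(real \<times> real) measure" and F :: "real \<times> real \<Rightarrow> real"
  assumes \<mu>: "finite_measure \<mu>" "sets \<mu> = sets borel" "AE z in \<mu>. z \<in> {0..1} \<times> {0..1}"
    and \<nu>: "finite_measure \<nu>" "sets \<nu> = sets borel" "AE z in \<nu>. z \<in> {0..1} \<times> {0..1}"
    and eq: "\<And>i j::nat. (LINT z|\<mu>. fst z ^ i * snd z ^ j) = (LINT z|\<nu>. fst z ^ i * snd z ^ j)"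
    and F: "continuous_on UNIV F"
  shows "(LINT z|\<mu>. F z) = (LINT z|\<nu>. F z)"
proof -
  note int\<mu> = integrable_continuous_on_unit_square[OF \<mu>]
  note int\<nu> = integrable_continuous_on_unit_square[OF \<nu>]
  have contp: "continuous_on UNIV f" if "real_polynomial_function f" for f :: "real \<times> real \<Rightarrow> real"
    using that by (simp add: continuous_at_imp_continuous_on continuous_real_polymonial_function)
  \<comment> \<open>Equality of integrals is not preserved under products. The induction over
    polynomial functions therefore uses a property stable under multiplication by them: equality
    after multiplication by every monomial.\<close>
  define S where "S F \<longleftrightarrow> continuous_on UNIV F \<and>
    (\<forall>i j::nat. (LINT z|\<mu>. F z * fst z ^ i * snd z ^ j) = (LINT z|\<nu>. F z * fst z ^ i * snd z ^ j))" for F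
  have S: "S (\<lambda>z. F z * P z)" if "real_polynomial_function P" "S F" for P F
    using that
  proof (induction P arbitrary: F)
    case (linear f)
    interpret f: bounded_linear f by fact
    have cF: "continuous_on UNIV F" using linear by (simp add: S_def)
    have f: "f z = fst z * f (1,0) + snd z * f (0,1)" for z
    proof -
      have "z = fst z *\<^sub>R (1,0) + snd z *\<^sub>R (0,1)" by (simp add: prod_eq_iff)
      then show ?thesis by (metis f.add f.scaleR real_scaleR_def)
    qed
    have *: "F z * f z * fst z ^ i * snd z ^ j =
       f (1,0) * (F z * fst z ^ Suc i * snd z ^ j) + f (0,1) * (F z * fst z ^ i * snd z ^ Suc j)" for z i j
      by (subst f) (simp add: algebra_simps)
    have c: "continuous_on UNIV (\<lambda>z. c * (F z * fst z ^ i * snd z ^ j))" for i j c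
      using cF by (intro continuous_intros)
    have "(LINT z|\<mu>. F z * f z * fst z ^ i * snd z ^ j) = (LINT z|\<nu>. F z * f z * fst z ^ i * snd z ^ j)" for i j
      unfolding * using linear(2) unfolding S_def
      by (subst (1 2) Bochner_Integration.integral_add) (simp_all only: int\<mu>[OF c] int\<nu>[OF c] integral_mult_right_zero)
    then show ?case
      unfolding S_def using cF linear_continuous_on[OF linear(1)] by (auto intro!: continuous_on_mult)
  next
    case (const c)
    have *: "F z * c * fst z ^ i * snd z ^ j = c * (F z * fst z ^ i * snd z ^ j)" for z i j by simp
    show ?case using const unfolding S_def * by (auto intro!: continuous_intros)
  next
    case (add f g)
    have 1: "S (\<lambda>z. F z * f z)" "S (\<lambda>z. F z * g z)" using add by auto
    have *: "F z * (f z + g z) * fst z ^ i * snd z ^ j =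
       F z * f z * fst z ^ i * snd z ^ j + F z * g z * fst z ^ i * snd z ^ j" for z i j
      by (simp add: algebra_simps)
    have cf: "continuous_on UNIV (\<lambda>z. F z * f z * fst z ^ i * snd z ^ j)" 
      and cg: "continuous_on UNIV (\<lambda>z. F z * g z * fst z ^ i * snd z ^ j)" for i j
      using 1 unfolding S_def by (auto intro!: continuous_intros)
    have "(LINT z|\<mu>. F z * (f z + g z) * fst z ^ i * snd z ^ j) = (LINT z|\<nu>. F z * (f z + g z) * fst z ^ i * snd z ^ j)" for i j
      unfolding * using 1 unfolding S_def
      by (subst (1 2) Bochner_Integration.integral_add)
         (simp_all only: int\<mu>[OF cf] int\<nu>[OF cf] int\<mu>[OF cg] int\<nu>[OF cg])
    then show ?case using add(5) contp[OF add(1)] contp[OF add(2)]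
      unfolding S_def by (auto intro!: continuous_intros)
  next
    case (mult f g)
    have "S (\<lambda>z. F z * f z)" using mult by auto
    then have "S (\<lambda>z. (F z * f z) * g z)" by (rule mult(4))
    then show ?case by (simp add: mult.assoc)
  qed
  have "S (\<lambda>z. 1)" unfolding S_def using eq by simp
  then have poly: "(LINT z|\<mu>. P z) = (LINT z|\<nu>. P z)" if "real_polynomial_function P" for P
    using S[OF that, of "\<lambda>z. 1"] unfolding S_def by (metis (no_types, lifting) Bochner_Integration.integral_cong mult_1 mult_1_right power_0)
  interpret \<mu>: finite_measure \<mu> by fact
  interpret \<nu>: finite_measure \<nu> by fact
  define C where "C = measure \<mu> (space \<mu>) + measure \<nu> (space \<nu>)"
  have "C \<ge> 0" by (simp add: C_def)
  have close: "\<bar>(LINT z|\<mu>. F z) - (LINT z|\<nu>. F z)\<bar> \<le> e * C" if "e > 0" for e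
  proof -
    have K: "compact ({0..1} \<times> {0..1} :: (real \<times> real) set)" by (intro compact_Times) auto
    obtain P where P: "real_polynomial_function P" "\<And>z. z \<in> {0..1} \<times> {0..1} \<Longrightarrow> \<bar>F z - P z\<bar> < e"
      using Stone_Weierstrass_real_polynomial_function[OF K continuous_on_subset[OF F subset_UNIV] \<open>e > 0\<close>] by metis
    have cP: "continuous_on UNIV P" by (rule contp) fact
    have "\<bar>LINT z|\<mu>. F z - P z\<bar> \<le> (LINT z|\<mu>. e)"
      using P(2) \<mu>(3) by (intro integral_abs_bound[THEN order_trans] integral_mono_AE integrable_abs int\<mu>
          continuous_on_diff F cP) (auto elim!: AE_mp simp: less_imp_le)
    moreover have "\<bar>LINT z|\<nu>. F z - P z\<bar> \<le> (LINT z|\<nu>. e)"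
      using P(2) \<nu>(3) by (intro integral_abs_bound[THEN order_trans] integral_mono_AE integrable_abs int\<nu>
          continuous_on_diff F cP) (auto elim!: AE_mp simp: less_imp_le)
    ultimately show ?thesis
      using poly[OF P(1)] int\<mu>[OF F] int\<nu>[OF F] int\<mu>[OF cP] int\<nu>[OF cP] by (simp add: C_def algebra_simps)
  qed
  show ?thesis
  proof (rule ccontr)
    assume "\<not> ?thesis"
    then have d: "\<bar>(LINT z|\<mu>. F z) - (LINT z|\<nu>. F z)\<bar> > 0" (is "?d > 0") by simp
    have "?d / (2 * (C + 1)) * C < ?d"
      using d \<open>C \<ge> 0\<close> by (simp add: field_simps) (smt (verit) mult_nonneg_nonneg)
    then show False using close[of "?d / (2 * (C + 1))"] d \<open>C \<ge> 0\<close> by simp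
  qed
qed

text \<open>Componentwise \<open>exp (- x)\<close> carries the quadrant into the unit square and
  turns Laplace transforms at integer arguments into moments.\<close>

lemma laplace_transform_unique:
  fixes \<mu> \<nu> :: "(real \<times> real) measure"
  assumes \<mu>: "finite_measure \<mu>" "sets \<mu> = sets borel" "AE z in \<mu>. 0 \<le> fst z \<and> 0 \<le> snd z"
    and \<nu>: "finite_measure \<nu>" "sets \<nu> = sets borel" "AE z in \<nu>. 0 \<le> fst z \<and> 0 \<le> snd z"
    and eq: "\<And>s t. 0 \<le> s \<Longrightarrow> 0 \<le> t \<Longrightarrow>
      (LINT z|\<mu>. exp (- (s * fst z + t * snd z))) = (LINT z|\<nu>. exp (- (s * fst z + t * snd z)))"
  shows "\<mu> = \<nu>"
proof -
  define T :: "real \<times> real \<Rightarrow> real \<times> real" where "T z = (exp (- fst z), exp (- snd z))" for z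
  have T [measurable]: "T \<in> borel_measurable borel" 
    unfolding T_def by (intro borel_measurable_continuous_onI continuous_intros)
  have T\<mu> [measurable]: "T \<in> borel_measurable \<mu>" and T\<nu> [measurable]: "T \<in> borel_measurable \<nu>"
    using T by (simp_all add: measurable_cong_sets[OF \<mu>(2) refl] measurable_cong_sets[OF \<nu>(2) refl])
  interpret \<mu>: finite_measure \<mu> by fact
  interpret \<nu>: finite_measure \<nu> by fact
  have fin: "finite_measure (distr \<mu> borel T)" "finite_measure (distr \<nu> borel T)"
    by (auto intro: \<mu>.finite_measure_distr \<nu>.finite_measure_distr)
  have supp: "AE z in distr \<mu> borel T. z \<in> {0..1} \<times> {0..1}" "AE z in distr \<nu> borel T. z \<in> {0..1} \<times> {0..1}"
    using \<mu>(3) \<nu>(3) closed_Times[of "{0..1::real}" "{0..1::real}"]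
    by (subst AE_distr_iff; force simp: borel_closed T_def)+
  have mom: "(LINT z|distr \<mu> borel T. fst z ^ i * snd z ^ j) = (LINT z|distr \<nu> borel T. fst z ^ i * snd z ^ j)" for i j
  proof -
    have [measurable]: "(\<lambda>z. fst z ^ i * snd z ^ j :: real) \<in> borel_measurable borel"
      by (intro borel_measurable_continuous_onI continuous_intros)
    show ?thesis
      using eq[of "real i" "real j"]
      by (simp add: integral_distr T_def exp_of_nat_mult[symmetric] exp_add[symmetric] algebra_simps)
  qed
  have F: "(LINT z|\<mu>. F (T z)) = (LINT z|\<nu>. F (T z))" if "continuous_on UNIV F" for F :: "real \<times> real \<Rightarrow> real"
    using moments_eq_imp_integral_eq[OF fin(1) _ supp(1) fin(2) _ supp(2) mom that]
      borel_measurable_continuous_onI[OF that]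
    by (simp add: integral_distr)
  have orth: "measure \<mu> {z. eucl_less a z} = measure \<nu> {z. eucl_less a z}" for a :: "real \<times> real"
  proof -
    \<comment> \<open>Ramps converging pointwise to the indicator of \<open>u < c\<close>. As
      \<open>exp (- x)\<close> is decreasing, products of two of them approximate indicators of open
      upper orthants, which generate the Borel sets.\<close>
    define G :: "nat \<Rightarrow> real \<Rightarrow> real \<Rightarrow> real" where "G n c u = min 1 (real n * max 0 (c - u))" for n c u
    define F where "F n z = G n (exp (- fst a)) (fst z) * G n (exp (- snd a)) (snd z)" for n and z :: "real \<times> real"
    have cF: "continuous_on UNIV (F n)" for n
      unfolding F_def G_def by (intro continuous_intros)
    have [measurable]: "F n \<in> borel_measurable borel" for n
      by (rule borel_measurable_continuous_onI[OF cF])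
    have G: "(\<lambda>n. G n c u) \<longlonglongrightarrow> (if u < c then 1 else 0)" for c u
    proof (cases "u < c")
      case True
      have "eventually (\<lambda>n. 1 / (c - u) \<le> real n) sequentially" by real_asymp
      then have "eventually (\<lambda>n. G n c u = 1) sequentially"
        by eventually_elim (use True in \<open>simp add: G_def field_simps\<close>)
      then show ?thesis using True by (simp add: tendsto_eventually)
    qed (simp add: G_def)
    have ind: "(if exp (- fst z) < exp (- fst a) then 1 else 0) * (if exp (- snd z) < exp (- snd a) then 1 else 0) = (indicator {z. eucl_less a z} z :: real)" for z
      by (auto simp: eucl_less_prod_iff)
    have lim: "(\<lambda>n. F n (T z)) \<longlonglongrightarrow> indicator {z. eucl_less a z} z" for z
      unfolding F_def ind[symmetric] T_def fst_conv snd_conv by (intro tendsto_mult G)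
    have bd: "norm (F n z) \<le> 1" for n z
      unfolding F_def G_def by (auto simp: abs_mult intro!: mult_le_one)
    have m: "{z. eucl_less a z} \<in> sets borel" by (simp add: borel_eq_greaterThan)
    have "(\<lambda>n. LINT z|\<mu>. F n (T z)) \<longlonglongrightarrow> (LINT z|\<mu>. indicator {z. eucl_less a z} z)"
      using lim m bd by (intro integral_dominated_convergence[where w = "\<lambda>_. 1"]) (auto simp: \<mu>(2) intro!: borel_measurable_indicator)
    moreover have "(\<lambda>n. LINT z|\<nu>. F n (T z)) \<longlonglongrightarrow> (LINT z|\<nu>. indicator {z. eucl_less a z} z)"
      using lim m bd by (intro integral_dominated_convergence[where w = "\<lambda>_. 1"]) (auto simp: \<nu>(2) intro!: borel_measurable_indicator)
    ultimately show ?thesis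
      using m F[OF cF] LIMSEQ_unique by (fastforce simp: \<mu>(2) \<nu>(2))
  qed
  show ?thesis
  proof (rule measure_eqI_generator_eq)
    show "Int_stable (range (\<lambda>a :: real \<times> real. {z. eucl_less a z}))"
    proof (safe intro!: Int_stableI)
      fix a b :: "real \<times> real"
      have "{z. eucl_less a z} \<inter> {z. eucl_less b z} = {z. eucl_less (max (fst a) (fst b), max (snd a) (snd b)) z}"
        by (auto simp: eucl_less_prod_iff)
      then show "{z. eucl_less a z} \<inter> {z. eucl_less b z} \<in> range (\<lambda>a. {z. eucl_less a z})" by auto
    qed
    show "emeasure \<mu> X = emeasure \<nu> X" if "X \<in> range (\<lambda>a :: real \<times> real. {z. eucl_less a z})" for X
      using that orth by (auto simp: \<mu>.emeasure_eq_measure \<nu>.emeasure_eq_measure)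
    show "sets \<mu> = sigma_sets UNIV (range (\<lambda>a :: real \<times> real. {z. eucl_less a z}))"
      "sets \<nu> = sigma_sets UNIV (range (\<lambda>a :: real \<times> real. {z. eucl_less a z}))"
      by (simp_all add: \<mu>(2) \<nu>(2) borel_eq_greaterThan del: Collect_mem_eq)
    show "range (\<lambda>n::nat. {z :: real \<times> real. eucl_less (- real n, - real n) z}) \<subseteq> range (\<lambda>a. {z. eucl_less a z})" by auto
    show "(\<Union>n::nat. {z :: real \<times> real. eucl_less (- real n, - real n) z}) = UNIV"
    proof safe
      fix x y :: real
      obtain n :: nat where "real n > max (- x) (- y)" using reals_Archimedean2 by blast
      then show "(x, y) \<in> (\<Union>n::nat. {z :: real \<times> real. eucl_less (- real n, - real n) z})"
        by (auto simp: eucl_less_prod_iff intro!: exI[of _ n])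
    qed auto
  qed (auto simp: \<mu>.emeasure_finite)
qed

section \<open>Gamma laws\<close>

definition gamma_density :: "real \<Rightarrow> real \<Rightarrow> real" where
  "gamma_density a x = (if x > 0 then x powr (a - 1) * exp (- x) / Gamma a else 0)"

lemma borel_measurable_gamma_density [measurable]: "gamma_density a \<in> borel_measurable borel"
  unfolding gamma_density_def by measurable

lemma nn_integral_gamma_density_exp:
  assumes a: "a > 0" and s: "s > -1"
  shows "(\<integral>\<^sup>+x. ennreal (gamma_density a x) * ennreal (exp (- (s * x))) \<partial>lborel) = ennreal ((1 + s) powr (- a))"
proof -
  define c where "c = 1 / (1 + s)"
  have c: "c > 0" using s by (simp add: c_def)
  have G: "Gamma a > 0" using a by (rule Gamma_real_pos)
  have eq: "ennreal (gamma_density a (c * x)) * ennreal (exp (- (s * (c * x))))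
      = ennreal (c powr (a - 1) / Gamma a) * ennreal (indicator {0..} x * x powr (a - 1) / exp x)"
    if "x \<noteq> 0" for x
  proof (cases "x > 0")
    case True
    have "- (c * x) + - (s * (c * x)) = - (((1 + s) * c) * x)" by (simp add: algebra_simps)
    also have "(1 + s) * c = 1" using s by (simp add: c_def)
    finally have "- (c * x) + - (s * (c * x)) = - x" by simp
    then have "exp (- (c * x)) * exp (- (s * (c * x))) = exp (- x)"
      by (simp only: exp_add[symmetric])
    then show ?thesis using True c G
      by (simp add: gamma_density_def ennreal_mult[symmetric] powr_mult exp_minus divide_simps mult_ac)
  next
    case False
    then have "x < 0" using that by simp
    then show ?thesis using c by (simp add: gamma_density_def mult_less_0_iff not_less zero_less_mult_iff)
  qed
  have "(\<integral>\<^sup>+x. ennreal (gamma_density a x) * ennreal (exp (- (s * x))) \<partial>lborel)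
      = ennreal c * (\<integral>\<^sup>+x. ennreal (gamma_density a (c * x)) * ennreal (exp (- (s * (c * x)))) \<partial>lborel)"
    using c by (subst nn_integral_real_affine[where c = c and t = 0]) auto
  also have "(\<integral>\<^sup>+x. ennreal (gamma_density a (c * x)) * ennreal (exp (- (s * (c * x)))) \<partial>lborel)
      = (\<integral>\<^sup>+x. ennreal (c powr (a - 1) / Gamma a) * ennreal (indicator {0..} x * x powr (a - 1) / exp x) \<partial>lborel)"
    by (rule nn_integral_cong_AE) (use AE_lborel_singleton[of 0] in \<open>eventually_elim, auto intro!: eq\<close>)
  also have "\<dots> = ennreal (c powr (a - 1) / Gamma a) * ennreal (Gamma a)"
    using a by (simp add: nn_integral_cmult Gamma_conv_nn_integral_real)
  also have "\<dots> = ennreal (c powr (a - 1))"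
    using G by (simp add: ennreal_mult'[symmetric])
  also have "ennreal c * \<dots> = ennreal (c powr a)"
    using c by (simp add: ennreal_mult'[symmetric] powr_diff)
  also have "c powr a = (1 + s) powr (- a)"
    using s by (simp add: c_def powr_minus powr_divide divide_simps)
  finally show ?thesis .
qed

definition gamma_measure :: "real \<Rightarrow> real measure" where
  "gamma_measure a = density lborel (\<lambda>x. ennreal (gamma_density a x))"

lemma sets_gamma_measure [simp, measurable_cong]: "sets (gamma_measure a) = sets borel"
  and space_gamma_measure [simp]: "space (gamma_measure a) = UNIV"
  by (simp_all add: gamma_measure_def)

lemma nn_integral_gamma_measure:
  "f \<in> borel_measurable borel \<Longrightarrow>
    (\<integral>\<^sup>+x. f x \<partial>gamma_measure a) = (\<integral>\<^sup>+x. ennreal (gamma_density a x) * f x \<partial>lborel)"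
  unfolding gamma_measure_def by (subst nn_integral_density) auto

lemma nn_integral_gamma_measure_exp:
  "a > 0 \<Longrightarrow> s > -1 \<Longrightarrow>
    (\<integral>\<^sup>+x. ennreal (exp (- (s * x))) \<partial>gamma_measure a) = ennreal ((1 + s) powr (- a))"
  by (simp add: nn_integral_gamma_measure nn_integral_gamma_density_exp)

lemma prob_space_gamma_measure: "a > 0 \<Longrightarrow> prob_space (gamma_measure a)"
  using nn_integral_gamma_measure_exp[of a 0] by (intro prob_spaceI) simp

lemma AE_gamma_measure_pos: "AE x in gamma_measure a. x > 0"
  unfolding gamma_measure_def by (subst AE_density) (auto simp: gamma_density_def)

text \<open>The two-dimensional uniqueness result, applied to pairs whose second component is the
  constant \<open>0\<close>.\<close>

lemma distr_eq_gamma: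
  assumes M: "prob_space M" and X [measurable]: "X \<in> borel_measurable M" and pos: "AE \<omega> in M. 0 \<le> X \<omega>"
    and a: "a > 0" and c: "c > 0"
    and L: "\<And>s. 0 \<le> s \<Longrightarrow> (LINT \<omega>|M. exp (- (s * X \<omega>))) = (1 + s * c) powr (- a)"
  shows "distr M borel X = distr (gamma_measure a) borel (\<lambda>x. c * x)"
proof -
  interpret M: prob_space M by fact
  interpret G: prob_space "gamma_measure a" using a by (rule prob_space_gamma_measure)
  let ?\<mu> = "distr M borel (\<lambda>\<omega>. (X \<omega>, 0 :: real))"
  let ?\<nu> = "distr (gamma_measure a) borel (\<lambda>x. (c * x, 0 :: real))"
  have exp_meas [measurable]: "(\<lambda>z :: real \<times> real. exp (- (s * fst z + t * snd z))) \<in> borel_measurable borel" for s t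
    by (intro borel_measurable_continuous_onI continuous_intros)
  have cl: "{z :: real \<times> real. 0 \<le> fst z \<and> 0 \<le> snd z} \<in> sets borel"
    by (intro borel_closed closed_Collect_conj closed_Collect_le continuous_intros)
  have "?\<mu> = ?\<nu>"
  proof (rule laplace_transform_unique)
    show "AE z in ?\<mu>. 0 \<le> fst z \<and> 0 \<le> snd z"
      using pos cl by (subst AE_distr_iff) auto
    show "AE z in ?\<nu>. 0 \<le> fst z \<and> 0 \<le> snd z"
      using AE_gamma_measure_pos[of a] c cl by (subst AE_distr_iff) (auto elim!: eventually_mono)
    fix s t :: real assume s: "0 \<le> s"
    have "(LINT x|gamma_measure a. exp (- (s * c * x))) = (1 + s * c) powr (- a)"
      using nn_integral_gamma_measure_exp[OF a, of "s * c"] c s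
      by (subst integral_eq_nn_integral) (simp_all add: less_le_trans[of "-1" 0])
    then show "(LINT z|?\<mu>. exp (- (s * fst z + t * snd z))) = (LINT z|?\<nu>. exp (- (s * fst z + t * snd z)))"
      by (subst (1 2) integral_distr) (simp_all add: L[OF s] mult.assoc del: minus_add_distrib)
  qed (auto intro: M.finite_measure_distr G.finite_measure_distr)
  then have "distr ?\<mu> borel fst = distr ?\<nu> borel fst" by simp
  moreover have "fst \<in> borel_measurable (borel :: (real \<times> real) measure)"
    by (intro borel_measurable_continuous_onI continuous_intros)
  ultimately show ?thesis by (simp add: distr_distr o_def)
qed

lemma gamma_measure_mgf:
  assumes a: "a > 0" and t: "t < 1"
  shows "(\<integral>\<^sup>+x. ennreal (exp (t * x)) \<partial>gamma_measure a) = ennreal ((1 - t) powr (- a))"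
  using nn_integral_gamma_measure_exp[of a "- t"] assms by simp

text \<open>Markov's inequality for \<open>exp (t * y)\<close>; with \<open>t\<close> near 1 the
  decay is almost \<open>exp (- x)\<close>, whatever the shape \<open>a\<close>.\<close>

lemma gamma_measure_tail_le:
  assumes a: "a > 0" and t: "0 \<le> t" "t < 1"
  shows "measure (gamma_measure a) {x<..} \<le> (1 - t) powr (- a) * exp (- (t * x))"
proof -
  interpret G: prob_space "gamma_measure a" using a by (rule prob_space_gamma_measure)
  have "ennreal (measure (gamma_measure a) {x<..}) = (\<integral>\<^sup>+y. indicator {x<..} y \<partial>gamma_measure a)"
    by (simp add: G.emeasure_eq_measure)
  also have "\<dots> \<le> (\<integral>\<^sup>+y. ennreal (exp (- (t * x))) * ennreal (exp (t * y)) \<partial>gamma_measure a)"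
    using t(1) by (intro nn_integral_mono)
      (auto simp: indicator_def ennreal_mult[symmetric] exp_add[symmetric] mult_left_mono)
  also have "\<dots> = ennreal ((1 - t) powr (- a) * exp (- (t * x)))"
    by (subst nn_integral_cmult, simp, subst gamma_measure_mgf[OF a t(2)])
      (simp add: ennreal_mult[symmetric] mult.commute)
  finally show ?thesis by simp
qed

text \<open>Only an interval of length 1 is kept. There \<open>y powr (a - 1)\<close> is at least
  \<open>1 / y\<close>, because \<open>y \<ge> 1\<close> and \<open>a > 0\<close>; the polynomial
  loss is harmless beside the exponential.\<close>

lemma gamma_measure_tail_ge:
  assumes a: "a > 0" and x: "x \<ge> 1"
  shows "exp (- (x + 1)) / ((x + 1) * Gamma a) \<le> measure (gamma_measure a) {x<..}"
proof -
  interpret G: prob_space "gamma_measure a" using a by (rule prob_space_gamma_measure)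
  have Ga: "Gamma a > 0" using a by (rule Gamma_real_pos)
  have le: "exp (- (x + 1)) / ((x + 1) * Gamma a) \<le> gamma_density a y" if "y \<in> {x<..x+1}" for y
  proof -
    have y: "x < y" "y \<le> x + 1" using that by auto
    have "1 / (x + 1) \<le> y powr - 1" using y x by (simp add: powr_minus_divide frac_le)
    also have "\<dots> \<le> y powr (a - 1)" using y x a by (intro powr_mono) auto
    finally have "1 / (x + 1) * exp (- (x + 1)) \<le> y powr (a - 1) * exp (- y)"
      using y x by (intro mult_mono) auto
    then have "1 / (x + 1) * exp (- (x + 1)) / Gamma a \<le> y powr (a - 1) * exp (- y) / Gamma a"
      using Ga by (intro divide_right_mono) auto
    then show ?thesis using y x by (simp add: gamma_density_def)
  qed
  have "ennreal (exp (- (x + 1)) / ((x + 1) * Gamma a)) =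
      (\<integral>\<^sup>+y. ennreal (exp (- (x + 1)) / ((x + 1) * Gamma a)) * indicator {x<..x+1} y \<partial>lborel)"
    by (simp add: nn_integral_cmult_indicator)
  also have "\<dots> \<le> (\<integral>\<^sup>+y. ennreal (gamma_density a y) * indicator {x<..} y \<partial>lborel)"
    using le by (intro nn_integral_mono) (auto simp: indicator_def ennreal_leI)
  also have "\<dots> = ennreal (measure (gamma_measure a) {x<..})"
    by (simp add: nn_integral_gamma_measure[symmetric] G.emeasure_eq_measure)
  finally show ?thesis using x Ga by (subst (asm) ennreal_le_iff) auto
qed

section \<open>A bivariate gamma law\<close>

text \<open>The weights are the coefficients of the binomial expansion of
  \<open>((1 + s) * (1 + t) - r * s * t) powr (- a)\<close> in powers of
  \<open>r / ((1 + s * (1 - r)) * (1 + t * (1 - r)))\<close>; every power is the Laplace transform of a pair of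
  independent gamma variables with parameter \<open>a + k\<close> and scale \<open>1 - r\<close>.\<close>

definition mixture_weight :: "real \<Rightarrow> real \<Rightarrow> nat \<Rightarrow> real" where
  "mixture_weight a r k = (1 - r) powr a * ((- a) gchoose k) * (- r) ^ k"

lemma mixture_weight_nonneg:
  assumes "a > 0" "0 \<le> r"
  shows "mixture_weight a r k \<ge> 0"
proof -
  have "((- a) gchoose k) * (- r) ^ k = pochhammer a k / fact k * r ^ k"
    by (simp add: gbinomial_pochhammer power_mult_distrib[symmetric] mult.assoc[symmetric])
  then show ?thesis
    using assms pochhammer_nonneg[of a k]
    unfolding mixture_weight_def mult.assoc by (simp add: zero_le_mult_iff)
qed

text \<open>Newton's binomial series. The case \<open>B = 1\<close> shows that the weights, which
  are negative binomial, have total mass 1; the general case gives the Laplace transform of the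
  mixture.\<close>

lemma mixture_weight_sums:
  assumes "0 \<le> r" "r < B"
  shows "(\<lambda>k. mixture_weight a r k * B powr (- a - real k)) sums ((1 - r) powr a * (B - r) powr (- a))"
proof -
  have "(\<lambda>k. ((- a) gchoose k) * (- r) ^ k * B powr (- a - real k)) sums (- r + B) powr (- a)"
    using assms by (intro gen_binomial_real') simp
  from sums_mult[OF this, of "(1 - r) powr a"] show ?thesis
    by (simp add: mixture_weight_def mult_ac)
qed

text \<open>The countable mixture is encoded as a single density, so that sums of measures are
  avoided; the pushforward applies the scale \<open>1 - r\<close> common to all components.\<close>

definition mixture_measure :: "real \<Rightarrow> real \<Rightarrow> (real \<times> real) measure" where
  "mixture_measure a r = distr (density lborel (\<lambda>z. \<Sum>k. ennreal (mixture_weight a r k) *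
      (ennreal (gamma_density (a + real k) (fst z)) * ennreal (gamma_density (a + real k) (snd z)))))
    borel (\<lambda>z. ((1 - r) * fst z, (1 - r) * snd z))"

lemma sets_mixture_measure [simp, measurable_cong]: "sets (mixture_measure a r) = sets borel"
  by (simp add: mixture_measure_def)

lemma nn_integral_mixture_measure:
  assumes a: "a > 0" and r: "0 \<le> r"
    and f [measurable]: "f \<in> borel_measurable borel" and g [measurable]: "g \<in> borel_measurable borel"
  shows "(\<integral>\<^sup>+z. f (fst z) * g (snd z) \<partial>mixture_measure a r) =
    (\<Sum>k. ennreal (mixture_weight a r k) *
      ((\<integral>\<^sup>+x. f ((1 - r) * x) \<partial>gamma_measure (a + real k)) * (\<integral>\<^sup>+y. g ((1 - r) * y) \<partial>gamma_measure (a + real k))))"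
proof -
  have [measurable]: "(\<lambda>z :: real \<times> real. ((1 - r) * fst z, (1 - r) * snd z)) \<in> borel_measurable borel"
    by (intro borel_measurable_continuous_onI continuous_intros)
  have [measurable]: "fst \<in> borel_measurable (borel :: (real \<times> real) measure)" 
    "snd \<in> borel_measurable (borel :: (real \<times> real) measure)"
    by (intro borel_measurable_continuous_onI continuous_intros)+
  define d where "d k = gamma_density (a + real k)" for k
  have [measurable]: "d k \<in> borel_measurable borel" for k unfolding d_def by measurable
  have "(\<integral>\<^sup>+z. f (fst z) * g (snd z) \<partial>mixture_measure a r) =
    (\<integral>\<^sup>+z. (\<Sum>k. ennreal (mixture_weight a r k) * (ennreal (d k (fst z)) * ennreal (d k (snd z)))) *
        (f ((1 - r) * fst z) * g ((1 - r) * snd z)) \<partial>lborel)"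
    unfolding mixture_measure_def d_def by (subst nn_integral_distr) (simp_all add: nn_integral_density)
  also have "\<dots> = (\<integral>\<^sup>+z. (\<Sum>k. ennreal (mixture_weight a r k) *
      ((ennreal (d k (fst z)) * f ((1 - r) * fst z)) * (ennreal (d k (snd z)) * g ((1 - r) * snd z)))) \<partial>lborel)"
    unfolding ennreal_suminf_multc[symmetric] by (intro nn_integral_cong suminf_cong) (simp add: mult_ac)
  also have "\<dots> = (\<Sum>k. \<integral>\<^sup>+z. ennreal (mixture_weight a r k) *
      ((ennreal (d k (fst z)) * f ((1 - r) * fst z)) * (ennreal (d k (snd z)) * g ((1 - r) * snd z))) \<partial>lborel)"
    by (subst nn_integral_suminf) auto
  also have "\<dots> = (\<Sum>k. ennreal (mixture_weight a r k) *
      ((\<integral>\<^sup>+x. ennreal (d k x) * f ((1 - r) * x) \<partial>lborel) * (\<integral>\<^sup>+x. ennreal (d k x) * g ((1 - r) * x) \<partial>lborel)))"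
  proof (intro suminf_cong)
    fix k
    have "(\<integral>\<^sup>+z. ennreal (d k (fst z)) * f ((1 - r) * fst z) * (ennreal (d k (snd z)) * g ((1 - r) * snd z)) \<partial>lborel)
       = (\<integral>\<^sup>+z. ennreal (d k (fst z)) * f ((1 - r) * fst z) * (ennreal (d k (snd z)) * g ((1 - r) * snd z)) \<partial>(lborel \<Otimes>\<^sub>M lborel))"
      by (simp add: lborel_prod)
    also have "\<dots> = (\<integral>\<^sup>+x. \<integral>\<^sup>+y. ennreal (d k x) * f ((1 - r) * x) * (ennreal (d k y) * g ((1 - r) * y)) \<partial>lborel \<partial>lborel)"
      by (subst lborel.nn_integral_fst[symmetric]) simp_all
    also have "\<dots> = (\<integral>\<^sup>+x. ennreal (d k x) * f ((1 - r) * x) \<partial>lborel) * (\<integral>\<^sup>+y. ennreal (d k y) * g ((1 - r) * y) \<partial>lborel)"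
      by (simp add: nn_integral_cmult nn_integral_multc)
    finally show "(\<integral>\<^sup>+z. ennreal (mixture_weight a r k) *
      ((ennreal (d k (fst z)) * f ((1 - r) * fst z)) * (ennreal (d k (snd z)) * g ((1 - r) * snd z))) \<partial>lborel)
      = ennreal (mixture_weight a r k) *
      ((\<integral>\<^sup>+x. ennreal (d k x) * f ((1 - r) * x) \<partial>lborel) * (\<integral>\<^sup>+x. ennreal (d k x) * g ((1 - r) * x) \<partial>lborel))"
      by (subst nn_integral_cmult) auto
  qed
  finally show ?thesis by (simp add: nn_integral_gamma_measure d_def)
qed

lemma AE_mixture_measure_nonneg:
  assumes "r < 1"
  shows "AE z in mixture_measure a r. 0 \<le> fst z \<and> 0 \<le> snd z"
proof -
  have [measurable]: "(\<lambda>z :: real \<times> real. ((1 - r) * fst z, (1 - r) * snd z)) \<in> borel_measurable borel"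
    by (intro borel_measurable_continuous_onI continuous_intros)
  have [measurable]: "fst \<in> borel_measurable (borel :: (real \<times> real) measure)" 
    "snd \<in> borel_measurable (borel :: (real \<times> real) measure)"
    by (intro borel_measurable_continuous_onI continuous_intros)+
  have cl: "{z :: real \<times> real. 0 \<le> fst z \<and> 0 \<le> snd z} \<in> sets borel"
    by (intro borel_closed closed_Collect_conj closed_Collect_le continuous_intros)
  have "AE z in lborel. 0 < (\<Sum>k. ennreal (mixture_weight a r k) *
      (ennreal (gamma_density (a + real k) (fst z)) * ennreal (gamma_density (a + real k) (snd z)))) \<longrightarrow>
      0 \<le> fst z \<and> 0 \<le> snd z"
  proof (intro AE_I2 impI, rule ccontr)
    fix z :: "real \<times> real" assume "\<not> (0 \<le> fst z \<and> 0 \<le> snd z)"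
      and *: "0 < (\<Sum>k. ennreal (mixture_weight a r k) *
      (ennreal (gamma_density (a + real k) (fst z)) * ennreal (gamma_density (a + real k) (snd z))))"
    then have "ennreal (gamma_density (a + real k) (fst z)) * ennreal (gamma_density (a + real k) (snd z)) = 0" for k
      by (auto simp: gamma_density_def)
    with * show False by simp
  qed
  then show ?thesis
    unfolding mixture_measure_def using assms cl
    by (subst AE_distr_iff) (auto simp: AE_density zero_le_mult_iff)
qed

lemma mixture_measure_laplace:
  assumes a: "a > 0" and r: "0 \<le> r" "r < 1" and s: "0 \<le> s" "0 \<le> t"
  shows "(\<integral>\<^sup>+z. ennreal (exp (- (s * fst z))) * ennreal (exp (- (t * snd z))) \<partial>mixture_measure a r) =
    ennreal (((1 + s) * (1 + t) - r * s * t) powr (- a))"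
proof -
  define B where "B = (1 + s * (1 - r)) * (1 + t * (1 - r))"
  have B1: "B \<ge> 1" using r s mult_mono[of 1 "1 + s * (1 - r)" 1 "1 + t * (1 - r)"] by (simp add: B_def)
  \<comment> \<open>The identity behind the mixture: its factor \<open>1 - r\<close> cancels the
    normalisation \<open>(1 - r) powr a\<close> of the weights.\<close>
  have B: "B - r = (1 - r) * ((1 + s) * (1 + t) - r * s * t)"
    by (simp add: B_def algebra_simps)
  have D: "(1 + s) * (1 + t) - r * s * t > 0" using B B1 r by (metis diff_gt_0_iff_gt less_le_trans zero_less_mult_pos)
  have *: "(\<integral>\<^sup>+x. ennreal (exp (- (u * ((1 - r) * x)))) \<partial>gamma_measure (a + real k)) = ennreal ((1 + u * (1 - r)) powr (- (a + real k)))"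
    if "u \<ge> 0" for u k
    using nn_integral_gamma_measure_exp[of "a + real k" "u * (1 - r)"] a r that
    by (simp add: mult.assoc less_le_trans[of "-1" 0])
  have "(\<integral>\<^sup>+z. ennreal (exp (- (s * fst z))) * ennreal (exp (- (t * snd z))) \<partial>mixture_measure a r) =
    (\<Sum>k. ennreal (mixture_weight a r k) * (ennreal ((1 + s * (1 - r)) powr (- (a + real k))) * ennreal ((1 + t * (1 - r)) powr (- (a + real k)))))"
    using * s a r by (subst nn_integral_mixture_measure) auto
  also have "\<dots> = (\<Sum>k. ennreal (mixture_weight a r k * B powr (- a - real k)))"
    using s r mixture_weight_nonneg[OF a r(1)] unfolding B_def
    by (intro suminf_cong) (simp add: ennreal_mult[symmetric] powr_mult)
  also have "\<dots> = ennreal ((1 - r) powr a * (B - r) powr (- a))"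
    using mixture_weight_sums[OF r(1), of B a] B1 r mixture_weight_nonneg[OF a r(1)]
    by (intro suminf_ennreal_eq) auto
  also have "(1 - r) powr a * (B - r) powr (- a) = ((1 + s) * (1 + t) - r * s * t) powr (- a)"
    using r D unfolding B by (simp add: powr_mult powr_minus)
  finally show ?thesis .
qed

lemma distr_eq_mixture:
  assumes M: "prob_space M" and X [measurable]: "X \<in> borel_measurable M" "Y \<in> borel_measurable M"
    and pos: "AE \<omega> in M. 0 \<le> X \<omega>" "AE \<omega> in M. 0 \<le> Y \<omega>"
    and a: "a > 0" and r: "0 \<le> r" "r < 1"
    and L: "\<And>s t. 0 \<le> s \<Longrightarrow> 0 \<le> t \<Longrightarrow>
      (LINT \<omega>|M. exp (- (s * X \<omega> + t * Y \<omega>))) = ((1 + s) * (1 + t) - r * s * t) powr (- a)"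
  shows "distr M borel (\<lambda>\<omega>. (X \<omega>, Y \<omega>)) = mixture_measure a r"
proof -
  interpret M: prob_space M by fact
  have [measurable]: "(\<lambda>z :: real \<times> real. exp (- (s * fst z + t * snd z))) \<in> borel_measurable borel" for s t
    by (intro borel_measurable_continuous_onI continuous_intros)
  have cl: "{z :: real \<times> real. 0 \<le> fst z \<and> 0 \<le> snd z} \<in> sets borel"
    by (intro borel_closed closed_Collect_conj closed_Collect_le continuous_intros)
  note nn = mixture_measure_laplace[OF a r]
  show ?thesis
  proof (rule laplace_transform_unique)
    show "finite_measure (mixture_measure a r)"
      using nn[of 0 0] by (intro finite_measureI) simp
    show "AE z in distr M borel (\<lambda>\<omega>. (X \<omega>, Y \<omega>)). 0 \<le> fst z \<and> 0 \<le> snd z"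
      using pos cl by (subst AE_distr_iff) auto
    show "AE z in mixture_measure a r. 0 \<le> fst z \<and> 0 \<le> snd z"
      using r by (intro AE_mixture_measure_nonneg)
    fix s t :: real assume s: "0 \<le> s" "0 \<le> t"
    have "(LINT z|mixture_measure a r. exp (- (s * fst z + t * snd z))) = ((1 + s) * (1 + t) - r * s * t) powr (- a)"
    proof -
      have "exp (- (s * fst z + t * snd z)) = exp (- (s * fst z)) * exp (- (t * snd z))" for z :: "real \<times> real"
        by (simp add: exp_add[symmetric])
      moreover have "(\<lambda>z. exp (- (s * fst z)) * exp (- (t * snd z))) \<in> borel_measurable (mixture_measure a r)"
        unfolding calculation[symmetric] by measurable
      ultimately show ?thesis
        using nn[OF s] by (subst integral_eq_nn_integral) (simp_all add: ennreal_mult del: minus_add_distrib)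
    qed
    then show "(LINT z|distr M borel (\<lambda>\<omega>. (X \<omega>, Y \<omega>)). exp (- (s * fst z + t * snd z))) =
      (LINT z|mixture_measure a r. exp (- (s * fst z + t * snd z)))"
      by (subst integral_distr) (simp_all add: L[OF s] del: minus_add_distrib)
  qed (simp_all add: M.finite_measure_distr)
qed

text \<open>The leading term of the mixture is dominated by the product of the marginal tails; the other
  terms have total weight \<open>1 - (1 - r) powr a\<close>, which makes the two tail events nearly independent
  when \<open>r\<close> is small.\<close>

lemma tail_events_nearly_independent:
  assumes M: "prob_space M" and X [measurable]: "X \<in> borel_measurable M" "Y \<in> borel_measurable M"
    and pos: "AE \<omega> in M. 0 \<le> X \<omega>" "AE \<omega> in M. 0 \<le> Y \<omega>"
    and a: "a > 0" and r: "0 \<le> r" "r < 1" and xy: "x \<ge> 0" "y \<ge> 0"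
    and L: "\<And>s t. 0 \<le> s \<Longrightarrow> 0 \<le> t \<Longrightarrow>
      (LINT \<omega>|M. exp (- (s * X \<omega> + t * Y \<omega>))) = ((1 + s) * (1 + t) - r * s * t) powr (- a)"
  shows "measure M {\<omega> \<in> space M. x < X \<omega> \<and> y < Y \<omega>} \<le>
    measure (gamma_measure a) {x<..} * measure (gamma_measure a) {y<..} + (1 - (1 - r) powr a)"
proof -
  interpret M: prob_space M by fact
  have D: "distr M borel (\<lambda>\<omega>. (X \<omega>, Y \<omega>)) = mixture_measure a r"
    by (rule distr_eq_mixture[OF M X pos a r]) (rule L)
  have G: "prob_space (gamma_measure (a + real k))" for k using a by (intro prob_space_gamma_measure) simp
  have G0: "prob_space (gamma_measure a)" using G[of 0] by simp
  have q1: "(1 - r) * u \<le> u" if "u \<ge> 0" for u using that r by (simp add: algebra_simps)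
  define w where "w = mixture_weight a r"
  have w0: "w k \<ge> 0" for k unfolding w_def by (rule mixture_weight_nonneg[OF a r(1)])
  have wsum: "w sums 1"
    using mixture_weight_sums[of r 1 a] r by (simp add: w_def powr_minus)
  have wz: "w 0 = (1 - r) powr a" by (simp add: w_def mixture_weight_def)
  have wz1: "w 0 \<le> 1" unfolding wz using r a by (simp add: powr_le1)
  define p where "p = measure (gamma_measure a) {x<..} * measure (gamma_measure a) {y<..}"
  have p0: "p \<ge> 0" by (simp add: p_def)
  define b where "b k = (if k = 0 then p else w k)" for k
  have bsum: "b sums (1 - w 0 + p)"
  proof -
    have "(\<lambda>k. b (Suc k)) sums (1 - w 0)"
      using wsum by (simp add: b_def sums_Suc_iff)
    then show ?thesis unfolding sums_Suc_iff by (simp add: b_def[of 0])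
  qed
  \<comment> \<open>Shrinking a variable by \<open>1 - r\<close> can only lower its tail, so the
    scale is dropped from the bounds.\<close>
  have I: "(\<integral>\<^sup>+v. indicator {u<..} ((1 - r) * v) \<partial>gamma_measure (a + real k)) \<le> ennreal (measure (gamma_measure (a + real k)) {u<..})"
    if "u \<ge> 0" for u k
  proof -
    interpret G: prob_space "gamma_measure (a + real k)" by (rule G)
    have "(\<integral>\<^sup>+v. indicator {u<..} ((1 - r) * v) \<partial>gamma_measure (a + real k)) \<le> (\<integral>\<^sup>+v. indicator {u<..} v \<partial>gamma_measure (a + real k))"
    proof (intro nn_integral_mono)
      fix v
      have "u < v" if "u < (1 - r) * v"
      proof -
        have "0 < v" using \<open>u \<ge> 0\<close> that r by (metis diff_gt_0_iff_gt le_less_trans zero_less_mult_pos)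
        then show ?thesis using that q1[of v] by linarith
      qed
      then show "(indicator {u<..} ((1 - r) * v) :: ennreal) \<le> indicator {u<..} v"
        by (auto simp: indicator_def)
    qed
    then show ?thesis by (simp add: G.emeasure_eq_measure)
  qed
  have [measurable]: "fst \<in> borel_measurable (borel :: (real \<times> real) measure)" 
    "snd \<in> borel_measurable (borel :: (real \<times> real) measure)"
    by (intro borel_measurable_continuous_onI continuous_intros)+
  have "ennreal (measure M {\<omega> \<in> space M. x < X \<omega> \<and> y < Y \<omega>}) = (\<integral>\<^sup>+\<omega>. indicator {x<..} (X \<omega>) * indicator {y<..} (Y \<omega>) \<partial>M)"
    by (subst nn_integral_cong[where v = "indicator {\<omega> \<in> space M. x < X \<omega> \<and> y < Y \<omega>}"])
       (auto simp: indicator_def M.emeasure_eq_measure)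
  also have "\<dots> = (\<integral>\<^sup>+z. indicator {x<..} (fst z) * indicator {y<..} (snd z) \<partial>mixture_measure a r)"
    unfolding D[symmetric] by (subst nn_integral_distr) auto
  also have "\<dots> = (\<Sum>k. ennreal (w k) *
      ((\<integral>\<^sup>+v. indicator {x<..} ((1 - r) * v) \<partial>gamma_measure (a + real k)) * (\<integral>\<^sup>+v. indicator {y<..} ((1 - r) * v) \<partial>gamma_measure (a + real k))))"
    unfolding w_def using a r by (subst nn_integral_mixture_measure) auto
  also have "\<dots> \<le> (\<Sum>k. ennreal (b k))"
  proof (intro suminf_le allI)
    fix k
    have "ennreal (w k) * ((\<integral>\<^sup>+v. indicator {x<..} ((1 - r) * v) \<partial>gamma_measure (a + real k)) * (\<integral>\<^sup>+v. indicator {y<..} ((1 - r) * v) \<partial>gamma_measure (a + real k)))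
      \<le> ennreal (w k) * (ennreal (measure (gamma_measure (a + real k)) {x<..}) * ennreal (measure (gamma_measure (a + real k)) {y<..}))"
      using xy by (intro mult_mono I) auto
    also have "\<dots> = ennreal (w k * (measure (gamma_measure (a + real k)) {x<..} * measure (gamma_measure (a + real k)) {y<..}))"
      using w0 by (simp add: ennreal_mult)
    also have "\<dots> \<le> ennreal (b k)"
    proof (rule ennreal_leI)
      show "w k * (measure (gamma_measure (a + real k)) {x<..} * measure (gamma_measure (a + real k)) {y<..}) \<le> b k"
      proof (cases "k = 0")
        case True
        then show ?thesis using wz1 p0 w0 by (simp add: b_def p_def mult_left_le_one_le)
      next
        case False
        have "measure (gamma_measure (a + real k)) {x<..} * measure (gamma_measure (a + real k)) {y<..} \<le> 1"
          using G[of k] by (intro mult_le_one) (auto simp: prob_space.prob_le_1)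
        then show ?thesis using False w0[of k] by (simp add: b_def mult_left_le)
      qed
    qed
    finally show "ennreal (w k) * ((\<integral>\<^sup>+v. indicator {x<..} ((1 - r) * v) \<partial>gamma_measure (a + real k)) * (\<integral>\<^sup>+v. indicator {y<..} ((1 - r) * v) \<partial>gamma_measure (a + real k)))
      \<le> ennreal (b k)" .
  qed auto
  also have "\<dots> = ennreal (1 - w 0 + p)"
  proof (rule suminf_ennreal_eq[OF _ bsum])
    show "0 \<le> b k" for k using w0 p0 by (simp add: b_def)
  qed
  finally show ?thesis using wz1 p0 by (subst (asm) ennreal_le_iff) (auto simp: wz p_def)
qed

text \<open>Weighting the measure by \<open>exp (- (l * Y))\<close> turns \<open>X\<close> into a scaled gamma variable, whose moment
  generating function is explicit.\<close>

lemma exp_diff_moment: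
  assumes M: "prob_space M" and X [measurable]: "X \<in> borel_measurable M" "Y \<in> borel_measurable M"
    and pos: "AE \<omega> in M. 0 \<le> X \<omega>"
    and \<alpha>: "\<alpha> > 0" and ab: "a > 0" "b > 0" "e \<le> a * b" and l: "l > 0"
    and p: "0 < 1 - l * (a - b) - l\<^sup>2 * (a * b - e)"
    and L: "\<And>s t. 0 \<le> s \<Longrightarrow> 0 \<le> t \<Longrightarrow>
      (LINT \<omega>|M. exp (- (s * X \<omega> + t * Y \<omega>))) = ((1 + s * a) * (1 + t * b) - s * t * e) powr (- \<alpha>)"
  shows "(\<integral>\<^sup>+\<omega>. ennreal (exp (l * (X \<omega> - Y \<omega>))) \<partial>M) =
    ennreal ((1 - l * (a - b) - l\<^sup>2 * (a * b - e)) powr (- \<alpha>))"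
proof -
  interpret M: prob_space M by fact
  \<comment> \<open>At \<open>t = l\<close> the base of the transform is affine in \<open>s\<close>,
    namely \<open>B + s * A\<close>. Division by its value \<open>B\<close> at \<open>s = 0\<close>
    leaves the transform of a gamma variable of scale \<open>A / B\<close>.\<close>
  define B where "B = 1 + l * b"
  define A where "A = a + l * (a * b - e)"
  have B: "B > 0" and A: "A > 0" using ab l by (auto simp: A_def B_def intro!: add_pos_nonneg)
  have LA: "(LINT \<omega>|M. exp (- (s * X \<omega> + l * Y \<omega>))) = (B + s * A) powr (- \<alpha>)" if "s \<ge> 0" for s
    using L[OF that, of l] l by (simp add: A_def B_def algebra_simps)
  \<comment> \<open>A non-integrable function has integral 0 by convention, whereas this transform
    is positive.\<close>
  have int: "integrable M (\<lambda>\<omega>. exp (- (s * X \<omega> + l * Y \<omega>)))" if "s \<ge> 0" for s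
  proof (rule ccontr)
    assume "\<not> ?thesis"
    then have "(B + s * A) powr (- \<alpha>) = 0" unfolding LA[OF that, symmetric] by (rule not_integrable_integral_eq)
    moreover have "B + s * A > 0" using A B that by (simp add: add_pos_nonneg)
    ultimately show False by simp
  qed
  define M' where "M' = density M (\<lambda>\<omega>. ennreal (B powr \<alpha> * exp (- (l * Y \<omega>))))"
  have M'm [measurable_cong]: "sets M' = sets M" by (simp add: M'_def)
  have LM': "(LINT \<omega>|M'. exp (- (s * X \<omega>))) = (1 + s * (A / B)) powr (- \<alpha>)" if s: "s \<ge> 0" for s
  proof -
    have "(LINT \<omega>|M'. exp (- (s * X \<omega>))) = (LINT \<omega>|M. B powr \<alpha> * exp (- (s * X \<omega> + l * Y \<omega>)))"
      unfolding M'_def by (subst integral_density) (auto simp: exp_add[symmetric] algebra_simps intro!: Bochner_Integration.integral_cong)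
    also have "\<dots> = B powr \<alpha> * (B + s * A) powr (- \<alpha>)" by (simp only: integral_mult_right_zero LA[OF s])
    also have "\<dots> = ((B + s * A) / B) powr (- \<alpha>)"
      using A B s by (simp add: powr_divide powr_minus add_pos_nonneg less_imp_le divide_simps)
    also have "(B + s * A) / B = 1 + s * (A / B)" using B by (simp add: field_simps)
    finally show ?thesis .
  qed
  have pM': "prob_space M'"
  proof (rule prob_spaceI)
    have "emeasure M' (space M') = (\<integral>\<^sup>+\<omega>. ennreal (B powr \<alpha> * exp (- (0 * X \<omega> + l * Y \<omega>))) \<partial>M)"
      unfolding M'_def by (simp add: emeasure_density cong: nn_integral_cong)
    also have "\<dots> = ennreal (LINT \<omega>|M. B powr \<alpha> * exp (- (0 * X \<omega> + l * Y \<omega>)))"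
      by (intro nn_integral_eq_integral integrable_mult_right int) auto
    also have "\<dots> = ennreal (B powr \<alpha> * B powr (- \<alpha>))" using LA[of 0] by simp
    finally show "emeasure M' (space M') = 1" using B by (simp add: powr_minus)
  qed
  have law: "distr M' borel X = distr (gamma_measure \<alpha>) borel (\<lambda>x. A / B * x)"
  proof (rule distr_eq_gamma[OF pM' _ _ \<alpha> _ LM'])
    show "AE \<omega> in M'. 0 \<le> X \<omega>"
      unfolding M'_def using pos by (subst AE_density) auto
  qed (use A B in auto)
  have AB: "l * (A / B) < 1"
    using p B by (simp add: A_def B_def field_simps power2_eq_square)
  have "(\<integral>\<^sup>+\<omega>. ennreal (exp (l * (X \<omega> - Y \<omega>))) \<partial>M) =
      ennreal (B powr (- \<alpha>)) * (\<integral>\<^sup>+\<omega>. ennreal (exp (l * X \<omega>)) \<partial>M')"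
    unfolding M'_def using B
    by (subst nn_integral_density)
      (auto simp: nn_integral_cmult[symmetric] ennreal_mult[symmetric] exp_diff exp_minus powr_minus
        right_diff_distrib divide_simps intro!: nn_integral_cong)
  also have "(\<integral>\<^sup>+\<omega>. ennreal (exp (l * X \<omega>)) \<partial>M') = (\<integral>\<^sup>+x. ennreal (exp (l * x)) \<partial>distr M' borel X)"
    by (subst nn_integral_distr) auto
  also have "\<dots> = (\<integral>\<^sup>+x. ennreal (exp (l * (A / B) * x)) \<partial>gamma_measure \<alpha>)"
    unfolding law by (subst nn_integral_distr) (auto simp: mult.assoc)
  also have "\<dots> = ennreal ((1 - l * (A / B)) powr (- \<alpha>))"
    by (rule gamma_measure_mgf[OF \<alpha> AB])
  also have "ennreal (B powr (- \<alpha>)) * \<dots> = ennreal ((B * (1 - l * (A / B))) powr (- \<alpha>))"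
    using B AB by (simp add: ennreal_mult[symmetric] powr_mult)
  also have "B * (1 - l * (A / B)) = 1 - l * (a - b) - l\<^sup>2 * (a * b - e)"
    using B by (simp add: field_simps) (simp add: A_def B_def algebra_simps power2_eq_square)
  finally show ?thesis .
qed

text \<open>Markov's inequality with exponential parameter \<open>1 / D\<close>. Each of the two
  bounds in terms of \<open>D\<close> takes at most 1/4 off the base 1, so the exponential moment is
  at most \<open>(1 / 2) powr (- \<alpha>)\<close>.\<close>

lemma diff_tail_one_sided:
  assumes M: "prob_space M" and X [measurable]: "X \<in> borel_measurable M" "Y \<in> borel_measurable M"
    and pos: "AE \<omega> in M. 0 \<le> X \<omega>"
    and \<alpha>: "\<alpha> > 0" and ab: "a > 0" "b > 0" "e \<le> a * b"
    and D: "D > 0" "\<bar>a - b\<bar> \<le> D / 4" "a * b - e \<le> D\<^sup>2 / 4"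
    and L: "\<And>s t. 0 \<le> s \<Longrightarrow> 0 \<le> t \<Longrightarrow>
      (LINT \<omega>|M. exp (- (s * X \<omega> + t * Y \<omega>))) = ((1 + s * a) * (1 + t * b) - s * t * e) powr (- \<alpha>)"
  shows "measure M {\<omega> \<in> space M. x < X \<omega> - Y \<omega>} \<le> 2 powr \<alpha> * exp (- (x / D))"
proof -
  interpret M: prob_space M by fact
  define P where "P = 1 - (1 / D) * (a - b) - (1 / D)\<^sup>2 * (a * b - e)"
  have P: "1 / 2 \<le> P"
  proof -
    have "(1 / D) * (a - b) \<le> (1 / D) * (D / 4)"
      using D(1) abs_le_D1[OF D(2)] by (intro mult_left_mono) auto
    moreover have "(1 / D)\<^sup>2 * (a * b - e) \<le> (1 / D)\<^sup>2 * (D\<^sup>2 / 4)"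
      using D by (intro mult_left_mono) auto
    moreover have "(1 / D) * (D / 4) = 1 / 4" "(1 / D)\<^sup>2 * (D\<^sup>2 / 4) = 1 / 4"
      using D by (simp_all add: power_divide)
    ultimately show ?thesis unfolding P_def by linarith
  qed
  have "P powr (- \<alpha>) \<le> (1 / 2) powr (- \<alpha>)" using P \<alpha> by (intro powr_mono2') auto
  also have "\<dots> = 2 powr \<alpha>" by (simp add: powr_minus powr_divide)
  finally have P2: "P powr (- \<alpha>) \<le> 2 powr \<alpha>" .
  have mgf: "(\<integral>\<^sup>+\<omega>. ennreal (exp (1 / D * (X \<omega> - Y \<omega>))) \<partial>M) = ennreal (P powr (- \<alpha>))"
    unfolding P_def
  proof (rule exp_diff_moment[OF M X pos \<alpha> ab])
    show "0 < 1 - 1 / D * (a - b) - (1 / D)\<^sup>2 * (a * b - e)" using P unfolding P_def by linarith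
  qed (use D(1) L in auto)
  have "ennreal (measure M {\<omega> \<in> space M. x < X \<omega> - Y \<omega>}) = (\<integral>\<^sup>+\<omega>. indicator {\<omega> \<in> space M. x < X \<omega> - Y \<omega>} \<omega> \<partial>M)"
    by (simp add: M.emeasure_eq_measure)
  also have "\<dots> \<le> (\<integral>\<^sup>+\<omega>. ennreal (exp (- (x / D))) * ennreal (exp (1 / D * (X \<omega> - Y \<omega>))) \<partial>M)"
    using D by (intro nn_integral_mono)
      (auto simp: indicator_def ennreal_mult[symmetric] exp_add[symmetric] divide_simps)
  also have "\<dots> = ennreal (exp (- (x / D)) * P powr (- \<alpha>))"
    by (subst nn_integral_cmult, simp, subst mgf) (simp add: ennreal_mult[symmetric])
  also have "\<dots> \<le> ennreal (2 powr \<alpha> * exp (- (x / D)))"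
    using P2 by (intro ennreal_leI) (simp add: mult.commute)
  finally show ?thesis by simp
qed

lemma diff_tail:
  assumes M: "prob_space M" and X [measurable]: "X \<in> borel_measurable M" "Y \<in> borel_measurable M"
    and pos: "AE \<omega> in M. 0 \<le> X \<omega>" "AE \<omega> in M. 0 \<le> Y \<omega>"
    and \<alpha>: "\<alpha> > 0" and ab: "a > 0" "b > 0" "e \<le> a * b"
    and D: "D > 0" "\<bar>a - b\<bar> \<le> D / 4" "a * b - e \<le> D\<^sup>2 / 4"
    and L: "\<And>s t. 0 \<le> s \<Longrightarrow> 0 \<le> t \<Longrightarrow>
      (LINT \<omega>|M. exp (- (s * X \<omega> + t * Y \<omega>))) = ((1 + s * a) * (1 + t * b) - s * t * e) powr (- \<alpha>)"
  shows "measure M {\<omega> \<in> space M. x < \<bar>X \<omega> - Y \<omega>\<bar>} \<le> 2 * 2 powr \<alpha> * exp (- (x / D))"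
proof -
  interpret M: prob_space M by fact
  have L': "(LINT \<omega>|M. exp (- (s * Y \<omega> + t * X \<omega>))) = ((1 + s * b) * (1 + t * a) - s * t * e) powr (- \<alpha>)"
    if "0 \<le> s" "0 \<le> t" for s t
    using L[OF that(2,1)] by (simp add: algebra_simps)
  have "{\<omega> \<in> space M. x < \<bar>X \<omega> - Y \<omega>\<bar>} = {\<omega> \<in> space M. x < X \<omega> - Y \<omega>} \<union> {\<omega> \<in> space M. x < Y \<omega> - X \<omega>}"
    by auto
  moreover have "{\<omega> \<in> space M. x < X \<omega> - Y \<omega>} \<in> sets M" "{\<omega> \<in> space M. x < Y \<omega> - X \<omega>} \<in> sets M"
    by measurable
  note measure_Un_le[OF this]
  ultimately have "measure M {\<omega> \<in> space M. x < \<bar>X \<omega> - Y \<omega>\<bar>} \<le>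
      measure M {\<omega> \<in> space M. x < X \<omega> - Y \<omega>} + measure M {\<omega> \<in> space M. x < Y \<omega> - X \<omega>}" by (simp only:)
  moreover have "measure M {\<omega> \<in> space M. x < X \<omega> - Y \<omega>} \<le> 2 powr \<alpha> * exp (- (x / D))"
    by (rule diff_tail_one_sided[OF M X pos(1) \<alpha> ab D]) (rule L)
  moreover have "measure M {\<omega> \<in> space M. x < Y \<omega> - X \<omega>} \<le> 2 powr \<alpha> * exp (- (x / D))"
    using D ab by (intro diff_tail_one_sided[OF M X(2,1) pos(2) \<alpha> _ _ _ _ _ _ L'])
      (auto simp: mult.commute abs_minus_commute)
  ultimately show ?thesis by simp
qed

section \<open>One- and two-dimensional marginals of permanental sequences\<close>

lemma det_mat_2:
  fixes A :: "'a :: comm_ring_1 mat"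
  assumes "A \<in> carrier_mat 2 2"
  shows "Determinant.det A = A $$ (0,0) * A $$ (1,1) - A $$ (0,1) * A $$ (1,0)"
proof -
  have c: "cofactor A 0 0 = A $$ (1,1)" "cofactor A 1 0 = - (A $$ (0,1))"
    using assms by (auto simp: cofactor_def mat_delete_def det_single)
  show ?thesis
    unfolding laplace_expansion_column[OF assms, of 0, simplified] 
    using c by (simp add: numeral_2_eq_2 mult.commute)
qed

lemma permanental_sequence_prob: "permanental_sequence M \<alpha> K Z \<Longrightarrow> prob_space M"
  and permanental_sequence_measurable: "permanental_sequence M \<alpha> K Z \<Longrightarrow> 1 \<le> j \<Longrightarrow> Z j \<in> borel_measurable M"
  and permanental_sequence_nonneg: "permanental_sequence M \<alpha> K Z \<Longrightarrow> 1 \<le> j \<Longrightarrow> \<omega> \<in> space M \<Longrightarrow> 0 \<le> Z j \<omega>"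
  by (auto simp: permanental_sequence_def)

text \<open>The definition speaks of positive parameters only; the uniqueness results need the
  boundary value 0 too, which is the total mass.\<close>

lemma permanental_laplace_1:
  assumes Z: "permanental_sequence M \<alpha> K Z" and i: "1 \<le> i" and s: "0 \<le> s"
  shows "(LINT \<omega>|M. exp (- (s * Z i \<omega>))) = (1 + s * K i i) powr (- \<alpha>)"
proof (cases "s = 0")
  case True
  then show ?thesis using permanental_sequence_prob[OF Z] by (simp add: prob_space.prob_space)
next
  case False
  let ?A = "1\<^sub>m 1 + mat 1 1 (\<lambda>(p, q). K i i) * diagonal_mat_of 1 (\<lambda>_. s)"
  have "Determinant.det ?A = 1 + s * K i i"
    by (subst det_single) (auto simp: diagonal_mat_of_def times_mat_def scalar_prod_def)
  moreover have "(LINT \<omega>|M. exp (- (\<Sum>m<1::nat. s * Z i \<omega>))) = Determinant.det ?A powr (- \<alpha>)"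
    by (rule Z[unfolded permanental_sequence_def, THEN conjunct2, THEN conjunct2, rule_format,
          of 1 "\<lambda>_. i" "\<lambda>_. s"])
      (use i s False in \<open>auto simp: lessThan_Suc\<close>)
  ultimately show ?thesis by (simp add: lessThan_Suc)
qed

text \<open>If one parameter vanishes, the determinant and the transform both reduce to those of the
  other variable.\<close>

lemma permanental_laplace_2:
  assumes Z: "permanental_sequence M \<alpha> K Z" and ij: "1 \<le> i" "1 \<le> j" "i \<noteq> j" and st: "0 \<le> s" "0 \<le> t"
  shows "(LINT \<omega>|M. exp (- (s * Z i \<omega> + t * Z j \<omega>))) =
    ((1 + s * K i i) * (1 + t * K j j) - s * t * (K i j * K j i)) powr (- \<alpha>)"
proof -
  consider "s = 0" | "t = 0" | "s > 0" "t > 0" using st by fastforce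
  then show ?thesis
  proof cases
    case 1
    then show ?thesis using permanental_laplace_1[OF Z ij(2) st(2)] by simp
  next
    case 2
    then show ?thesis using permanental_laplace_1[OF Z ij(1) st(1)] by simp
  next
    case 3
    define n where "n m = (if m = 0 then i else j)" for m :: nat
    define u where "u m = (if m = 0 then s else t)" for m :: nat
    let ?A = "1\<^sub>m 2 + mat 2 2 (\<lambda>(p, q). K (n p) (n q)) * diagonal_mat_of 2 u"
    have "Determinant.det ?A = (1 + s * K i i) * (1 + t * K j j) - s * t * (K i j * K j i)"
      by (subst det_mat_2)
        (auto simp: diagonal_mat_of_def times_mat_def scalar_prod_def numeral_2_eq_2 n_def u_def algebra_simps)
    moreover have "(LINT \<omega>|M. exp (- (\<Sum>m<2. u m * Z (n m) \<omega>))) = Determinant.det ?A powr (- \<alpha>)"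
    proof (rule Z[unfolded permanental_sequence_def, THEN conjunct2, THEN conjunct2, rule_format])
      show "(\<forall>m<2. 1 \<le> n m) \<and> inj_on n {..<2} \<and> (\<forall>m<2. 0 < u m)"
        using ij 3 by (auto simp: n_def u_def inj_on_def)
    qed
    moreover have "(\<Sum>m<2. u m * Z (n m) \<omega>) = s * Z i \<omega> + t * Z j \<omega>" for \<omega>
      by (simp add: numeral_2_eq_2 u_def n_def)
    ultimately show ?thesis by simp
  qed
qed

text \<open>If the principal minor were negative, the determinant would vanish for some positive parameters,
  whereas the Laplace transform never does.\<close>

lemma permanental_minor_nonneg:
  assumes Z: "permanental_sequence M \<alpha> K Z" and ij: "1 \<le> i" "1 \<le> j" "i \<noteq> j"
  shows "K i j * K j i \<le> K i i * K j j"
proof (rule ccontr)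
  assume neg: "\<not> ?thesis"
  define d where "d = K i j * K j i - K i i * K j j"
  have d: "d > 0" using neg by (simp add: d_def)
  define P where "P s = 1 + s * (K i i + K j j) - s\<^sup>2 * d" for s
  have lap: "(LINT \<omega>|M. exp (- (s * Z i \<omega> + s * Z j \<omega>))) = P s powr (- \<alpha>)" if "s \<ge> 0" for s
    using permanental_laplace_2[OF Z ij that that] by (simp add: P_def d_def power2_eq_square algebra_simps)
  \<comment> \<open>\<open>S * d\<close> exceeds the absolute value of the linear coefficient by
    \<open>1 + d\<close>, which makes the quadratic nonpositive at \<open>S\<close>; it equals 1 at
    0, so it has a zero in between.\<close>
  define S where "S = (\<bar>K i i + K j j\<bar> + 1) / d + 1"
  have S: "S \<ge> 1" using d by (simp add: S_def)
  have "P S \<le> 1 + S * \<bar>K i i + K j j\<bar> - S * (S * d)"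
    using S by (simp add: P_def power2_eq_square mult_left_mono)
  also have "S * d = \<bar>K i i + K j j\<bar> + 1 + d" using d by (simp add: S_def field_simps)
  also have "1 + S * \<bar>K i i + K j j\<bar> - S * (\<bar>K i i + K j j\<bar> + 1 + d) = 1 - S - S * d" by (simp add: algebra_simps)
  also have "\<dots> \<le> 0" using S mult_nonneg_nonneg[of S d] d by linarith
  finally have "\<exists>s\<ge>0. s \<le> S \<and> P s = 0"
    using S by (intro IVT2) (auto simp: P_def)
  then obtain s where s: "s \<ge> 0" "P s = 0" by auto
  interpret prob_space M using Z by (rule permanental_sequence_prob)
  have [measurable]: "Z i \<in> borel_measurable M" "Z j \<in> borel_measurable M"
    using Z ij by (auto intro: permanental_sequence_measurable)
  have "integrable M (\<lambda>\<omega>. exp (- (s * Z i \<omega> + s * Z j \<omega>)))"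
  proof (rule integrable_const_bound)
    show "AE \<omega> in M. norm (exp (- (s * Z i \<omega> + s * Z j \<omega>))) \<le> 1"
      using permanental_sequence_nonneg[OF Z] ij s by (intro AE_I2) (simp add: add_nonneg_nonneg del: minus_add_distrib)
  qed measurable
  moreover have "(LINT \<omega>|M. exp (- (s * Z i \<omega> + s * Z j \<omega>))) = 0" using lap[OF s(1)] s by simp
  ultimately have "AE \<omega> in M. exp (- (s * Z i \<omega> + s * Z j \<omega>)) = 0"
    by (subst (asm) integral_nonneg_eq_0_iff_AE) auto
  then show False using AE_const[of "False"] by simp
qed

lemma permanental_tail:
  assumes Z: "permanental_sequence M \<alpha> K Z" and \<alpha>: "\<alpha> > 0" and i: "1 \<le> i" and K: "0 < K i i"
  shows "measure M {\<omega> \<in> space M. x * K i i < Z i \<omega>} = measure (gamma_measure \<alpha>) {x<..}"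
proof -
  interpret prob_space M using Z by (rule permanental_sequence_prob)
  have [measurable]: "Z i \<in> borel_measurable M"
    using Z i by (auto intro: permanental_sequence_measurable)
  have D: "distr M borel (Z i) = distr (gamma_measure \<alpha>) borel (\<lambda>x. K i i * x)"
    using permanental_sequence_nonneg[OF Z i]
    by (intro distr_eq_gamma \<alpha> K permanental_laplace_1[OF Z i]) (auto intro: prob_space_axioms)
  have "measure M {\<omega> \<in> space M. x * K i i < Z i \<omega>} = measure (distr M borel (Z i)) {x * K i i<..}"
    by (subst measure_distr) (auto intro!: arg_cong[where f = "measure M"])
  also have "\<dots> = measure (gamma_measure \<alpha>) {x<..}"
    unfolding D using K by (subst measure_distr) (auto intro!: arg_cong[where f = "measure _"] simp: mult.commute)
  finally show ?thesis .
qed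

text \<open>Division by the diagonal entries brings the transform into the normal form with
  parameter \<open>\<rho>\<close>. The error increases with this parameter, so an upper bound
  \<open>r\<close> suffices.\<close>

lemma permanental_tails_nearly_independent:
  assumes Z: "permanental_sequence M \<alpha> K Z" and \<alpha>: "\<alpha> > 0" and ij: "1 \<le> i" "1 \<le> j" "i \<noteq> j"
    and K: "0 < K i i" "0 < K j j" and r: "0 \<le> K i j * K j i" "K i j * K j i \<le> r * (K i i * K j j)" "r < 1"
    and xy: "x \<ge> 0" "y \<ge> 0"
  shows "measure M {\<omega> \<in> space M. x * K i i < Z i \<omega> \<and> y * K j j < Z j \<omega>} \<le>
    measure (gamma_measure \<alpha>) {x<..} * measure (gamma_measure \<alpha>) {y<..} + (1 - (1 - r) powr \<alpha>)"
proof -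
  interpret prob_space M using Z by (rule permanental_sequence_prob)
  have [measurable]: "Z i \<in> borel_measurable M" "Z j \<in> borel_measurable M"
    using Z ij by (auto intro: permanental_sequence_measurable)
  define \<rho> where "\<rho> = K i j * K j i / (K i i * K j j)"
  have \<rho>: "0 \<le> \<rho>" "\<rho> \<le> r" using r K by (auto simp: \<rho>_def field_simps)
  have "measure M {\<omega> \<in> space M. x < Z i \<omega> / K i i \<and> y < Z j \<omega> / K j j} \<le>
    measure (gamma_measure \<alpha>) {x<..} * measure (gamma_measure \<alpha>) {y<..} + (1 - (1 - \<rho>) powr \<alpha>)"
  proof (rule tail_events_nearly_independent[OF prob_space_axioms _ _ _ _ \<alpha> _ _ xy])
    show "AE \<omega> in M. 0 \<le> Z i \<omega> / K i i" "AE \<omega> in M. 0 \<le> Z j \<omega> / K j j"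
      using K permanental_sequence_nonneg[OF Z] ij by auto
    fix s t :: real assume "0 \<le> s" "0 \<le> t"
    then show "(LINT \<omega>|M. exp (- (s * (Z i \<omega> / K i i) + t * (Z j \<omega> / K j j)))) =
        ((1 + s) * (1 + t) - \<rho> * s * t) powr (- \<alpha>)"
      using permanental_laplace_2[OF Z ij, of "s / K i i" "t / K j j"] K by (simp add: \<rho>_def mult_ac)
  qed (use \<rho> r in auto)
  also have "1 - (1 - \<rho>) powr \<alpha> \<le> 1 - (1 - r) powr \<alpha>"
    using \<rho> r \<alpha> by (simp add: powr_mono2)
  finally show ?thesis using K by (simp add: field_simps)
qed

section \<open>Renewal sequences\<close>

text \<open>For a random walk from 0 with step law \<open>w\<close> on the positive integers,
  \<open>renewal w n\<close> is the probability of a visit to \<open>n\<close>. For the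
  autoregression it is the response at lag \<open>n\<close> to a unit shock.\<close>

fun renewal :: "(nat \<Rightarrow> real) \<Rightarrow> nat \<Rightarrow> real" where
  "renewal w 0 = 1"
| "renewal w (Suc n) = (\<Sum>l\<le>n. w (Suc l) * renewal w (n - l))"

text \<open>The bound \<epsilon> is what positive decreasing weights supply: it will be the last
  weight \<open>p k\<close>. Extension by 0 beyond \<open>k\<close> allows the recursion to be a
  full convolution.\<close>

locale renewal_weights =
  fixes w :: "nat \<Rightarrow> real" and k :: nat and \<epsilon> :: real
  assumes k2: "2 \<le> k" and eps: "0 < \<epsilon>" and w_ge: "\<And>l. 1 \<le> l \<Longrightarrow> l \<le> k \<Longrightarrow> \<epsilon> \<le> w l"
    and w_zero: "\<And>l. k < l \<Longrightarrow> w l = 0" and w_sum: "(\<Sum>l=1..k. w l) = 1"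
begin

abbreviation "u \<equiv> renewal w"

definition mean :: real where "mean = (\<Sum>l=1..k. real l * w l)"

lemma w_nonneg: "1 \<le> l \<Longrightarrow> 0 \<le> w l"
  using w_ge[of l] w_zero[of l] eps by (cases "l \<le> k") auto

lemma w_partial_sum_le: "(\<Sum>l\<le>n. w (Suc l)) \<le> 1"
proof -
  have "(\<Sum>l\<le>n. w (Suc l)) = sum w {1..Suc n}"
    by (simp add: sum.atLeast_Suc_atMost_Suc_shift atLeast0AtMost del: sum.cl_ivl_Suc)
  also have "\<dots> \<le> sum w {1..Suc n + k}" by (rule sum_mono2) (auto intro: w_nonneg)
  also have "\<dots> = sum w {1..k}" using w_zero by (intro sum.mono_neutral_right) auto
  finally show ?thesis using w_sum by simp
qed

lemma renewal_bounds: "0 \<le> u n \<and> u n \<le> 1"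
proof (induction n rule: less_induct)
  case (less n)
  show ?case
  proof (cases n)
    case (Suc m)
    have IH: "0 \<le> u (m - l)" "u (m - l) \<le> 1" for l using less[of "m - l"] Suc by auto
    have "0 \<le> u n" unfolding Suc by (simp, intro sum_nonneg mult_nonneg_nonneg w_nonneg IH) simp
    moreover have "u n \<le> (\<Sum>l\<le>m. w (Suc l) * 1)"
      unfolding Suc renewal.simps by (intro sum_mono mult_left_mono IH w_nonneg) simp
    ultimately show ?thesis using w_partial_sum_le[of m] by simp
  qed simp
qed

lemma renewal_recurrence:
  assumes "k \<le> n"
  shows "u n = (\<Sum>l=1..k. w l * u (n - l))"
proof -
  obtain m where m: "n = Suc m" using assms k2 by (cases n) auto
  have "u n = (\<Sum>l=1..Suc m. w l * u (n - l))"
    unfolding m One_nat_def sum.atLeast_Suc_atMost_Suc_shift by (simp add: atLeast0AtMost)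
  also have "\<dots> = (\<Sum>l=1..k. w l * u (n - l))"
    using assms m w_zero by (intro sum.mono_neutral_right) auto
  finally show ?thesis .
qed

text \<open>A convex combination of the \<open>k\<close> preceding values in which
  \<open>u j\<close> has weight at least \<epsilon>: a single low value pulls the next one down by
  \<epsilon> times its distance from \<open>b\<close>.\<close>

lemma renewal_le_step:
  assumes n: "k \<le> n" and b: "\<And>i. n - k \<le> i \<Longrightarrow> i < n \<Longrightarrow> u i \<le> b" and j: "n - k \<le> j" "j < n"
  shows "u n \<le> b - \<epsilon> * (b - u j)"
proof -
  have jl: "n - j \<in> {1..k}" using n j by auto
  have "b - u n = (\<Sum>l=1..k. w l * (b - u (n - l)))"
    unfolding renewal_recurrence[OF n] using w_sum
    by (simp add: right_diff_distrib sum_subtractf sum_distrib_right[symmetric])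
  moreover have "w (n - j) * (b - u (n - (n - j))) \<le> (\<Sum>l=1..k. w l * (b - u (n - l)))"
    using jl w_nonneg b n by (intro member_le_sum[where f = "\<lambda>l. w l * (b - u (n - l))"]) auto
  moreover have "w (n - j) * (b - u (n - (n - j))) \<ge> \<epsilon> * (b - u j)"
    using jl w_ge[of "n - j"] b[OF j] j by (simp add: mult_right_mono)
  ultimately show ?thesis by linarith
qed

lemma renewal_ge_step:
  assumes n: "k \<le> n" and a: "\<And>i. n - k \<le> i \<Longrightarrow> i < n \<Longrightarrow> a \<le> u i"
  shows "a \<le> u n"
proof -
  have "a = (\<Sum>l=1..k. w l * a)" using w_sum by (simp add: sum_distrib_right[symmetric])
  also have "\<dots> \<le> (\<Sum>l=1..k. w l * u (n - l))"
    using n k2 by (intro sum_mono mult_left_mono a w_nonneg) auto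
  finally show ?thesis using renewal_recurrence[OF n] by simp
qed

text \<open>Convex combinations of a window of length \<open>k\<close> cannot leave an interval that
  contains the window.\<close>

lemma renewal_bounds_persist:
  assumes "\<And>i. m \<le> i \<Longrightarrow> i < m + k \<Longrightarrow> a \<le> u i \<and> u i \<le> b" "m \<le> i"
  shows "a \<le> u i \<and> u i \<le> b"
  using assms(2)
proof (induction i rule: less_induct)
  case (less i)
  show ?case
  proof (cases "i < m + k")
    case True then show ?thesis using assms(1) less.prems by blast
  next
    case False
    have IH: "a \<le> u j \<and> u j \<le> b" if "i - k \<le> j" "j < i" for j
      by (rule less.IH) (use that False in linarith)+
    have "u i \<le> b - \<epsilon> * (b - u (i - 1))"
      using False k2 IH by (intro renewal_le_step) auto
    moreover have "0 \<le> \<epsilon> * (b - u (i - 1))"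
      using eps IH[of "i - 1"] False k2 by (intro mult_nonneg_nonneg) auto
    moreover have "a \<le> u i" by (rule renewal_ge_step) (use False IH in auto)
    ultimately show ?thesis by linarith
  qed
qed

definition rate :: real where "rate = 1 - \<epsilon>\<^sup>2"

lemma eps_le_half: "\<epsilon> \<le> 1 / 2"
proof -
  have "\<epsilon> + \<epsilon> \<le> w 1 + w 2" using w_ge[of 1] w_ge[of 2] k2 by simp
  also have "\<dots> = sum w {1, 2}" by simp
  also have "\<dots> \<le> sum w {1..k}" using k2 w_nonneg by (intro sum_mono2) auto
  finally show ?thesis using w_sum by simp
qed

lemma rate: "0 < rate" "rate < 1"
proof -
  have "\<epsilon>\<^sup>2 \<le> (1 / 2)\<^sup>2" using eps eps_le_half by (intro power_mono) auto
  then show "0 < rate" "rate < 1" using eps by (auto simp: rate_def power2_eq_square)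
qed

text \<open>Once the minimum \<open>a\<close> of a window has entered the recurrence, the next value is below
  \<open>b - \<epsilon> (b - a)\<close>; as this value stays in every window of the following block, the whole block
  is below \<open>b - \<epsilon>\<^sup>2 (b - a)\<close>.\<close>

lemma renewal_oscillation: "\<exists>a b. b - a \<le> rate ^ j \<and> (\<forall>i\<ge>k * j. a \<le> u i \<and> u i \<le> b)"
proof (induction j)
  case 0
  show ?case using renewal_bounds by (intro exI[of _ 0] exI[of _ 1]) auto
next
  case (Suc j)
  then obtain a0 b where b: "b - a0 \<le> rate ^ j" and ab: "\<And>i. k * j \<le> i \<Longrightarrow> a0 \<le> u i \<and> u i \<le> b" by auto
  define m where "m = k * j"
  define W where "W = u ` {m..<m+k}"
  have W: "finite W" "W \<noteq> {}" using k2 by (auto simp: W_def)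
  define a where "a = Min W"
  obtain j0 where j0: "m \<le> j0" "j0 < m + k" "u j0 = a"
    using Min_in[OF W] unfolding a_def W_def by auto
  have a_le: "a \<le> u i" if "m \<le> i" "i < m + k" for i
    unfolding a_def using W(1) that by (intro Min_le) (auto simp: W_def)
  have aa: "a0 \<le> a" "a \<le> b" using ab[of j0] j0 by (auto simp: m_def)
  have all: "a \<le> u i \<and> u i \<le> b" if "m \<le> i" for i
    using renewal_bounds_persist[OF _ that, of a b] a_le ab by (auto simp: m_def)
  have first: "u (m + k) \<le> b - \<epsilon> * (b - a)"
    using renewal_le_step[of "m + k" b j0] all j0 by auto
  define b' where "b' = b - \<epsilon>\<^sup>2 * (b - a)"
  have e2: "\<epsilon>\<^sup>2 * (b - a) \<le> \<epsilon> * (b - a)"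
    using aa eps eps_le_half by (intro mult_right_mono) (auto simp: power2_eq_square mult_le_cancel_left1)
  have up: "u i \<le> b'" if "m + k \<le> i" "i < m + k + k" for i
  proof (cases "i = m + k")
    case True then show ?thesis using first e2 by (simp add: b'_def)
  next
    case False
    have "u i \<le> b - \<epsilon> * (b - u (m + k))"
      using that False all by (intro renewal_le_step) auto
    also have "\<dots> \<le> b - \<epsilon> * (\<epsilon> * (b - a))" using first eps by (intro diff_left_mono mult_left_mono) auto
    finally show ?thesis by (simp add: b'_def power2_eq_square)
  qed
  have "\<forall>i\<ge>k * Suc j. a \<le> u i \<and> u i \<le> b'"
    using renewal_bounds_persist[of "m + k" a b'] all up by (auto simp: m_def algebra_simps)
  moreover have "b' - a \<le> rate ^ Suc j"
  proof -
    have "b' - a = rate * (b - a)" by (simp add: b'_def rate_def algebra_simps)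
    also have "\<dots> \<le> rate * rate ^ j" using rate aa b by (intro mult_left_mono) auto
    finally show ?thesis by simp
  qed
  ultimately show ?case by blast
qed

text \<open>Dominates the oscillation of the renewal sequence from index \<open>i\<close> on: one
  contraction per complete block of length \<open>k\<close>.\<close>

definition gap :: "nat \<Rightarrow> real" where "gap i = rate ^ (i div k)"

lemma gap_nonneg: "0 \<le> gap i" using rate by (simp add: gap_def)

lemma renewal_dist_le_gap: "i \<le> j \<Longrightarrow> i \<le> j' \<Longrightarrow> \<bar>u j - u j'\<bar> \<le> gap i"
proof -
  assume ij: "i \<le> j" "i \<le> j'"
  obtain a b where ab: "b - a \<le> rate ^ (i div k)" "\<And>l. k * (i div k) \<le> l \<Longrightarrow> a \<le> u l \<and> u l \<le> b"
    using renewal_oscillation[of "i div k"] by auto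
  have "k * (i div k) \<le> i" by simp
  then have "a \<le> u j \<and> u j \<le> b" "a \<le> u j' \<and> u j' \<le> b" using ab(2) ij by (meson order_trans)+
  then show ?thesis using ab(1) by (auto simp: gap_def)
qed

lemma summable_gap: "summable gap"
proof -
  define \<sigma> where "\<sigma> = rate powr (1 / real k)"
  have "\<sigma> < 1" using rate k2 powr_less_mono2[of "1 / real k" rate 1] by (simp add: \<sigma>_def)
  moreover have "0 \<le> \<sigma>" by (simp add: \<sigma>_def)
  ultimately have s: "summable (\<lambda>i. (1 / rate) * \<sigma> ^ i)" by (intro summable_mult summable_geometric) auto
  have "gap i \<le> (1 / rate) * \<sigma> ^ i" for i
  proof -
    have "real i < real k * (real (i div k) + 1)"
    proof -
      have "i < k * (i div k) + k" using mod_less_divisor[of k i] mult_div_mod_eq[of k i] k2 by linarith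
      then have "real i < real (k * (i div k) + k)" by (simp only: of_nat_less_iff)
      then show ?thesis by (simp add: distrib_left)
    qed
    then have "real i / real k - 1 \<le> real (i div k)" using k2 by (simp add: field_simps)
    then have "rate powr real (i div k) \<le> rate powr (real i / real k - 1)"
      using rate by (intro powr_mono') auto
    also have "\<dots> = (1 / rate) * \<sigma> ^ i"
      using rate by (simp add: \<sigma>_def powr_diff powr_powr flip: powr_realpow)
    finally show ?thesis using rate by (simp add: gap_def powr_realpow)
  qed
  then show ?thesis using s gap_nonneg by (intro summable_comparison_test'[OF s, of 0]) auto
qed

section \<open>The value of the renewal limit\<close>

definition tail_weight :: "nat \<Rightarrow> real" where "tail_weight l = (\<Sum>r=Suc l..k. w r)"

lemma tail_weight_Suc: "tail_weight l = tail_weight (Suc l) + w (Suc l)"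
proof (cases "Suc l \<le> k")
  case True
  then show ?thesis unfolding tail_weight_def by (subst sum.atLeast_Suc_atMost) auto
qed (simp add: tail_weight_def w_zero)

text \<open>In terms of the random walk, \<open>tail_weight l\<close> is the probability of a step
  longer than \<open>l\<close>. The sum runs over the position \<open>n - l\<close> of the last
  visit up to \<open>n\<close>, and there is exactly one such visit.\<close>

lemma renewal_invariant: "(\<Sum>l\<le>n. tail_weight l * u (n - l)) = 1"
proof (induction n)
  case 0 then show ?case using w_sum by (simp add: tail_weight_def)
next
  case (Suc n)
  have "(\<Sum>l\<le>Suc n. tail_weight l * u (Suc n - l)) = tail_weight 0 * u (Suc n) + (\<Sum>l\<le>n. tail_weight (Suc l) * u (n - l))"
    by (subst sum.atMost_Suc_shift) simp
  also have "(\<Sum>l\<le>n. tail_weight (Suc l) * u (n - l)) = (\<Sum>l\<le>n. tail_weight l * u (n - l)) - u (Suc n)"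
    by (subst tail_weight_Suc) (simp add: algebra_simps sum.distrib)
  finally show ?case using Suc w_sum by (simp add: tail_weight_def)
qed

lemma sum_tail_weight: "(\<Sum>l<k. tail_weight l) = mean"
proof -
  have "(\<Sum>l<k. tail_weight l) = (\<Sum>l<k. \<Sum>r\<in>{1..k}. if l < r then w r else 0)"
    unfolding tail_weight_def by (intro sum.cong refl sum.mono_neutral_cong_left) auto
  also have "\<dots> = (\<Sum>r\<in>{1..k}. \<Sum>l<k. if l < r then w r else 0)" by (rule sum.swap)
  also have "\<dots> = (\<Sum>r\<in>{1..k}. \<Sum>l<r. w r)"
    by (intro sum.cong refl sum.mono_neutral_cong_right) auto
  finally show ?thesis by (simp add: mean_def)
qed

lemma mean_ge_1: "mean \<ge> 1"
proof -
  have "(\<Sum>l=1..k. w l) \<le> mean" unfolding mean_def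
    using w_nonneg by (intro sum_mono) (simp add: mult_le_cancel_right1 order.strict_iff_not)
  then show ?thesis using w_sum by simp
qed

text \<open>Summable increments give convergence, and passing to the limit in
  \<open>renewal_invariant\<close> identifies the limit.\<close>

lemma renewal_tendsto: "u \<longlonglongrightarrow> 1 / mean"
proof -
  have "summable (\<lambda>n. u (Suc n) - u n)"
    using renewal_dist_le_gap
    by (intro summable_comparison_test'[OF summable_gap, of 0]) (simp del: renewal.simps)
  then obtain S where "(\<lambda>n. u (Suc n) - u n) sums S" by blast
  then have "(\<lambda>n. \<Sum>i<n. u (Suc i) - u i) \<longlonglongrightarrow> S" by (simp add: sums_def)
  then have "(\<lambda>n. u n - u 0) \<longlonglongrightarrow> S" by (simp only: sum_lessThan_telescope)
  from tendsto_add[OF this tendsto_const[of "u 0"]] have L: "u \<longlonglongrightarrow> S + u 0" (is "_ \<longlonglongrightarrow> ?L") by simp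
  have "(\<lambda>n. \<Sum>l<k. tail_weight l * u (n + k - l)) \<longlonglongrightarrow> (\<Sum>l<k. tail_weight l * ?L)"
  proof (intro tendsto_sum tendsto_mult tendsto_const)
    fix l assume "l \<in> {..<k}"
    then have "(\<lambda>n. u (n + k - l)) = (\<lambda>n. u (n + (k - l)))" by (intro ext) simp
    then show "(\<lambda>n. u (n + k - l)) \<longlonglongrightarrow> ?L" using LIMSEQ_ignore_initial_segment[OF L, of "k - l"] by simp
  qed
  moreover have "(\<Sum>l<k. tail_weight l * u (n + k - l)) = 1" for n
  proof -
    have "(\<Sum>l<k. tail_weight l * u (n + k - l)) = (\<Sum>l\<le>n + k. tail_weight l * u (n + k - l))"
      by (intro sum.mono_neutral_left) (auto simp: tail_weight_def)
    then show ?thesis using renewal_invariant by simp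
  qed
  ultimately have "(\<Sum>l<k. tail_weight l * ?L) = 1" by (simp add: LIMSEQ_const_iff)
  then have "mean * ?L = 1" by (simp add: sum_distrib_right[symmetric] sum_tail_weight)
  then have "?L = 1 / mean" using mean_ge_1 by (simp add: field_simps)
  then show ?thesis using L by simp
qed

lemma renewal_limit_dist: "\<bar>u i - 1 / mean\<bar> \<le> gap i"
proof (rule LIMSEQ_le_const2)
  show "(\<lambda>n. \<bar>u i - u (n + i)\<bar>) \<longlonglongrightarrow> \<bar>u i - 1 / mean\<bar>"
    by (intro tendsto_intros LIMSEQ_ignore_initial_segment renewal_tendsto)
qed (use renewal_dist_le_gap in auto)

text \<open>With truncated subtraction one of the two shifts is always 0, so one formula covers both
  orders of \<open>m\<close> and \<open>n\<close>.\<close>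

definition cov :: "nat \<Rightarrow> nat \<Rightarrow> real" where
  "cov m n = (\<Sum>i<min m n. u (i + (m - n)) * u (i + (n - m)))"

lemma cov_sym: "cov m n = cov n m"
  by (simp add: cov_def min.commute mult.commute)

lemma cov_le: "m \<le> n \<Longrightarrow> cov m n = (\<Sum>i<m. u i * u (i + (n - m)))"
  by (simp add: cov_def min_def)

lemma cov_bounds: "0 \<le> cov m n" "cov m n \<le> real (min m n)"
proof -
  show "0 \<le> cov m n" unfolding cov_def using renewal_bounds by (intro sum_nonneg mult_nonneg_nonneg) auto
  have "cov m n \<le> (\<Sum>i<min m n. 1)" unfolding cov_def using renewal_bounds by (intro sum_mono mult_le_one) auto
  then show "cov m n \<le> real (min m n)" by simp
qed

lemma cov_diag_diff: "m \<le> n \<Longrightarrow> 0 \<le> cov n n - cov m m \<and> cov n n - cov m m \<le> real n - real m"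
proof (induction n rule: dec_induct)
  case (step n)
  have "cov (Suc n) (Suc n) = cov n n + u n * u n" by (simp add: cov_def)
  moreover have "0 \<le> u n * u n" "u n * u n \<le> 1" using renewal_bounds[of n] by (auto intro: mult_le_one)
  ultimately show ?case using step.IH by (simp only: of_nat_Suc) linarith
qed simp

definition gap_total :: real where "gap_total = suminf gap"

lemma gap_total_nonneg: "0 \<le> gap_total"
  unfolding gap_total_def using summable_gap gap_nonneg by (intro suminf_nonneg)

lemma sum_gap_le: "(\<Sum>i<n. gap (i + j)) \<le> gap_total"
proof -
  have "(\<Sum>i<n. gap (i + j)) = sum gap {j..<n + j}"
    using sum.shift_bounds_nat_ivl[of gap 0 j n] by (simp add: atLeast0LessThan)
  also have "\<dots> \<le> gap_total"
    unfolding gap_total_def using summable_gap gap_nonneg by (intro sum_le_suminf) auto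
  finally show ?thesis .
qed

text \<open>Each difference of renewal values is telescoped into \<open>n - m\<close> unit steps;
  every step is then summed over \<open>i\<close> first, so that the bound has no factor
  \<open>m\<close>.\<close>

lemma cov_offdiag_diff: "m \<le> n \<Longrightarrow> \<bar>cov m m - cov m n\<bar> \<le> gap_total * (real n - real m)"
proof -
  assume mn: "m \<le> n"
  have "cov m m - cov m n = (\<Sum>i<m. u i * (u i - u (i + (n - m))))"
    using mn by (simp add: cov_le sum_subtractf[symmetric] right_diff_distrib)
  also have "\<bar>\<dots>\<bar> \<le> (\<Sum>i<m. \<bar>u (i + (n - m)) - u i\<bar>)"
  proof (intro order_trans[OF sum_abs] sum_mono)
    fix i
    show "\<bar>u i * (u i - u (i + (n - m)))\<bar> \<le> \<bar>u (i + (n - m)) - u i\<bar>"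
      using renewal_bounds[of i] by (simp add: abs_mult abs_minus_commute mult_left_le_one_le)
  qed
  also have "\<dots> \<le> (\<Sum>i<m. \<Sum>e<n - m. gap (i + e))"
  proof (intro sum_mono)
    fix i
    have "u (i + (n - m)) - u i = (\<Sum>e<n - m. u (i + Suc e) - u (i + e))"
      using sum_lessThan_telescope[of "\<lambda>e. u (i + e)" "n - m"] by simp
    also have "\<bar>\<dots>\<bar> \<le> (\<Sum>e<n - m. gap (i + e))"
      by (intro order_trans[OF sum_abs] sum_mono renewal_dist_le_gap) auto
    finally show "\<bar>u (i + (n - m)) - u i\<bar> \<le> (\<Sum>e<n - m. gap (i + e))" .
  qed
  also have "\<dots> = (\<Sum>e<n - m. \<Sum>i<m. gap (i + e))" by (rule sum.swap)
  also have "\<dots> \<le> (\<Sum>e<n - m. gap_total)" by (intro sum_mono sum_gap_le)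
  finally show ?thesis using mn by (simp add: of_nat_diff mult.commute)
qed

lemma cov_diag_asymp: "\<bar>cov n n - real n / mean\<^sup>2\<bar> \<le> 2 * gap_total"
proof -
  have le: "\<bar>u i * u i - 1 / mean\<^sup>2\<bar> \<le> 2 * gap i" for i
  proof -
    have "u i * u i - 1 / mean\<^sup>2 = (u i + 1 / mean) * (u i - 1 / mean)"
      by (simp add: power2_eq_square algebra_simps)
    also have "\<bar>\<dots>\<bar> \<le> 2 * gap i"
      unfolding abs_mult
    proof (intro mult_mono renewal_limit_dist)
      have "1 / mean \<le> 1" "0 \<le> 1 / mean" using mean_ge_1 by auto
      then show "\<bar>u i + 1 / mean\<bar> \<le> 2" using renewal_bounds[of i] by linarith
    qed auto
    finally show ?thesis .
  qed
  have "cov n n - real n / mean\<^sup>2 = (\<Sum>i<n. u i * u i - 1 / mean\<^sup>2)"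
    by (simp add: cov_def sum_subtractf)
  also have "\<bar>\<dots>\<bar> \<le> (\<Sum>i<n. 2 * gap i)" by (intro order_trans[OF sum_abs] sum_mono le)
  also have "\<dots> \<le> 2 * gap_total"
    using sum_gap_le[of 0 n] by (simp add: sum_distrib_left[symmetric])
  finally show ?thesis .
qed

end

section \<open>The covariance of the autoregressive sequence\<close>

context renewal_weights begin

lemma autoregressive_solution:
  fixes N :: "'b measure" and g :: "nat \<Rightarrow> 'b \<Rightarrow> real" and \<xi> :: "int \<Rightarrow> 'b \<Rightarrow> real"
  assumes xi_nonpos: "\<And>i. i \<le> 0 \<Longrightarrow> \<xi> i \<omega> = 0"
    and xi_1: "\<xi> 1 \<omega> = g 1 \<omega>"
    and xi_rec: "\<And>n. 2 \<le> n \<Longrightarrow> \<xi> (int n) \<omega> = (\<Sum>l=1..k. w l * \<xi> (int n - int l) \<omega>) + g n \<omega>"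
    and n: "1 \<le> n"
  shows "\<xi> (int n) \<omega> = (\<Sum>i<n. u i * g (n - i) \<omega>)"
  using n
proof (induction n rule: less_induct)
  case (less n)
  show ?case
  proof (cases "n = 1")
    case True then show ?thesis using xi_1 by simp
  next
    case False
    then obtain m where m: "n = Suc m" "1 \<le> m" using less.prems by (cases n) auto
    \<comment> \<open>Extending the range by zero weights and cutting it where \<open>\<xi>\<close>
      vanishes treats small and large \<open>k\<close> alike.\<close>
    have "(\<Sum>l=1..k. w l * \<xi> (int n - int l) \<omega>) = (\<Sum>l=1..k + m. w l * \<xi> (int n - int l) \<omega>)"
      using w_zero by (intro sum.mono_neutral_left) auto
    also have "\<dots> = (\<Sum>l=1..m. w l * \<xi> (int n - int l) \<omega>)"
      using xi_nonpos m by (intro sum.mono_neutral_right) auto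
    also have "\<dots> = (\<Sum>l<m. w (Suc l) * \<xi> (int (m - l)) \<omega>)"
      by (rule sum.reindex_bij_witness[of _ Suc "\<lambda>l. l - 1"]) (auto simp: m of_nat_diff)
    also have "\<dots> = (\<Sum>l<m. \<Sum>i<m - l. w (Suc l) * (u i * g (m - l - i) \<omega>))"
    proof (intro sum.cong refl)
      fix l assume "l \<in> {..<m}"
      then have "\<xi> (int (m - l)) \<omega> = (\<Sum>i<m - l. u i * g (m - l - i) \<omega>)"
        using m by (intro less.IH) auto
      then show "w (Suc l) * \<xi> (int (m - l)) \<omega> = (\<Sum>i<m - l. w (Suc l) * (u i * g (m - l - i) \<omega>))"
        by (simp only: sum_distrib_left)
    qed
    also have "\<dots> = (\<Sum>(l, i)\<in>{(l, i). l + i < m}. w (Suc l) * (u i * g (m - l - i) \<omega>))"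
      by (subst sum.Sigma) (auto intro!: sum.cong)
    \<comment> \<open>Collected by \<open>j = l + i\<close>, the inner sum is the recursion for
      \<open>u (Suc j)\<close>.\<close>
    also have "\<dots> = (\<Sum>j<m. \<Sum>l\<le>j. w (Suc l) * (u (j - l) * g (m - l - (j - l)) \<omega>))"
      by (rule sum.triangle_reindex)
    also have "\<dots> = (\<Sum>j<m. u (Suc j) * g (m - j) \<omega>)"
      by (auto simp: sum_distrib_right mult.assoc intro!: sum.cong)
    finally have "(\<Sum>l=1..k. w l * \<xi> (int n - int l) \<omega>) = (\<Sum>j<m. u (Suc j) * g (m - j) \<omega>)" .
    moreover have "(\<Sum>i<n. u i * g (n - i) \<omega>) = g n \<omega> + (\<Sum>j<m. u (Suc j) * g (m - j) \<omega>)"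
      unfolding m(1) by (subst sum.lessThan_Suc_shift) simp
    ultimately show ?thesis using xi_rec[of n] m by simp
  qed
qed

end

lemma std_normal_product_moments:
  assumes N: "prob_space N"
    and g_normal: "\<And>n. 1 \<le> n \<Longrightarrow> distributed N lborel (g n) std_normal_density"
    and g_indep: "prob_space.indep_vars N (\<lambda>_. borel) g {1..}"
  shows std_normal_has_mean: "1 \<le> a \<Longrightarrow> has_bochner_integral N (g a) 0"
    and std_normal_has_product: "1 \<le> a \<Longrightarrow> 1 \<le> b \<Longrightarrow>
      has_bochner_integral N (\<lambda>\<omega>. g a \<omega> * g b \<omega>) (if a = b then 1 else 0)"
proof -
  interpret N: prob_space N by fact
  have mean: "has_bochner_integral N (g a) 0" if "1 \<le> a" for a
  proof -
    have "integrable N (g a)"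
      using integrable_std_normal_moment[of 1] distributed_integrable[OF g_normal[OF that], of "\<lambda>x. x"] by simp
    moreover have "(LINT \<omega>|N. g a \<omega>) = 0"
      using integral_std_normal_moment_odd[of 0] distributed_integral[OF g_normal[OF that], of "\<lambda>x. x"] by simp
    ultimately show ?thesis by (simp add: has_bochner_integral_iff)
  qed
  show "has_bochner_integral N (g a) 0" if "1 \<le> a" by (rule mean[OF that])
  show "has_bochner_integral N (\<lambda>\<omega>. g a \<omega> * g b \<omega>) (if a = b then 1 else 0)" if ab: "1 \<le> a" "1 \<le> b"
  proof (cases "a = b")
    case True
    have "integrable N (\<lambda>\<omega>. (g a \<omega>)\<^sup>2)"
      using integrable_std_normal_moment[of 2] distributed_integrable[OF g_normal[OF ab(1)], of "\<lambda>x. x\<^sup>2"] by simp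
    moreover have "(LINT \<omega>|N. (g a \<omega>)\<^sup>2) = 1"
      using integral_std_normal_moment_even[of 1] distributed_integral[OF g_normal[OF ab(1)], of "\<lambda>x. x\<^sup>2"] by simp
    ultimately show ?thesis using True by (simp add: has_bochner_integral_iff power2_eq_square)
  next
    case False
    have "N.indep_vars (\<lambda>_. borel) g {a, b}" by (rule N.indep_vars_subset[OF g_indep]) (use ab in auto)
    moreover have int: "integrable N (g i)" if "i \<in> {a, b}" for i
      using mean that ab by (auto simp: has_bochner_integral_iff)
    ultimately have "integrable N (\<lambda>\<omega>. \<Prod>i\<in>{a,b}. g i \<omega>)"
        "(LINT \<omega>|N. (\<Prod>i\<in>{a,b}. g i \<omega>)) = (\<Prod>i\<in>{a,b}. LINT \<omega>|N. g i \<omega>)"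
      by (auto intro!: N.indep_vars_integrable N.indep_vars_lebesgue_integral)
    then show ?thesis using False mean ab by (simp add: has_bochner_integral_iff)
  qed
qed

context renewal_weights begin

text \<open>Both variables are moving averages of the noise with coefficients \<open>u\<close>. By
  orthonormality of the noise only pairs with equal noise index survive, which for
  \<open>m \<le> n\<close> means \<open>j = i + (n - m)\<close>.\<close>

lemma covariance_autoregressive:
  fixes N :: "'b measure" and g :: "nat \<Rightarrow> 'b \<Rightarrow> real" and \<xi> :: "int \<Rightarrow> 'b \<Rightarrow> real"
  assumes N: "prob_space N"
    and g_normal: "\<And>n. 1 \<le> n \<Longrightarrow> distributed N lborel (g n) std_normal_density"
    and g_indep: "prob_space.indep_vars N (\<lambda>_. borel) g {1..}"
    and xi_nonpos: "\<And>i \<omega>. i \<le> 0 \<Longrightarrow> \<omega> \<in> space N \<Longrightarrow> \<xi> i \<omega> = 0"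
    and xi_1: "\<And>\<omega>. \<omega> \<in> space N \<Longrightarrow> \<xi> 1 \<omega> = g 1 \<omega>"
    and xi_rec: "\<And>n \<omega>. 2 \<le> n \<Longrightarrow> \<omega> \<in> space N \<Longrightarrow>
                   \<xi> (int n) \<omega> = (\<Sum>l=1..k. w l * \<xi> (int n - int l) \<omega>) + g n \<omega>"
    and mn: "1 \<le> m" "1 \<le> n"
  shows "covariance N (\<xi> (int m)) (\<xi> (int n)) = cov m n"
proof -
  note mean = std_normal_has_mean[OF N g_normal g_indep]
  note product = std_normal_has_product[OF N g_normal g_indep]
  have sol: "\<xi> (int n) \<omega> = (\<Sum>i<n. u i * g (n - i) \<omega>)" if "1 \<le> n" "\<omega> \<in> space N" for n \<omega>
    using that by (intro autoregressive_solution xi_nonpos xi_1 xi_rec)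
  have E: "(LINT \<omega>|N. \<xi> (int n) \<omega>) = 0" if "1 \<le> n" for n
  proof -
    have "(LINT \<omega>|N. \<xi> (int n) \<omega>) = (LINT \<omega>|N. (\<Sum>i<n. u i * g (n - i) \<omega>))"
      using that sol by (intro Bochner_Integration.integral_cong) auto
    also have "has_bochner_integral N (\<lambda>\<omega>. (\<Sum>i<n. u i * g (n - i) \<omega>)) (\<Sum>i<n. u i * 0)"
      by (intro has_bochner_integral_sum has_bochner_integral_mult_right mean) auto
    then have "(LINT \<omega>|N. (\<Sum>i<n. u i * g (n - i) \<omega>)) = 0"
      by (simp add: has_bochner_integral_iff)
    finally show ?thesis .
  qed
  have main: "(LINT \<omega>|N. \<xi> (int m) \<omega> * \<xi> (int n) \<omega>) = cov m n" if mn: "1 \<le> m" "m \<le> n" for m n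
  proof -
    have "(LINT \<omega>|N. \<xi> (int m) \<omega> * \<xi> (int n) \<omega>) =
        (LINT \<omega>|N. (\<Sum>i<m. \<Sum>j<n. u i * u j * (g (m - i) \<omega> * g (n - j) \<omega>)))"
      using mn sol by (intro Bochner_Integration.integral_cong) (auto simp: sum_product mult_ac)
    also have "has_bochner_integral N (\<lambda>\<omega>. (\<Sum>i<m. \<Sum>j<n. u i * u j * (g (m - i) \<omega> * g (n - j) \<omega>)))
        (\<Sum>i<m. \<Sum>j<n. u i * u j * (if m - i = n - j then 1 else 0))"
      by (intro has_bochner_integral_sum has_bochner_integral_mult_right product) auto
    then have "(LINT \<omega>|N. (\<Sum>i<m. \<Sum>j<n. u i * u j * (g (m - i) \<omega> * g (n - j) \<omega>))) =
        (\<Sum>i<m. \<Sum>j<n. u i * u j * (if m - i = n - j then 1 else 0))"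
      by (simp only: has_bochner_integral_iff)
    also have "\<dots> = (\<Sum>i<m. u i * u (i + (n - m)))"
    proof (intro sum.cong refl)
      fix i assume "i \<in> {..<m}"
      then have eq: "j < n \<Longrightarrow> m - i = n - j \<longleftrightarrow> j = i + (n - m)" and lt: "i + (n - m) < n" for j
        using mn by auto
      have "(\<Sum>j<n. u i * u j * (if m - i = n - j then 1 else 0)) = (\<Sum>j<n. if j = i + (n - m) then u i * u j else 0)"
        using eq by (intro sum.cong) auto
      then show "(\<Sum>j<n. u i * u j * (if m - i = n - j then 1 else 0)) = u i * u (i + (n - m))"
        using lt by simp
    qed
    finally show ?thesis using mn by (simp add: cov_le)
  qed
  have "covariance N (\<xi> (int m)) (\<xi> (int n)) = (LINT \<omega>|N. \<xi> (int m) \<omega> * \<xi> (int n) \<omega>)"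
    using E mn by (simp add: covariance_def)
  also have "\<dots> = cov m n"
    using main[of m n] main[of n m] mn cov_sym[of m n] by (cases "m \<le> n") (auto simp: mult.commute)
  finally show ?thesis .
qed

end

section \<open>Lower bound\<close>

text \<open>Chebyshev's inequality for the number \<open>S n\<close> of events among the first
  \<open>n\<close>. The variance is at most \<open>m n + C\<close>: the diagonal contributes at most
  \<open>m n\<close>, and each \<open>j\<close> is paired with \<open>j\<close> earlier indices at
  error \<open>d j\<close>. As the mean \<open>m n\<close> diverges, the count cannot stay bounded
  by \<open>N\<close> with positive probability.\<close>

lemma (in prob_space) quasi_independent_infinitely_often:
  fixes A :: "nat \<Rightarrow> 'a set" and d :: "nat \<Rightarrow> real"
  assumes A [measurable]: "\<And>i. A i \<in> events"
    and diverges: "filterlim (\<lambda>n. \<Sum>i<n. prob (A i)) at_top sequentially"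
    and d: "\<And>j. 0 \<le> d j" "summable (\<lambda>j. real j * d j)"
    and pair: "\<And>i j. i < j \<Longrightarrow> prob (A i \<inter> A j) \<le> prob (A i) * prob (A j) + d j"
  shows "AE \<omega> in M. \<exists>\<^sub>F i in sequentially. \<omega> \<in> A i"
proof -
  define m where "m n = (\<Sum>i<n. prob (A i))" for n
  define S where "S n \<omega> = (\<Sum>i<n. indicator (A i) \<omega> :: real)" for n \<omega>
  define C where "C = 2 * (\<Sum>j. real j * d j)"
  have ind: "has_bochner_integral M (indicator E :: 'a \<Rightarrow> real) (prob E)" if "E \<in> events" for E
    using that by (intro has_bochner_integral_real_indicator) (auto simp: less_top[symmetric])
  have const: "has_bochner_integral M (\<lambda>_. c) c" for c :: real
    by (simp add: has_bochner_integral_iff prob_space)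
  have var: "(\<integral>\<omega>. (S n \<omega> - m n)\<^sup>2 \<partial>M) \<le> m n + C" for n
  proof -
    have sq: "(S n \<omega> - m n)\<^sup>2 = (\<Sum>i<n. \<Sum>j<n. indicator (A i \<inter> A j) \<omega>
        - prob (A j) * indicator (A i) \<omega> - prob (A i) * indicator (A j) \<omega> + prob (A i) * prob (A j))" for \<omega>
    proof -
      have "S n \<omega> - m n = (\<Sum>i<n. indicator (A i) \<omega> - prob (A i))"
        by (simp add: S_def m_def sum_subtractf)
      then show ?thesis
        by (simp add: power2_eq_square sum_product algebra_simps indicator_inter_arith)
    qed
    have "(\<integral>\<omega>. (S n \<omega> - m n)\<^sup>2 \<partial>M) = (\<Sum>i<n. \<Sum>j<n. prob (A i \<inter> A j) - prob (A i) * prob (A j))"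
    proof -
      have "has_bochner_integral M (\<lambda>\<omega>. \<Sum>i<n. \<Sum>j<n. indicator (A i \<inter> A j) \<omega>
        - prob (A j) * indicator (A i) \<omega> - prob (A i) * indicator (A j) \<omega> + prob (A i) * prob (A j))
        (\<Sum>i<n. \<Sum>j<n. prob (A i \<inter> A j) - prob (A j) * prob (A i) - prob (A i) * prob (A j) + prob (A i) * prob (A j))"
        by (intro has_bochner_integral_sum has_bochner_integral_add has_bochner_integral_diff
            has_bochner_integral_mult_right ind const) (use A in auto)
      then show ?thesis unfolding sq by (simp add: has_bochner_integral_iff mult.commute)
    qed
    also have "\<dots> \<le> (\<Sum>i<n. \<Sum>j<n. (if i = j then prob (A i) else 0) + (if i < j then d j else 0) + (if j < i then d i else 0))"
    proof (intro sum_mono)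
      fix i j
      show "prob (A i \<inter> A j) - prob (A i) * prob (A j) \<le>
          (if i = j then prob (A i) else 0) + (if i < j then d j else 0) + (if j < i then d i else 0)"
        using pair[of i j] pair[of j i] by (cases i j rule: linorder_cases) (auto simp: Int_commute mult.commute)
    qed
    also have "\<dots> = m n + ((\<Sum>i<n. \<Sum>j<n. if i < j then d j else 0) + (\<Sum>i<n. \<Sum>j<n. if j < i then d i else 0))"
      by (simp add: sum.distrib m_def)
    also have "(\<Sum>i<n. \<Sum>j<n. if i < j then d j else 0) = (\<Sum>i<n. \<Sum>j<n. if j < i then d i else 0)"
      by (rule sum.swap)
    also have "(\<Sum>i<n. \<Sum>j<n. if j < i then d i else 0) = (\<Sum>i<n. real i * d i)"
    proof (intro sum.cong refl)
      fix i assume "i \<in> {..<n}"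
      then have "(\<Sum>j<n. if j < i then d i else 0) = (\<Sum>j<i. d i)"
        by (intro sum.mono_neutral_cong_right) auto
      then show "(\<Sum>j<n. if j < i then d i else 0) = real i * d i" by simp
    qed
    also have "(\<Sum>i<n. real i * d i) + (\<Sum>i<n. real i * d i) \<le> C"
      using sum_le_suminf[OF d(2), of "{..<n}"] d(1) by (simp add: C_def)
    finally show ?thesis by simp
  qed
  have zero: "prob {\<omega> \<in> space M. \<forall>i\<ge>N. \<omega> \<notin> A i} = 0" for N
  proof -
    define B where "B = {\<omega> \<in> space M. \<forall>i\<ge>N. \<omega> \<notin> A i}"
    have [measurable]: "B \<in> events" unfolding B_def by measurable
    have le: "(real N - m n)\<^sup>2 * prob B \<le> m n + C" if "m n \<ge> real N" for n
    proof -
      have "(real N - m n)\<^sup>2 * prob B = (\<integral>\<omega>. (real N - m n)\<^sup>2 * indicator B \<omega> \<partial>M)"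
        by simp
      also have "\<dots> \<le> (\<integral>\<omega>. (S n \<omega> - m n)\<^sup>2 \<partial>M)"
      proof (intro integral_mono)
        show "integrable M (\<lambda>\<omega>. (S n \<omega> - m n)\<^sup>2)"
        proof (rule integrable_const_bound)
          have "\<bar>S n \<omega>\<bar> \<le> real n" for \<omega>
            unfolding S_def using sum_bounded_above[of "{..<n}" "\<lambda>i. indicator (A i) \<omega>" "1 :: real"]
            by (auto simp: indicator_def sum_nonneg)
          then have "\<bar>S n \<omega> - m n\<bar> \<le> \<bar>real n + \<bar>m n\<bar>\<bar>" for \<omega>
            using abs_triangle_ineq4[of "S n \<omega>" "m n"] by (smt (verit))
          then show "AE \<omega> in M. norm ((S n \<omega> - m n)\<^sup>2) \<le> (real n + \<bar>m n\<bar>)\<^sup>2"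
            by (intro AE_I2) (simp only: abs_le_square_iff real_norm_def abs_power2)
        qed (simp add: S_def)
        fix \<omega> assume "\<omega> \<in> space M"
        show "(real N - m n)\<^sup>2 * indicator B \<omega> \<le> (S n \<omega> - m n)\<^sup>2"
        proof (cases "\<omega> \<in> B")
          case True
          then have "S n \<omega> = (\<Sum>i\<in>{..<n} \<inter> {..<N}. indicator (A i) \<omega>)"
            unfolding S_def by (intro sum.mono_neutral_right) (auto simp: B_def indicator_def, meson not_le)
          also have "\<dots> \<le> (\<Sum>i<N. indicator (A i) \<omega>)"
            by (intro sum_mono2) auto
          also have "\<dots> \<le> real N"
            using sum_bounded_above[of "{..<N}" "\<lambda>i. indicator (A i) \<omega>" "1 :: real"] by (auto simp: indicator_def)
          finally have "(m n - real N)\<^sup>2 \<le> (m n - S n \<omega>)\<^sup>2" using that by (intro power_mono) auto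
          then show ?thesis using True by (simp add: power2_commute)
        qed simp
      qed (use ind[of B] in \<open>simp add: has_bochner_integral_iff\<close>)
      also note var
      finally show ?thesis .
    qed
    have "((\<lambda>x. (x + C) / (real N - x)\<^sup>2) \<longlongrightarrow> 0) at_top" by real_asymp
    from filterlim_compose[OF this diverges] have lim: "(\<lambda>n. (m n + C) / (real N - m n)\<^sup>2) \<longlonglongrightarrow> 0"
      unfolding m_def .
    have "eventually (\<lambda>n. m n > real N) sequentially"
      using diverges unfolding m_def filterlim_at_top_dense by blast
    then have "eventually (\<lambda>n. prob B \<le> (m n + C) / (real N - m n)\<^sup>2) sequentially"
      by eventually_elim (use le in \<open>simp add: pos_le_divide_eq mult.commute\<close>)
    then have "prob B \<le> 0" using lim by (intro tendsto_lowerbound[OF lim]) auto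
    then show ?thesis unfolding B_def[symmetric] by (simp add: measure_le_0_iff)
  qed
  have "AE \<omega> in M. \<forall>N. \<not> (\<forall>i\<ge>N. \<omega> \<notin> A i)"
    unfolding AE_all_countable
  proof
    fix N
    have "{\<omega> \<in> space M. \<forall>i\<ge>N. \<omega> \<notin> A i} \<in> null_sets M"
      using zero[of N] by (auto simp: null_sets_def emeasure_eq_measure)
    then show "AE \<omega> in M. \<not> (\<forall>i\<ge>N. \<omega> \<notin> A i)" by (rule AE_I') auto
  qed
  then show ?thesis
    by (rule eventually_mono) (auto simp: frequently_def eventually_sequentially)
qed

text \<open>The sequence grows fast enough for the correlations between different indices to be summable,
  yet \<open>ln (ln (sparse_index i))\<close> is still asymptotic to \<open>ln i\<close>. The shift by \<open>2\<close> makes it injective.\<close>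

definition sparse_index :: "nat \<Rightarrow> nat" where "sparse_index i = (i + 2) ^ (3 * (i + 2))"

lemma sparse_index_ge_1: "1 \<le> sparse_index i"
  by (simp add: sparse_index_def)

lemma sparse_index_ratio: "i < j \<Longrightarrow> sparse_index i * (j + 2) ^ 3 \<le> sparse_index j"
proof -
  assume ij: "i < j"
  have "sparse_index i \<le> (j + 2) ^ (3 * (i + 2))" unfolding sparse_index_def using ij by (intro power_mono) auto
  also have "\<dots> \<le> (j + 2) ^ (3 * (j + 1))" using ij by (intro power_increasing) auto
  finally have "sparse_index i * (j + 2) ^ 3 \<le> (j + 2) ^ (3 * (j + 1)) * (j + 2) ^ 3" by (rule mult_right_mono) simp
  also have "\<dots> = sparse_index j" by (simp add: sparse_index_def power_add[symmetric] algebra_simps)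
  finally show ?thesis .
qed

lemma sparse_index_less: "i < j \<Longrightarrow> sparse_index i < sparse_index j"
proof -
  assume ij: "i < j"
  have "sparse_index i * 1 < sparse_index i * (j + 2) ^ 3"
    using sparse_index_ge_1[of i] by (intro mult_strict_left_mono one_less_power) auto
  also have "\<dots> \<le> sparse_index j" by (rule sparse_index_ratio[OF ij])
  finally show ?thesis by simp
qed

text \<open>Follows from \<open>- ln (1 - r) \<le> r / (1 - r) \<le> 2 * r\<close> and
  \<open>1 + x \<le> exp x\<close>. This includes exponents below 1, for which Bernoulli's
  inequality points the other way.\<close>

lemma one_minus_powr_le:
  fixes r :: real
  assumes \<alpha>: "0 < \<alpha>" and "0 \<le> r" "r \<le> 1 / 2"
  shows "1 - (1 - r) powr \<alpha> \<le> 2 * \<alpha> * r"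
proof -
  have "ln (1 / (1 - r)) \<le> 1 / (1 - r) - 1" using assms by (intro ln_le_minus_one) auto
  then have "- ln (1 - r) \<le> r / (1 - r)" using assms by (simp add: ln_div field_simps)
  also have "\<dots> \<le> 2 * r" using assms mult_left_mono[of "2 * r" 1 r] by (simp add: field_simps)
  finally have "\<alpha> * (- ln (1 - r)) \<le> \<alpha> * (2 * r)" using \<alpha> by (intro mult_left_mono) auto
  moreover have "1 + \<alpha> * ln (1 - r) \<le> (1 - r) powr \<alpha>" using assms by (simp add: powr_def)
  ultimately show ?thesis by simp
qed

lemma nonneg_not_summable_imp_at_top:
  fixes a :: "nat \<Rightarrow> real"
  assumes "\<And>i. 0 \<le> a i" "\<not> summable a"
  shows "filterlim (\<lambda>n. \<Sum>i<n. a i) at_top sequentially"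
  unfolding filterlim_at_top
proof
  fix B
  have "\<exists>n. B \<le> sum a {..<n}"
    using assms summableI_nonneg_bounded[of a B] by (meson linear)
  then obtain n where "B \<le> sum a {..<n}" by blast
  then have "B \<le> sum a {..<m}" if "n \<le> m" for m
    using that assms(1) by (elim order_trans) (auto intro: sum_mono2)
  then show "eventually (\<lambda>n. B \<le> sum a {..<n}) sequentially" by (auto simp: eventually_sequentially)
qed

text \<open>Separates the probabilistic argument from the renewal estimates. \<open>K_diag\<close>
  fixes the limit; \<open>K_diag_incr\<close> and \<open>K_minor\<close> bound the two coefficients
  in the exponential moment of an increment, for the upper bound; \<open>K_offdiag\<close> bounds
  the dependence of a pair, for the lower bound.\<close>

locale lil_kernel =
  fixes M :: "'a measure" and \<alpha> :: real and K :: "nat \<Rightarrow> nat \<Rightarrow> real" and Z :: "nat \<Rightarrow> 'a \<Rightarrow> real"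
    and \<sigma> C :: real
  assumes Z: "permanental_sequence M \<alpha> K Z" and \<alpha>: "0 < \<alpha>"
    and K_nonneg: "\<And>i j. 1 \<le> i \<Longrightarrow> 1 \<le> j \<Longrightarrow> 0 \<le> K i j"
    and K_pos: "\<And>j. 1 \<le> j \<Longrightarrow> 0 < K j j"
    and \<sigma>: "0 < \<sigma>" and C: "0 < C"
    and K_diag: "(\<lambda>j. K j j / real j) \<longlonglongrightarrow> \<sigma>"
    and K_diag_incr: "\<And>i j. 1 \<le> i \<Longrightarrow> i < j \<Longrightarrow> \<bar>K j j - K i i\<bar> \<le> C * sqrt (real j * (real j - real i))"
    and K_minor: "\<And>i j. 1 \<le> i \<Longrightarrow> i < j \<Longrightarrow> K i i * K j j - K i j * K j i \<le> C\<^sup>2 * (real j * (real j - real i))"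
    and K_offdiag: "\<And>i j. 1 \<le> i \<Longrightarrow> i < j \<Longrightarrow>
      K i j * K j i \<le> C * (real i / real j + 1 / sqrt (real j)) * (K i i * K j j)"
begin

sublocale prob_space M
  using Z by (rule permanental_sequence_prob)

lemma Z_measurable: "1 \<le> j \<Longrightarrow> Z j \<in> borel_measurable M"
  using Z by (rule permanental_sequence_measurable)

lemma Z_nonneg: "1 \<le> j \<Longrightarrow> \<omega> \<in> space M \<Longrightarrow> 0 \<le> Z j \<omega>"
  using Z by (rule permanental_sequence_nonneg)

lemma sparse_correlation:
  assumes ij: "i < j"
  shows "K (sparse_index i) (sparse_index j) * K (sparse_index j) (sparse_index i) \<le>
    2 * C / (real j + 2) ^ 3 * (K (sparse_index i) (sparse_index i) * K (sparse_index j) (sparse_index j))"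
proof -
  let ?J = "real j + 2"
  have "real (sparse_index i * (j + 2) ^ 3) \<le> real (sparse_index j)"
    using sparse_index_ratio[OF ij] by (simp only: of_nat_le_iff)
  then have 1: "real (sparse_index i) / real (sparse_index j) \<le> 1 / ?J ^ 3"
    using sparse_index_ge_1[of j] by (simp add: field_simps)
  \<comment> \<open>As \<open>3 * (j + 2)\<close> is at least 6, the index is at least the sixth
    power of \<open>j + 2\<close>, and its square root still dominates the cube.\<close>
  have "?J ^ (3 * 2) \<le> ?J ^ (3 * (j + 2))" by (intro power_increasing) auto
  then have "(?J ^ 3)\<^sup>2 \<le> real (sparse_index j)" by (simp only: power_mult[symmetric]) (simp add: sparse_index_def add.commute)
  then have "?J ^ 3 \<le> sqrt (real (sparse_index j))" by (rule real_le_rsqrt)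
  then have 2: "1 / sqrt (real (sparse_index j)) \<le> 1 / ?J ^ 3"
    using sparse_index_ge_1[of j] by (intro divide_left_mono mult_pos_pos) auto
  have le: "C * (real (sparse_index i) / real (sparse_index j) + 1 / sqrt (real (sparse_index j))) \<le> C * (2 / ?J ^ 3)"
    using 1 2 C by (intro mult_left_mono) auto
  have "K (sparse_index i) (sparse_index j) * K (sparse_index j) (sparse_index i) \<le>
      C * (2 / ?J ^ 3) * (K (sparse_index i) (sparse_index i) * K (sparse_index j) (sparse_index j))"
    by (rule order_trans[OF K_offdiag[OF sparse_index_ge_1 sparse_index_less[OF ij]] mult_right_mono[OF le]])
      (use K_pos[OF sparse_index_ge_1] in \<open>simp add: less_imp_le\<close>)
  then show ?thesis by (simp add: mult.commute)
qed

lemma sparse_infinitely_often: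
  assumes \<epsilon>: "0 < \<epsilon>" "\<epsilon> < 1"
  shows "AE \<omega> in M. \<exists>\<^sub>F i in sequentially. (1 - \<epsilon>) * ln (real i + 2) * K (sparse_index i) (sparse_index i) < Z (sparse_index i) \<omega>"
proof -
  define x where "x i = (1 - \<epsilon>) * ln (real i + 2)" for i :: nat
  have x0: "x i \<ge> 0" for i using \<epsilon> by (simp add: x_def)
  define A where "A i = {\<omega> \<in> space M. x i * K (sparse_index i) (sparse_index i) < Z (sparse_index i) \<omega>}" for i
  define r where "r j = 2 * C / (real j + 2) ^ 3" for j :: nat
  have r0: "r j \<ge> 0" for j using C by (simp add: r_def)
  \<comment> \<open>The part \<open>2 * \<alpha>\<close> linearises the error when
    \<open>r j \<le> 1 / 2\<close>; otherwise the part 2 makes \<open>d j \<ge> 1\<close>, and the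
    bound on pairs is trivial.\<close>
  define d where "d j = (2 * \<alpha> + 2) * r j" for j
  have A_meas: "A i \<in> events" for i
    unfolding A_def using Z_measurable[OF sparse_index_ge_1] by measurable
  have PA: "prob (A i) = measure (gamma_measure \<alpha>) {x i<..}" for i
    unfolding A_def by (rule permanental_tail[OF Z \<alpha> sparse_index_ge_1 K_pos[OF sparse_index_ge_1]])
  have pair: "prob (A i \<inter> A j) \<le> prob (A i) * prob (A j) + d j" if ij: "i < j" for i j
  proof (cases "r j \<le> 1 / 2")
    case True
    have "A i \<inter> A j = {\<omega> \<in> space M. x i * K (sparse_index i) (sparse_index i) < Z (sparse_index i) \<omega> \<and> x j * K (sparse_index j) (sparse_index j) < Z (sparse_index j) \<omega>}"
      by (auto simp: A_def)
    then have "prob (A i \<inter> A j) \<le> prob (A i) * prob (A j) + (1 - (1 - r j) powr \<alpha>)"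
      unfolding PA using True sparse_correlation[OF ij] sparse_index_less[OF ij] x0
      by (simp only: r_def[symmetric])
        (intro permanental_tails_nearly_independent[OF Z \<alpha>] sparse_index_ge_1 K_pos K_nonneg mult_nonneg_nonneg; auto)
    also have "1 - (1 - r j) powr \<alpha> \<le> d j"
      using one_minus_powr_le[OF \<alpha> r0 True] r0[of j] by (simp add: d_def algebra_simps)
    finally show ?thesis by simp
  next
    case False
    have "1 \<le> 2 * r j" using False by simp
    also have "\<dots> \<le> d j" unfolding d_def using \<alpha> r0 by (intro mult_right_mono) auto
    finally have "1 \<le> d j" .
    moreover have "0 \<le> prob (A i) * prob (A j)" by simp
    ultimately show ?thesis using prob_le_1[of "A i \<inter> A j"] by linarith
  qed
  have sum_d: "summable (\<lambda>j. real j * d j)"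
  proof (rule summable_comparison_test_ev)
    have "summable (\<lambda>j. inverse (real (j + 2) ^ 2))"
      using inverse_power_summable[of 2] by (subst summable_iff_shift[of "\<lambda>j. inverse (real j ^ 2)"]) auto
    then show "summable (\<lambda>j. (2 * \<alpha> + 2) * (2 * C) * inverse (real (j + 2) ^ 2))" by (rule summable_mult)
    show "eventually (\<lambda>j. norm (real j * d j) \<le> (2 * \<alpha> + 2) * (2 * C) * inverse (real (j + 2) ^ 2)) sequentially"
    proof (rule always_eventually, rule allI)
      fix j :: nat
      have "real j * d j = (2 * \<alpha> + 2) * (2 * C) * (real j / (real j + 2) ^ 3)"
        by (simp add: d_def r_def)
      also have "real j / (real j + 2) ^ 3 \<le> (real j + 2) / (real j + 2) ^ 3" by (intro divide_right_mono) auto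
      also have "\<dots> = inverse (real (j + 2) ^ 2)" by (simp add: power3_eq_cube power2_eq_square inverse_eq_divide add.commute)
      finally have "real j * d j \<le> (2 * \<alpha> + 2) * (2 * C) * inverse (real (j + 2) ^ 2)"
        using \<alpha> C by (simp add: mult_left_mono)
      moreover have "0 \<le> d j" using \<alpha> r0 by (simp add: d_def)
      ultimately show "norm (real j * d j) \<le> (2 * \<alpha> + 2) * (2 * C) * inverse (real (j + 2) ^ 2)" by simp
    qed
  qed
  have div: "filterlim (\<lambda>n. \<Sum>i<n. prob (A i)) at_top sequentially"
  proof -
    \<comment> \<open>At the level \<open>(1 - \<epsilon>) * ln (i + 2)\<close> the lower tail
      estimate is \<open>(i + 2) powr (\<epsilon> - 1)\<close> up to a logarithmic factor, hence
      eventually above the harmonic series.\<close>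
    have "eventually (\<lambda>i::nat. 1 / (real i + 2) \<le> exp (- ((1 - \<epsilon>) * ln (real i + 2) + 1)) / (((1 - \<epsilon>) * ln (real i + 2) + 1) * Gamma \<alpha>)) sequentially"
      using \<epsilon> Gamma_real_pos[OF \<alpha>] by real_asymp
    moreover have "eventually (\<lambda>i::nat. 1 \<le> (1 - \<epsilon>) * ln (real i + 2)) sequentially"
      using \<epsilon> by real_asymp
    ultimately have "eventually (\<lambda>i. 1 / (real i + 2) \<le> prob (A i)) sequentially"
      by eventually_elim (unfold PA x_def, rule order_trans, assumption, rule gamma_measure_tail_ge[OF \<alpha>])
    then have ev: "eventually (\<lambda>i. norm (inverse (real (i + 2))) \<le> prob (A i)) sequentially"
      by (rule eventually_mono) (simp add: field_simps)
    have "\<not> summable (\<lambda>i. prob (A i))"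
    proof
      assume "summable (\<lambda>i. prob (A i))"
      then have "summable (\<lambda>i. inverse (real (i + 2)))" using ev by (rule summable_comparison_test_ev[rotated])
      then show False using not_summable_harmonic by (subst (asm) summable_iff_shift[of "\<lambda>i. inverse (real i)"]) auto
    qed
    then show ?thesis
by (intro nonneg_not_summable_imp_at_top) auto
  qed
  have d0: "0 \<le> d j" for j using \<alpha> r0 by (simp add: d_def)
  have "AE \<omega> in M. \<exists>\<^sub>F i in sequentially. \<omega> \<in> A i"
    by (rule quasi_independent_infinitely_often[OF A_meas div d0 sum_d pair])
  then show ?thesis
    by (rule eventually_mono) (auto simp: A_def x_def elim!: frequently_elim1)
qed

end

section \<open>Upper bound\<close>

lemma power_minus_two_exp_le: "2 ^ m * exp (- (2 * real m)) \<le> 1"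
proof -
  have "2 ^ m \<le> (exp 1 * exp 1 :: real) ^ m"
    using exp_ge_add_one_self[of 1] mult_mono[of 2 "exp 1" 1 "exp 1 :: real"] by (intro power_mono) auto
  also have "\<dots> = exp (2 * real m)" by (simp add: exp_add[symmetric] exp_of_nat_mult[symmetric] mult.commute)
  finally show ?thesis by (simp add: exp_minus field_simps)
qed

text \<open>With \<open>m = n - l\<close>, the terms dominate the chaining thresholds relative to
  \<open>2 ^ n * ln n\<close>, up to a constant factor.\<close>

lemma summable_chaining: "summable (\<lambda>m. (1 / sqrt 2) ^ m * (3 + 2 * real m))"
proof (rule summable_comparison_test_ev)
  show "eventually (\<lambda>m. norm ((1 / sqrt 2) ^ m * (3 + 2 * real m)) \<le> inverse (real m ^ 2)) sequentially"
  proof -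
    have "eventually (\<lambda>m. (1 / sqrt 2) ^ m * (3 + 2 * real m) \<le> inverse (real m ^ 2)) sequentially"
      by real_asymp
    then show ?thesis by (rule eventually_mono) simp
  qed
  show "summable (\<lambda>m. inverse (real m ^ 2))" by (rule inverse_power_summable) simp
qed

lemma sqrt_two_powers:
  assumes "l \<le> n"
  shows "sqrt (2 ^ n * 2 ^ l) = 2 ^ n * (1 / sqrt 2) ^ (n - l)"
proof (rule real_sqrt_unique)
  have "(2 ^ n * (1 / sqrt 2) ^ (n - l))\<^sup>2 = (2 ^ n)\<^sup>2 * ((1 / sqrt 2)\<^sup>2) ^ (n - l)"
    by (simp add: power_mult_distrib power_mult[symmetric] mult.commute)
  also have "\<dots> = 2 ^ n * (2 ^ (l + (n - l)) / 2 ^ (n - l))"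
    using assms by (simp add: power_divide power2_eq_square)
  also have "\<dots> = 2 ^ n * 2 ^ l" by (simp add: power_add)
  finally show "(2 ^ n * (1 / sqrt 2) ^ (n - l))\<^sup>2 = 2 ^ n * (2 ^ l :: real)" .
qed simp

context lil_kernel begin

text \<open>\<open>D\<close> is any upper bound of the scale, so that all increments of one chaining
  level can share it.\<close>

lemma increment_tail:
  assumes i: "1 \<le> i" "i < j" and D: "0 < D" "4 * C * sqrt (real j * (real j - real i)) \<le> D"
  shows "prob {\<omega> \<in> space M. x < \<bar>Z i \<omega> - Z j \<omega>\<bar>} \<le> 2 * 2 powr \<alpha> * exp (- (x / D))"
proof (rule diff_tail[OF prob_space_axioms])
  have j: "1 \<le> j" "i \<noteq> j" using i by auto
  let ?s = "sqrt (real j * (real j - real i))"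
  have s: "0 \<le> real j * (real j - real i)" using i by simp
  show "Z i \<in> borel_measurable M" "Z j \<in> borel_measurable M" using Z_measurable i j by auto
  show "AE \<omega> in M. 0 \<le> Z i \<omega>" "AE \<omega> in M. 0 \<le> Z j \<omega>" using Z_nonneg i j by auto
  show "0 < K i i" "0 < K j j" using K_pos i j by auto
  show "K i j * K j i \<le> K i i * K j j" using permanental_minor_nonneg[OF Z] i j by auto
  show "\<bar>K i i - K j j\<bar> \<le> D / 4" using K_diag_incr[OF i] D by (simp add: abs_minus_commute)
  have "(4 * C * ?s)\<^sup>2 \<le> D\<^sup>2" using D C s by (intro power_mono) auto
  then have "16 * (C\<^sup>2 * (real j * (real j - real i))) \<le> D\<^sup>2" using s by (simp add: power_mult_distrib)
  moreover have "0 \<le> C\<^sup>2 * (real j * (real j - real i))" using s by simp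
  ultimately show "K i i * K j j - K i j * K j i \<le> D\<^sup>2 / 4" using K_minor[OF i] by linarith
  fix s t :: real assume "0 \<le> s" "0 \<le> t"
  then show "(LINT \<omega>|M. exp (- (s * Z i \<omega> + t * Z j \<omega>))) =
      ((1 + s * K i i) * (1 + t * K j j) - s * t * (K i j * K j i)) powr (- \<alpha>)"
    using permanental_laplace_2[OF Z i(1) j] by simp
qed (use \<alpha> D in auto)

text \<open>There are \<open>2 ^ (n - Suc l)\<close> increments of length \<open>2 ^ l\<close> in the block \<open>[2 ^ n, 2 ^ Suc n)\<close>, with
  tails on the scale \<open>8 * C * sqrt (2 ^ n * 2 ^ l)\<close>. The last factor of the threshold makes the union
  bound over all of them summable in \<open>n\<close>.\<close>

definition threshold :: "nat \<Rightarrow> nat \<Rightarrow> real" where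
  "threshold n l = 8 * C * sqrt (2 ^ n * 2 ^ l) * (3 * ln (real n) + 2 * (real n - real l))"

text \<open>The two indices differ in binary digit \<open>l\<close> only, and all lower digits are
  0: one step of the chain clears the digit \<open>l\<close>.\<close>

definition chain_event :: "nat \<Rightarrow> nat \<Rightarrow> nat \<Rightarrow> 'a set" where
  "chain_event n l b = {\<omega> \<in> space M. threshold n l < \<bar>Z (2 ^ Suc l * b) \<omega> - Z (2 ^ Suc l * b + 2 ^ l) \<omega>\<bar>}"

text \<open>The range of \<open>b\<close> is exactly the one for which both indices lie in the
  dyadic block.\<close>

definition bad_chain :: "nat \<Rightarrow> 'a set" where
  "bad_chain n = (\<Union>l<n. \<Union>b\<in>{2 ^ (n - Suc l)..<2 ^ (n - l)}. chain_event n l b)"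

lemma chain_event_prob:
  assumes n: "1 \<le> n" and l: "l < n" and b: "2 ^ (n - Suc l) \<le> b" "b < 2 ^ (n - l)"
  shows "chain_event n l b \<in> events"
    and "prob (chain_event n l b) \<le> 2 * 2 powr \<alpha> * (inverse (real n ^ 3) * exp (- (2 * (real n - real l))))"
proof -
  let ?i = "2 ^ Suc l * b" and ?j = "2 ^ Suc l * b + 2 ^ l"
  have b1: "1 \<le> b" using b(1) by (metis le_trans one_le_numeral one_le_power)
  then have i: "1 \<le> ?i" by (metis le_trans mult_le_mono one_le_numeral one_le_power mult_1)
  have j1: "1 \<le> ?j" using i by linarith
  show "chain_event n l b \<in> events"
    unfolding chain_event_def using Z_measurable[of ?i] Z_measurable[of ?j] i j1 by measurable
  have "Suc b \<le> 2 ^ (n - l)" using b by simp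
  then have "2 ^ Suc l * Suc b \<le> 2 ^ Suc l * 2 ^ (n - l)" by (rule mult_left_mono) simp
  also have "\<dots> = 2 * 2 ^ n" using l by (simp add: power_add[symmetric])
  finally have j: "?j \<le> 2 * 2 ^ n" by simp
  have jr: "real ?j \<le> 2 * 2 ^ n" using of_nat_mono[OF j, where 'a = real] by simp
  have d: "real ?j - real ?i = 2 ^ l" by simp
  \<comment> \<open>The constant 8 is 4 times 2: \<open>increment_tail\<close> asks for 4, and
    bounding the larger index by \<open>4 * 2 ^ n\<close> under the root yields 2.\<close>
  define D where "D = 8 * C * sqrt (2 ^ n * 2 ^ l)"
  have D0: "0 < D" using C by (simp add: D_def)
  have "sqrt (real ?j * (real ?j - real ?i)) \<le> sqrt (2\<^sup>2 * (2 ^ n * 2 ^ l))"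
  proof -
    have "real ?j \<le> 4 * 2 ^ n" using jr by (rule order_trans) simp
    then have "real ?j * 2 ^ l \<le> 4 * 2 ^ n * 2 ^ l" by (rule mult_right_mono) simp
    then show ?thesis unfolding d by (intro real_sqrt_le_mono) (simp add: mult.assoc)
  qed
  also have "\<dots> = 2 * sqrt (2 ^ n * 2 ^ l)" by (simp only: real_sqrt_mult real_sqrt_abs abs_numeral)
  finally have "4 * C * sqrt (real ?j * (real ?j - real ?i)) \<le> 4 * C * (2 * sqrt (2 ^ n * 2 ^ l))"
    using C by (intro mult_left_mono) auto
  then have "4 * C * sqrt (real ?j * (real ?j - real ?i)) \<le> D" by (simp add: D_def)
  then have "prob (chain_event n l b) \<le> 2 * 2 powr \<alpha> * exp (- (threshold n l / D))"
    unfolding chain_event_def using i D0 by (intro increment_tail) auto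
  also have "threshold n l / D = 3 * ln (real n) + 2 * (real n - real l)"
  proof -
    have "threshold n l = D * (3 * ln (real n) + 2 * (real n - real l))" by (simp add: threshold_def D_def)
    then show ?thesis using D0 by (simp only: nonzero_mult_div_cancel_left[OF less_imp_neq[THEN not_sym]])
  qed
  also have "exp (- (3 * ln (real n) + 2 * (real n - real l))) = exp (- (3 * ln (real n))) * exp (- (2 * (real n - real l)))"
    by (simp only: minus_add_distrib exp_add)
  also have "exp (- (3 * ln (real n))) = inverse (real n ^ 3)"
  proof -
    have "3 * ln (real n) = ln (real n ^ 3)" using n by (simp add: ln_realpow)
    then show ?thesis using n by (simp only: exp_minus) simp
  qed
  finally show "prob (chain_event n l b) \<le> 2 * 2 powr \<alpha> * (inverse (real n ^ 3) * exp (- (2 * (real n - real l))))" .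
qed

text \<open>Level \<open>l\<close> has at most \<open>2 ^ (n - l)\<close> increments, outweighed by
  the factor \<open>exp (- 2 * (n - l))\<close>. What remains is of order \<open>n ^ (- 3)\<close>
  for each of the \<open>n\<close> levels, and the total is summable.\<close>

lemma bad_chain_prob:
  assumes n: "1 \<le> n"
  shows "bad_chain n \<in> events" and "prob (bad_chain n) \<le> 2 * 2 powr \<alpha> * inverse (real n ^ 2)"
proof -
  let ?B = "\<lambda>l. {2 ^ (n - Suc l)..<2 ^ (n - l)} :: nat set"
  have ev: "chain_event n l b \<in> events" if "l < n" "b \<in> ?B l" for l b
    using chain_event_prob(1)[OF n that(1)] that by simp
  then show "bad_chain n \<in> events" unfolding bad_chain_def by (intro sets.finite_UN) auto
  have "prob (bad_chain n) \<le> (\<Sum>l<n. prob (\<Union>b\<in>?B l. chain_event n l b))"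
    unfolding bad_chain_def using ev by (intro finite_measure_subadditive_finite) (auto intro!: sets.finite_UN)
  also have "\<dots> \<le> (\<Sum>l<n. \<Sum>b\<in>?B l. prob (chain_event n l b))"
    using ev by (intro sum_mono finite_measure_subadditive_finite) auto
  also have "\<dots> \<le> (\<Sum>l<n. 2 * 2 powr \<alpha> * inverse (real n ^ 3))"
  proof (intro sum_mono)
    fix l assume l: "l \<in> {..<n}"
    let ?e = "2 * 2 powr \<alpha> * (inverse (real n ^ 3) * exp (- (2 * (real n - real l))))"
    have "(\<Sum>b\<in>?B l. prob (chain_event n l b)) \<le> real (card (?B l)) * ?e"
      using chain_event_prob(2)[OF n, of l] l by (intro sum_bounded_above) auto
    also have "\<dots> \<le> 2 ^ (n - l) * ?e"
    proof (rule mult_right_mono)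
      have "card (?B l) \<le> 2 ^ (n - l)" by simp
      from of_nat_mono[OF this, where 'a = real] show "real (card (?B l)) \<le> 2 ^ (n - l)" by (simp only: of_nat_power of_nat_numeral)
    qed simp
    also have "\<dots> = 2 * 2 powr \<alpha> * inverse (real n ^ 3) * (2 ^ (n - l) * exp (- (2 * real (n - l))))"
      using l by (simp add: of_nat_diff)
    also have "\<dots> \<le> 2 * 2 powr \<alpha> * inverse (real n ^ 3) * 1"
      by (intro mult_left_mono power_minus_two_exp_le) simp
    finally show "(\<Sum>b\<in>?B l. prob (chain_event n l b)) \<le> 2 * 2 powr \<alpha> * inverse (real n ^ 3)" by simp
  qed
  also have "\<dots> = 2 * 2 powr \<alpha> * inverse (real n ^ 2)"
    using n by (simp add: power3_eq_cube power2_eq_square)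
  finally show "prob (bad_chain n) \<le> 2 * 2 powr \<alpha> * inverse (real n ^ 2)" .
qed

text \<open>\<open>2 ^ L * (j div 2 ^ L)\<close> is \<open>j\<close> with its lowest
  \<open>L\<close> binary digits cleared. Induction clears one digit at a time; an even quotient
  makes the step void, an odd one is an increment controlled outside
  \<open>bad_chain n\<close>.\<close>

lemma chain_bound:
  assumes j: "2 ^ n \<le> j" "j < 2 ^ Suc n" and \<omega>: "\<omega> \<in> space M" "\<omega> \<notin> bad_chain n" and L: "L \<le> n"
  shows "\<bar>Z j \<omega> - Z (2 ^ L * (j div 2 ^ L)) \<omega>\<bar> \<le> (\<Sum>l<L. threshold n l)"
  using L
proof (induction L)
  case (Suc l)
  define b where "b = j div 2 ^ Suc l"
  have "0 \<le> ln (real n)" using Suc by simp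
  then have t0: "0 \<le> threshold n l" using C Suc.prems by (simp add: threshold_def)
  have half: "b = (j div 2 ^ l) div 2" unfolding b_def power_Suc2 by (rule div_mult2_eq)
  have step: "\<bar>Z (2 ^ l * (j div 2 ^ l)) \<omega> - Z (2 ^ Suc l * b) \<omega>\<bar> \<le> threshold n l"
  proof (cases "even (j div 2 ^ l)")
    case True
    then have eq: "2 ^ l * (j div 2 ^ l) = 2 ^ Suc l * b" unfolding half by simp
    show ?thesis unfolding eq using t0 by simp
  next
    case False
    then have "j div 2 ^ l = 2 * b + 1" unfolding half by simp
    then have eq: "2 ^ l * (j div 2 ^ l) = 2 ^ Suc l * b + 2 ^ l" by (simp add: algebra_simps)
    have n: "n = (n - Suc l) + Suc l" using Suc.prems by simp
    have "2 ^ n div 2 ^ Suc l \<le> b" unfolding b_def by (rule div_le_mono[OF j(1)])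
    moreover have "(2 :: nat) ^ n div 2 ^ Suc l = 2 ^ (n - Suc l)"
      using Suc.prems by (simp only: power_diff[symmetric])
    ultimately have b1: "2 ^ (n - Suc l) \<le> b" by simp
    have "Suc n = (n - l) + Suc l" using Suc.prems by simp
    then have "(2 :: nat) ^ Suc n = 2 ^ (n - l) * 2 ^ Suc l" by (simp only: power_add)
    then have b2: "b < 2 ^ (n - l)"
      unfolding b_def using j(2) by (simp only: less_mult_imp_div_less)
    have "\<omega> \<notin> chain_event n l b"
      using \<omega>(2) b1 b2 Suc.prems by (auto simp: bad_chain_def)
    then show ?thesis using \<omega>(1) by (simp add: chain_event_def eq abs_minus_commute)
  qed
  show ?case using Suc step unfolding b_def by simp
qed simp

text \<open>Relative to \<open>2 ^ n * ln n\<close> the thresholds are dominated by a summable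
  series in \<open>n - l\<close>. Stopping the chain at level \<open>n - P\<close> leaves only a
  tail of that series, small for large \<open>P\<close> uniformly in \<open>n\<close>.\<close>

lemma chain_sum:
  assumes \<delta>: "0 < \<delta>"
  obtains P where "eventually (\<lambda>n. (\<Sum>l<n - P. threshold n l) \<le> \<delta> * 2 ^ n * ln (real n)) sequentially"
proof -
  define h where "h m = (1 / sqrt 2) ^ m * (3 + 2 * real m)" for m
  have h0: "0 \<le> h m" for m by (simp add: h_def)
  have hs: "summable h" unfolding h_def by (rule summable_chaining)
  obtain P where P: "norm (\<Sum>i. h (i + P)) < \<delta> / (8 * C)"
    using suminf_exist_split[OF _ hs, of "\<delta> / (8 * C)"] \<delta> C by auto
  have "(\<Sum>l<n - P. threshold n l) \<le> \<delta> * 2 ^ n * ln (real n)" if ln: "1 \<le> ln (real n)" for n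
  proof -
    have "(\<Sum>l<n - P. threshold n l) \<le> (\<Sum>l<n - P. 8 * C * 2 ^ n * ln (real n) * h (n - l))"
    proof (intro sum_mono)
      fix l assume l: "l \<in> {..<n - P}"
      have "3 * ln (real n) + 2 * (real n - real l) \<le> ln (real n) * (3 + 2 * real (n - l))"
        using ln l mult_right_mono[OF ln, of "2 * real (n - l)"] by (simp add: of_nat_diff algebra_simps)
      then have "8 * C * (2 ^ n * (1 / sqrt 2) ^ (n - l)) * (3 * ln (real n) + 2 * (real n - real l))
         \<le> 8 * C * (2 ^ n * (1 / sqrt 2) ^ (n - l)) * (ln (real n) * (3 + 2 * real (n - l)))"
        using C by (intro mult_left_mono) auto
      then show "threshold n l \<le> 8 * C * 2 ^ n * ln (real n) * h (n - l)"
        using sqrt_two_powers[of l n] l unfolding threshold_def h_def by (simp only: mult_ac lessThan_iff less_imp_le)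
    qed
    also have "\<dots> = 8 * C * 2 ^ n * ln (real n) * (\<Sum>l<n - P. h (n - l))"
      by (simp only: sum_distrib_left)
    also have "(\<Sum>l<n - P. h (n - l)) \<le> (\<Sum>i. h (i + P))"
    proof -
      have "(\<Sum>l<n - P. h (n - l)) = (\<Sum>i\<in>{1..n - P}. h (i + P))"
        by (rule sum.reindex_bij_witness[of _ "\<lambda>i. n - P - i" "\<lambda>l. n - P - l"]) (auto intro!: arg_cong[where f = h])
      also have "\<dots> \<le> (\<Sum>i. h (i + P))"
        using hs h0 by (intro sum_le_suminf) (auto simp: summable_iff_shift)
      finally show ?thesis .
    qed
    also have "(\<Sum>i. h (i + P)) \<le> \<delta> / (8 * C)" using P by simp
    finally show ?thesis using C ln by (simp add: mult_left_mono field_simps)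
  qed
  moreover have "eventually (\<lambda>n. 1 \<le> ln (real n)) sequentially" by real_asymp
  ultimately have "eventually (\<lambda>n. (\<Sum>l<n - P. threshold n l) \<le> \<delta> * 2 ^ n * ln (real n)) sequentially"
    by (auto elim!: eventually_mono)
  then show ?thesis by (rule that)
qed

lemma AE_eventually_not_bad_chain: "AE \<omega> in M. eventually (\<lambda>n. \<omega> \<notin> bad_chain n) sequentially"
proof -
  \<comment> \<open>Shifted by one, as the probability estimate is stated for
    \<open>n \<ge> 1\<close>.\<close>
  define A where "A n = bad_chain (Suc n)" for n
  have "summable (\<lambda>n. prob (A n))"
  proof (rule summable_comparison_test_ev)
    have "summable (\<lambda>n. inverse (real (n + 1) ^ 2))"
      using inverse_power_summable[of 2] by (subst summable_iff_shift[of "\<lambda>n. inverse (real n ^ 2)"]) auto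
    then show "summable (\<lambda>n. 2 * 2 powr \<alpha> * inverse (real (n + 1) ^ 2))" by (rule summable_mult)
    show "eventually (\<lambda>n. norm (prob (A n)) \<le> 2 * 2 powr \<alpha> * inverse (real (n + 1) ^ 2)) sequentially"
    proof (intro always_eventually allI)
      fix n
      show "norm (prob (A n)) \<le> 2 * 2 powr \<alpha> * inverse (real (n + 1) ^ 2)"
        using bad_chain_prob(2)[of "Suc n"] by (simp add: A_def)
    qed
  qed
  then have "AE \<omega> in M. eventually (\<lambda>n. \<omega> \<in> space M - A n) sequentially"
    using bad_chain_prob(1) by (intro borel_cantelli_AE1) (auto simp: A_def emeasure_eq_measure)
  then show ?thesis
  proof (rule eventually_mono)
    fix \<omega> assume "eventually (\<lambda>n. \<omega> \<in> space M - A n) sequentially"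
    then have "eventually (\<lambda>n. \<omega> \<notin> bad_chain (Suc n)) sequentially" by (rule eventually_mono) (simp add: A_def)
    then show "eventually (\<lambda>n. \<omega> \<notin> bad_chain n) sequentially" by (rule eventually_sequentially_Suc[THEN iffD1])
  qed
qed

text \<open>For fixed \<open>P\<close> every block has \<open>2 ^ P\<close> nodes, so the union
  bound costs a constant factor and the sharp gamma tail survives.\<close>

lemma AE_eventually_nodes_le:
  assumes \<delta>: "0 < \<delta>"
  shows "AE \<omega> in M. eventually (\<lambda>n. \<forall>b\<in>{2 ^ P..<2 ^ Suc P}.
    Z (2 ^ (n - P) * b) \<omega> \<le> (1 + \<delta>) * ln (real n) * K (2 ^ (n - P) * b) (2 ^ (n - P) * b)) sequentially"
proof -
  let ?B = "{2 ^ P..<2 ^ Suc P} :: nat set"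
  define E where "E n b = {\<omega> \<in> space M. (1 + \<delta>) * ln (real n) * K (2 ^ (n - P) * b) (2 ^ (n - P) * b) < Z (2 ^ (n - P) * b) \<omega>}" for n b
  define A where "A n = (\<Union>b\<in>?B. E (Suc n) b)" for n
  \<comment> \<open>Makes \<open>t * (1 + \<delta>) = 1 + \<delta> / 2\<close>, a summable exponent,
    while keeping \<open>t < 1\<close>.\<close>
  define t where "t = (1 + \<delta> / 2) / (1 + \<delta>)"
  have t: "0 \<le> t" "t < 1" using \<delta> by (auto simp: t_def)
  define c where "c = real (card ?B) * (1 - t) powr (- \<alpha>)"
  have node: "1 \<le> 2 ^ (n - P) * b" if "b \<in> ?B" for n b
  proof -
    have "1 \<le> (2::nat) ^ P" by simp
    then have "1 \<le> b" using that by (simp del: one_le_power)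
    then show ?thesis by (metis mult_le_mono one_le_numeral one_le_power mult_1)
  qed
  have E: "E n b \<in> events" if "b \<in> ?B" for n b
    unfolding E_def using Z_measurable[OF node[OF that]] by measurable
  then have A: "A n \<in> events" for n unfolding A_def by (intro sets.finite_UN) auto
  have PE: "prob (E n b) \<le> (1 - t) powr (- \<alpha>) * real n powr (- (1 + \<delta> / 2))" if b: "b \<in> ?B" and n: "1 \<le> n" for n b
  proof -
    have "prob (E n b) = measure (gamma_measure \<alpha>) {(1 + \<delta>) * ln (real n)<..}"
      unfolding E_def by (rule permanental_tail[OF Z \<alpha> node[OF b] K_pos[OF node[OF b]]])
    also have "\<dots> \<le> (1 - t) powr (- \<alpha>) * exp (- (t * ((1 + \<delta>) * ln (real n))))"
      by (rule gamma_measure_tail_le[OF \<alpha> t])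
    also have "t * ((1 + \<delta>) * ln (real n)) = (1 + \<delta> / 2) * ln (real n)" using \<delta> by (simp add: t_def)
    also have "exp (- \<dots>) = real n powr (- (1 + \<delta> / 2))" using n by (simp add: powr_def algebra_simps)
    finally show ?thesis .
  qed
  have PA: "prob (A n) \<le> c * real (Suc n) powr (- (1 + \<delta> / 2))" for n
  proof -
    have "prob (A n) \<le> (\<Sum>b\<in>?B. prob (E (Suc n) b))"
      unfolding A_def using E by (intro finite_measure_subadditive_finite) auto
    also have "\<dots> \<le> real (card ?B) * ((1 - t) powr (- \<alpha>) * real (Suc n) powr (- (1 + \<delta> / 2)))"
      by (intro sum_bounded_above PE) auto
    finally show ?thesis by (simp only: c_def mult.assoc)
  qed
  have "summable (\<lambda>n. prob (A n))"
  proof (rule summable_comparison_test_ev)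
    have "summable (\<lambda>n. real n powr (- (1 + \<delta> / 2)))" using \<delta> by (simp add: summable_real_powr_iff)
    then have "summable (\<lambda>n. real (Suc n) powr (- (1 + \<delta> / 2)))"
      by (subst summable_Suc_iff[of "\<lambda>n. real n powr (- (1 + \<delta> / 2))"])
    then show "summable (\<lambda>n. c * real (Suc n) powr (- (1 + \<delta> / 2)))" by (rule summable_mult)
    show "eventually (\<lambda>n. norm (prob (A n)) \<le> c * real (Suc n) powr (- (1 + \<delta> / 2))) sequentially"
      using PA by (intro always_eventually) (simp del: of_nat_Suc)
  qed
  then have "AE \<omega> in M. eventually (\<lambda>n. \<omega> \<in> space M - A n) sequentially"
    using A by (intro borel_cantelli_AE1) (auto simp: emeasure_eq_measure)
  then show ?thesis
  proof (rule eventually_mono)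
    fix \<omega> assume "eventually (\<lambda>n. \<omega> \<in> space M - A n) sequentially"
    then have "eventually (\<lambda>n. \<forall>b\<in>?B. Z (2 ^ (Suc n - P) * b) \<omega> \<le> (1 + \<delta>) * ln (real (Suc n)) * K (2 ^ (Suc n - P) * b) (2 ^ (Suc n - P) * b)) sequentially"
      by (rule eventually_mono) (auto simp: A_def E_def not_less)
    then show "eventually (\<lambda>n. \<forall>b\<in>?B. Z (2 ^ (n - P) * b) \<omega> \<le> (1 + \<delta>) * ln (real n) * K (2 ^ (n - P) * b) (2 ^ (n - P) * b)) sequentially"
      by (rule iffD1[OF eventually_sequentially_Suc])
  qed
qed

lemma upper_bound:
  assumes \<epsilon>: "0 < \<epsilon>"
  shows "AE \<omega> in M. eventually (\<lambda>j. Z j \<omega> \<le> (\<sigma> + \<epsilon>) * (real j * ln (ln (real j)))) sequentially"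
proof -
  \<comment> \<open>Losses to be absorbed: the outer \<open>1 + \<delta>\<close> replaces
    \<open>ln n\<close> by \<open>ln (ln j)\<close>, the inner one is the gamma threshold,
    \<open>\<sigma> + \<delta>\<close> bounds the diagonal, and the summand \<open>\<delta>\<close>
    is the chaining error.\<close>
  have "((\<lambda>\<delta>. (1 + \<delta>) * ((1 + \<delta>) * (\<sigma> + \<delta>) + \<delta>)) \<longlongrightarrow> (1 + 0) * ((1 + 0) * (\<sigma> + 0) + 0)) (at_right 0)"
    by (intro tendsto_intros)
  then have "eventually (\<lambda>\<delta>. (1 + \<delta>) * ((1 + \<delta>) * (\<sigma> + \<delta>) + \<delta>) < \<sigma> + \<epsilon>) (at_right 0)"
    using \<epsilon> by (intro order_tendstoD) auto
  then have "eventually (\<lambda>\<delta>. 0 < \<delta> \<and> (1 + \<delta>) * ((1 + \<delta>) * (\<sigma> + \<delta>) + \<delta>) < \<sigma> + \<epsilon>) (at_right 0)"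
    by (intro eventually_conj eventually_at_right_less)
  then obtain \<delta> where \<delta>: "0 < \<delta>" "(1 + \<delta>) * ((1 + \<delta>) * (\<sigma> + \<delta>) + \<delta>) < \<sigma> + \<epsilon>"
    using eventually_happens'[OF trivial_limit_at_right_real] by blast
  obtain P where P: "eventually (\<lambda>n. (\<Sum>l<n - P. threshold n l) \<le> \<delta> * 2 ^ n * ln (real n)) sequentially"
    using chain_sum[OF \<delta>(1)] .
  have "eventually (\<lambda>m. K m m / real m < \<sigma> + \<delta>) sequentially"
    using K_diag \<delta> by (intro order_tendstoD) auto
  then obtain m0 where m0: "\<And>m. m0 \<le> m \<Longrightarrow> K m m / real m < \<sigma> + \<delta>" by (auto simp: eventually_sequentially)
  have ev2: "eventually (\<lambda>n::nat. m0 \<le> (2::nat) ^ n) sequentially"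
    by (intro eventually_sequentiallyI[of m0]) (meson le_trans less_exp less_imp_le)
  \<comment> \<open>From \<open>2 ^ n \<le> j\<close> only
    \<open>ln (n * ln 2) \<le> ln (ln j)\<close> follows; the factor \<open>1 + \<delta>\<close>
    makes up for \<open>ln 2 < 1\<close>.\<close>
  have ev3: "eventually (\<lambda>n. ln (real n) \<le> (1 + \<delta>) * ln (real n * ln 2)) sequentially"
    using \<delta>(1) by real_asymp
  have ev4: "eventually (\<lambda>n. 1 < real n * ln 2) sequentially" by real_asymp
  show ?thesis
    using AE_eventually_not_bad_chain AE_eventually_nodes_le[OF \<delta>(1), of P] AE_space
  proof eventually_elim
    case (elim \<omega>)
    from eventually_conj[OF eventually_conj[OF elim(1,2)] eventually_conj[OF P eventually_conj[OF ev2 eventually_conj[OF ev3 eventually_conj[OF ev4 eventually_ge_at_top[of "max 1 P"]]]]]]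
    obtain N where N: "\<And>n. N \<le> n \<Longrightarrow> \<omega> \<notin> bad_chain n"
      "\<And>n b. N \<le> n \<Longrightarrow> b \<in> {2 ^ P..<2 ^ Suc P} \<Longrightarrow>
        Z (2 ^ (n - P) * b) \<omega> \<le> (1 + \<delta>) * ln (real n) * K (2 ^ (n - P) * b) (2 ^ (n - P) * b)"
      "\<And>n. N \<le> n \<Longrightarrow> (\<Sum>l<n - P. threshold n l) \<le> \<delta> * 2 ^ n * ln (real n)"
      "\<And>n. N \<le> n \<Longrightarrow> m0 \<le> 2 ^ n" "\<And>n. N \<le> n \<Longrightarrow> ln (real n) \<le> (1 + \<delta>) * ln (real n * ln 2)"
      "\<And>n. N \<le> n \<Longrightarrow> 1 < real n * ln 2" "\<And>n. N \<le> n \<Longrightarrow> 1 \<le> n \<and> P \<le> n"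
      unfolding eventually_sequentially by (auto simp: Ball_def)
    show ?case
    proof (rule eventually_sequentiallyI[of "2 ^ N"])
      fix j :: nat assume jN: "2 ^ N \<le> j"
      have "1 \<le> j" using jN by (metis le_trans one_le_numeral one_le_power)
      then obtain n where n: "2 ^ n \<le> j" "j < 2 ^ Suc n" using ex_power_ivl1[of 2 j] by auto
      have "(2::nat) ^ N < 2 ^ Suc n" using jN n by simp
      then have nN: "N \<le> n" using power_less_imp_less_exp[of "2 :: nat" N "Suc n"] by (simp del: power_Suc)
      \<comment> \<open>The top \<open>P + 1\<close> binary digits of \<open>j\<close>; the node
        \<open>v\<close> keeps these and clears the rest.\<close>
      define b where "b = j div 2 ^ (n - P)"
      have Pn: "P \<le> n" using N(7)[OF nN] by simp
      have b: "b \<in> {2 ^ P..<2 ^ Suc P}"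
      proof -
        have e: "(2::nat) ^ n = 2 ^ P * 2 ^ (n - P)" "(2::nat) ^ Suc n = 2 ^ Suc P * 2 ^ (n - P)"
          using Pn by (simp_all add: power_add[symmetric])
        have "2 ^ P \<le> b" unfolding b_def using n(1) e(1) by (simp add: less_eq_div_iff_mult_less_eq)
        moreover have "b < 2 ^ Suc P" unfolding b_def using n(2) e(2) by (simp only: less_mult_imp_div_less)
        ultimately show ?thesis by simp
      qed
      define v where "v = 2 ^ (n - P) * b"
      have vj: "v \<le> j" unfolding v_def b_def by simp
      have "2 ^ n = 2 ^ (n - P) * (2 ^ P :: nat)" using Pn by (simp add: power_add[symmetric])
      also have "\<dots> \<le> v" unfolding v_def using b by simp
      finally have vn: "2 ^ n \<le> v" .
      have v0: "0 < v" using vn by (metis le_zero_eq not_gr_zero power_not_zero zero_neq_numeral)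
      have ln0: "0 \<le> ln (real n)" using N(7)[OF nN] by simp
      have "K v v / real v < \<sigma> + \<delta>" using N(4)[OF nN] vn by (intro m0) simp
      then have Kv: "K v v \<le> (\<sigma> + \<delta>) * real v" using v0 by (simp add: field_simps)
      also have "\<dots> \<le> (\<sigma> + \<delta>) * real j" using vj \<sigma> \<delta> by (intro mult_left_mono) auto
      finally have Kv: "K v v \<le> (\<sigma> + \<delta>) * real j" .
      have "Z v \<omega> \<le> (1 + \<delta>) * ln (real n) * K v v" using N(2)[OF nN b] by (simp add: v_def)
      also have "\<dots> \<le> (1 + \<delta>) * ln (real n) * ((\<sigma> + \<delta>) * real j)" using Kv ln0 \<delta> by (intro mult_left_mono) auto
      finally have Zv: "Z v \<omega> \<le> (1 + \<delta>) * ln (real n) * ((\<sigma> + \<delta>) * real j)" .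
      have "\<bar>Z j \<omega> - Z v \<omega>\<bar> \<le> (\<Sum>l<n - P. threshold n l)"
        unfolding v_def b_def using n elim(3) N(1)[OF nN] by (intro chain_bound) auto
      also have "\<dots> \<le> \<delta> * 2 ^ n * ln (real n)" by (rule N(3)[OF nN])
      also have "\<dots> \<le> \<delta> * real j * ln (real n)"
        using n(1) \<delta> ln0 of_nat_mono[OF n(1), where 'a = real] by (intro mult_right_mono mult_left_mono) auto
      finally have "Z j \<omega> \<le> Z v \<omega> + \<delta> * real j * ln (real n)" by linarith
      also have "\<dots> \<le> ((1 + \<delta>) * (\<sigma> + \<delta>) + \<delta>) * (real j * ln (real n))" using Zv by (simp add: algebra_simps)
      also have "ln (real n) \<le> (1 + \<delta>) * ln (ln (real j))"
      proof -
        have "real n * ln 2 = ln (2 ^ n)" by (simp add: ln_realpow)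
        also have "\<dots> \<le> ln (real j)" using of_nat_mono[OF n(1), where 'a = real] by (intro ln_mono) auto
        finally have "ln (real n * ln 2) \<le> ln (ln (real j))" using N(6)[OF nN] by (intro ln_mono) auto
        then have "(1 + \<delta>) * ln (real n * ln 2) \<le> (1 + \<delta>) * ln (ln (real j))" using \<delta> by (intro mult_left_mono) auto
        then show ?thesis using N(5)[OF nN] by linarith
      qed
      finally have fin: "Z j \<omega> \<le> ((1 + \<delta>) * (\<sigma> + \<delta>) + \<delta>) * (real j * ((1 + \<delta>) * ln (ln (real j))))"
        using \<sigma> \<delta> by (simp add: mult_left_mono)
      have "0 \<le> ln (ln (real j))" using \<open>ln (real n) \<le> (1 + \<delta>) * ln (ln (real j))\<close> ln0 \<delta>
        by (smt (verit) mult_pos_neg)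
      then have "((1 + \<delta>) * ((1 + \<delta>) * (\<sigma> + \<delta>) + \<delta>)) * (real j * ln (ln (real j))) \<le> (\<sigma> + \<epsilon>) * (real j * ln (ln (real j)))"
        using \<delta> by (intro mult_right_mono) auto
      then show "Z j \<omega> \<le> (\<sigma> + \<epsilon>) * (real j * ln (ln (real j)))" using fin by (simp add: mult_ac)
    qed
  qed
qed

end

section \<open>The law of the iterated logarithm\<close>

lemma filterlim_sparse_index: "filterlim sparse_index sequentially sequentially"
  by (rule filterlim_subseq) (auto simp: strict_mono_def sparse_index_less)

lemma (in lil_kernel) lower_bound:
  assumes \<epsilon>: "0 < \<epsilon>" "\<epsilon> < \<sigma>"
  shows "AE \<omega> in M. \<exists>\<^sub>F j in sequentially. (\<sigma> - \<epsilon>) * (real j * ln (ln (real j))) \<le> Z j \<omega>"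
proof -
  \<comment> \<open>The factor \<open>1 - \<delta>\<close> is the gamma threshold,
    \<open>\<sigma> - \<delta>\<close> bounds the diagonal, and \<open>1 + \<delta>\<close> compares
    \<open>ln (ln n)\<close> with \<open>ln (i + 2)\<close> at the sparse index
    \<open>n\<close>.\<close>
  have "((\<lambda>\<delta>. (1 - \<delta>) * (\<sigma> - \<delta>) / (1 + \<delta>)) \<longlongrightarrow> (1 - 0) * (\<sigma> - 0) / (1 + 0)) (at_right 0)"
    by (intro tendsto_intros) auto
  then have "eventually (\<lambda>\<delta>. \<sigma> - \<epsilon> < (1 - \<delta>) * (\<sigma> - \<delta>) / (1 + \<delta>)) (at_right 0)"
    using \<epsilon> by (intro order_tendstoD) auto
  moreover have "eventually (\<lambda>\<delta>::real. 0 < \<delta> \<and> \<delta> < 1) (at_right 0)"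
    using eventually_at_right_real[of 0 1] by (simp add: conj_commute)
  ultimately have "eventually (\<lambda>\<delta>. (0 < \<delta> \<and> \<delta> < 1) \<and> \<sigma> - \<epsilon> < (1 - \<delta>) * (\<sigma> - \<delta>) / (1 + \<delta>)) (at_right 0)"
    by (rule eventually_conj[rotated])
  then obtain \<delta> where \<delta>: "0 < \<delta>" "\<delta> < 1" and \<delta>': "\<sigma> - \<epsilon> < (1 - \<delta>) * (\<sigma> - \<delta>) / (1 + \<delta>)"
    using eventually_happens'[OF trivial_limit_at_right_real] by blast
  have \<delta>'': "(\<sigma> - \<epsilon>) * (1 + \<delta>) \<le> (1 - \<delta>) * (\<sigma> - \<delta>)" using \<delta> \<delta>' by (simp add: field_simps)
  have "eventually (\<lambda>m. \<sigma> - \<delta> < K m m / real m) sequentially"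
    using K_diag \<delta> by (intro order_tendstoD) auto
  then have ev1: "eventually (\<lambda>i. \<sigma> - \<delta> < K (sparse_index i) (sparse_index i) / real (sparse_index i)) sequentially"
    by (rule eventually_compose_filterlim[OF _ filterlim_sparse_index])
  have ev2: "eventually (\<lambda>i::nat. ln (3 * (real i + 2) * ln (real i + 2)) \<le> (1 + \<delta>) * ln (real i + 2)) sequentially"
    using \<delta> by real_asymp
  have "AE \<omega> in M. \<exists>\<^sub>F i in sequentially. (1 - \<delta>) * ln (real i + 2) * K (sparse_index i) (sparse_index i) < Z (sparse_index i) \<omega>"
    using \<delta> by (rule sparse_infinitely_often)
  then show ?thesis
  proof (rule eventually_mono)
    fix \<omega> assume fr: "\<exists>\<^sub>F i in sequentially. (1 - \<delta>) * ln (real i + 2) * K (sparse_index i) (sparse_index i) < Z (sparse_index i) \<omega>"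
    have "\<exists>\<^sub>F i in sequentially. (\<sigma> - \<epsilon>) * (real (sparse_index i) * ln (ln (real (sparse_index i)))) \<le> Z (sparse_index i) \<omega>"
      using frequently_eventually_frequently[OF fr eventually_conj[OF ev1 ev2]]
    proof (rule frequently_elim1)
      fix i
      let ?n = "sparse_index i" and ?l = "ln (real i + 2)"
      assume *: "(1 - \<delta>) * ?l * K ?n ?n < Z ?n \<omega> \<and> \<sigma> - \<delta> < K ?n ?n / real ?n \<and>
        ln (3 * (real i + 2) * ?l) \<le> (1 + \<delta>) * ?l"
      have n0: "0 < real ?n" using sparse_index_ge_1[of i] by linarith
      have "ln (real ?n) = 3 * (real i + 2) * ?l"
        by (simp add: sparse_index_def ln_realpow add.commute)
      then have lnln: "ln (ln (real ?n)) \<le> (1 + \<delta>) * ?l" using * by simp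
      have "(\<sigma> - \<epsilon>) * (real ?n * ln (ln (real ?n))) \<le> (\<sigma> - \<epsilon>) * (real ?n * ((1 + \<delta>) * ?l))"
        using \<epsilon> lnln by (intro mult_left_mono) auto
      also have "\<dots> = ((\<sigma> - \<epsilon>) * (1 + \<delta>)) * (real ?n * ?l)" by simp
      also have "\<dots> \<le> ((1 - \<delta>) * (\<sigma> - \<delta>)) * (real ?n * ?l)" using \<delta>'' by (rule mult_right_mono) simp
      also have "\<dots> = (1 - \<delta>) * ?l * ((\<sigma> - \<delta>) * real ?n)" by simp
      also have "\<dots> \<le> (1 - \<delta>) * ?l * K ?n ?n"
        using * n0 \<delta> by (intro mult_left_mono) (auto simp: field_simps)
      also have "\<dots> \<le> Z ?n \<omega>" using * by simp
      finally show "(\<sigma> - \<epsilon>) * (real ?n * ln (ln (real ?n))) \<le> Z ?n \<omega>" .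
    qed
    then show "\<exists>\<^sub>F j in sequentially. (\<sigma> - \<epsilon>) * (real j * ln (ln (real j))) \<le> Z j \<omega>"
      unfolding frequently_def using eventually_compose_filterlim[OF _ filterlim_sparse_index] by blast
  qed
qed

section \<open>From bounds for each tolerance to the limit superior\<close>

lemma limsup_eqI:
  fixes a :: "nat \<Rightarrow> real"
  assumes upper: "\<And>\<epsilon>. 0 < \<epsilon> \<Longrightarrow> eventually (\<lambda>j. a j \<le> \<sigma> + \<epsilon>) sequentially"
    and lower: "\<And>\<epsilon>. 0 < \<epsilon> \<Longrightarrow> \<exists>\<^sub>F j in sequentially. \<sigma> - \<epsilon> \<le> a j"
  shows "limsup (\<lambda>j. ereal (a j)) = ereal \<sigma>"
proof (rule antisym)
  show "limsup (\<lambda>j. ereal (a j)) \<le> ereal \<sigma>"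
  proof (rule ereal_le_epsilon2)
    fix e :: real assume "0 < e"
    then show "limsup (\<lambda>j. ereal (a j)) \<le> ereal \<sigma> + ereal e"
      using upper[of e] by (intro Limsup_bounded) (auto elim!: eventually_mono)
  qed
  show "ereal \<sigma> \<le> limsup (\<lambda>j. ereal (a j))"
  proof (rule ccontr)
    assume "\<not> ?thesis"
    then obtain c where c: "limsup (\<lambda>j. ereal (a j)) < ereal c" "ereal c < ereal \<sigma>"
      using ereal_dense2[of "limsup (\<lambda>j. ereal (a j))" "ereal \<sigma>"] by (auto simp: not_le)
    have "eventually (\<lambda>j. a j < c) sequentially"
      using Limsup_lessD[OF c(1)] by simp
    then have "eventually (\<lambda>j. \<not> \<sigma> - (\<sigma> - c) \<le> a j) sequentially" by (rule eventually_mono) simp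
    then show False using lower[of "\<sigma> - c"] c(2) by (simp add: frequently_def)
  qed
qed

theorem (in lil_kernel) law_of_iterated_logarithm:
  "AE \<omega> in M. limsup (\<lambda>j. ereal (Z j \<omega> / (real j * ln (ln (real j))))) = ereal \<sigma>"
proof -
  have pos: "eventually (\<lambda>j::nat. 0 < real j * ln (ln (real j))) sequentially" by real_asymp
  \<comment> \<open>Countably many tolerances, so that the exceptional null sets can be united; the
    shift by 2 keeps them below \<open>\<sigma>\<close>, as the lower bound demands.\<close>
  define e where "e q = \<sigma> / real (q + 2)" for q :: nat
  have e: "0 < e q" "e q < \<sigma>" for q using \<sigma> by (auto simp: e_def divide_less_eq add_pos_nonneg intro!: divide_pos_pos)
  have small: "\<exists>q. e q \<le> \<epsilon>" if "0 < \<epsilon>" for \<epsilon>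
  proof -
    have "eventually (\<lambda>q. e q < \<epsilon>) sequentially"
      unfolding e_def using that by real_asymp
    then show ?thesis by (auto simp: eventually_sequentially intro: less_imp_le)
  qed
  have "AE \<omega> in M. \<forall>q. eventually (\<lambda>j. Z j \<omega> \<le> (\<sigma> + e q) * (real j * ln (ln (real j)))) sequentially"
    unfolding AE_all_countable using upper_bound e by blast
  moreover have "AE \<omega> in M. \<forall>q. \<exists>\<^sub>F j in sequentially. (\<sigma> - e q) * (real j * ln (ln (real j))) \<le> Z j \<omega>"
    unfolding AE_all_countable using lower_bound e by blast
  ultimately show ?thesis
  proof eventually_elim
    case (elim \<omega>)
    show ?case
    proof (rule limsup_eqI)
      fix \<epsilon> :: real assume "0 < \<epsilon>"
      then obtain q where q: "e q \<le> \<epsilon>" using small by blast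
      show "eventually (\<lambda>j. Z j \<omega> / (real j * ln (ln (real j))) \<le> \<sigma> + \<epsilon>) sequentially"
        using elim(1)[rule_format, of q] pos
      proof eventually_elim
        case (elim j)
        then have "Z j \<omega> / (real j * ln (ln (real j))) \<le> \<sigma> + e q" by (subst pos_divide_le_eq) auto
        then show ?case using q by simp
      qed
      show "\<exists>\<^sub>F j in sequentially. \<sigma> - \<epsilon> \<le> Z j \<omega> / (real j * ln (ln (real j)))"
        using frequently_eventually_frequently[OF elim(2)[rule_format, of q] pos]
      proof (rule frequently_elim1)
        fix j assume "(\<sigma> - e q) * (real j * ln (ln (real j))) \<le> Z j \<omega> \<and> 0 < real j * ln (ln (real j))"
        then have "\<sigma> - e q \<le> Z j \<omega> / (real j * ln (ln (real j)))" by (subst pos_le_divide_eq) auto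
        then show "\<sigma> - \<epsilon> \<le> Z j \<omega> / (real j * ln (ln (real j)))" using q by simp
      qed
    qed
  qed
qed

text \<open>Each kernel condition splits into a part from \<open>cov\<close> and a part from
  \<open>f\<close>. Since \<open>j - i \<ge> 1\<close>, terms of order \<open>sqrt j\<close> are
  below the scale \<open>sqrt (j * (j - i))\<close> set by \<open>cov\<close>.\<close>

lemma (in renewal_weights) lil_kernel_cov:
  assumes Z: "permanental_sequence M \<alpha> K Z" and \<alpha>: "0 < \<alpha>"
    and K: "\<And>i j. 1 \<le> i \<Longrightarrow> 1 \<le> j \<Longrightarrow> K i j = cov i j + f j"
    and f: "\<And>j. 1 \<le> j \<Longrightarrow> 0 \<le> f j" "\<And>j. 1 \<le> j \<Longrightarrow> f j \<le> B * sqrt (real j)" and B: "0 < B"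
  shows "\<exists>C. lil_kernel M \<alpha> K Z (1 / mean\<^sup>2) C"
proof -
  define s where "s = 1 / mean\<^sup>2"
  define G where "G = gap_total"
  have G: "0 \<le> G" unfolding G_def by (rule gap_total_nonneg)
  have s: "0 < s" using mean_ge_1 by (simp add: s_def)
  \<comment> \<open>For a linear lower bound valid from \<open>j = 1\<close> on:
    \<open>cov j j \<ge> 1\<close> absorbs the additive error \<open>2 * G\<close> into a
    factor.\<close>
  define c where "c = s / (1 + 2 * G)"
  have c: "0 < c" using s G by (simp add: c_def)
  have cov_diag_ge_1: "1 \<le> cov j j" if "1 \<le> j" for j
    using cov_diag_diff[OF that] by (simp add: cov_def)
  have cov_lower: "c * real j \<le> cov j j" if "1 \<le> j" for j
  proof -
    have "s * real j \<le> cov j j + 2 * G" using cov_diag_asymp[of j] by (simp add: s_def G_def abs_le_iff)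
    also have "\<dots> \<le> cov j j * (1 + 2 * G)"
      using mult_left_mono[OF cov_diag_ge_1[OF that], of "2 * G"] G by (simp add: algebra_simps)
    finally show ?thesis using G by (simp add: c_def field_simps)
  qed
  \<comment> \<open>\<open>c1\<close>, \<open>c2\<close>, \<open>c3\<close> serve the diagonal
    increments, the minors and the off-diagonal products. The minors involve
    \<open>C\<^sup>2\<close>, and \<open>C \<ge> 1\<close> gives
    \<open>c2 \<le> C \<le> C\<^sup>2\<close>.\<close>
  define c1 where "c1 = 1 + 2 * B"
  define c2 where "c2 = (1 + 2 * G) + 2 * B * (1 + G)"
  define c3 where "c3 = (1 + B)\<^sup>2 / c\<^sup>2"
  define C where "C = c1 + c2 + c3"
  have cs: "1 \<le> c1" "0 \<le> c2" "0 \<le> c3" using B G by (auto simp: c1_def c2_def c3_def)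
  have C: "1 \<le> C" "c1 \<le> C" "c2 \<le> C" "c3 \<le> C" using cs by (auto simp: C_def)
  have C2: "c2 \<le> C\<^sup>2" 
  proof -
    have "C * 1 \<le> C * C" using C by (intro mult_left_mono) auto
    then show ?thesis using C unfolding power2_eq_square by linarith
  qed
  have K_pos: "0 < K j j" if "1 \<le> j" for j
    using K[OF that that] cov_diag_ge_1[OF that] f(1)[OF that] by simp
  have "lil_kernel M \<alpha> K Z s C"
  proof
    show "permanental_sequence M \<alpha> K Z" "0 < \<alpha>" "0 < s" by fact+
    show "0 < C" using C by simp
    show "0 < K j j" if "1 \<le> j" for j by (rule K_pos[OF that])
    show "0 \<le> K i j" if "1 \<le> i" "1 \<le> j" for i j
      using K[OF that] cov_bounds(1)[of i j] f(1)[OF that(2)] by simp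
    show "(\<lambda>j. K j j / real j) \<longlonglongrightarrow> s"
    proof (rule Lim_transform_bound[of "\<lambda>j. K j j / real j - s" "\<lambda>j. (2 * G + B * sqrt (real j)) / real j", THEN LIM_zero_cancel])
      show "eventually (\<lambda>j. norm (K j j / real j - s) \<le> norm ((2 * G + B * sqrt (real j)) / real j)) sequentially"
        using eventually_ge_at_top[of 1]
      proof eventually_elim
        case (elim j)
        have "K j j / real j - s = (cov j j - s * real j + f j) / real j"
          using elim K[OF elim elim] by (simp add: field_simps)
        moreover have "\<bar>cov j j - s * real j + f j\<bar> \<le> 2 * G + B * sqrt (real j)"
          using cov_diag_asymp[of j] f(1)[OF elim] f(2)[OF elim] by (simp add: s_def G_def abs_le_iff)
        ultimately show ?case using elim G B by (simp add: divide_right_mono)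
      qed
      show "(\<lambda>j. (2 * G + B * sqrt (real j)) / real j) \<longlonglongrightarrow> 0" by real_asymp
    qed
    fix i j :: nat assume i: "1 \<le> i" "i < j"
    have j: "1 \<le> j" using i by simp
    have ij: "i \<le> j" using i by simp
    define d where "d = real j - real i"
    have d: "1 \<le> d" "d \<le> real j" using i by (auto simp: d_def)
    have dj: "d \<le> sqrt (real j * d)" "sqrt (real j) \<le> sqrt (real j * d)"
      using d by (auto intro!: real_le_rsqrt mult_right_mono real_sqrt_le_mono simp: power2_eq_square mult_le_cancel_left1)
    have fi: "0 \<le> f i" "f i \<le> B * sqrt (real j)" "f i \<le> B * real i"
    proof -
      have "sqrt (real i) \<le> sqrt (real j)" "sqrt (real i) \<le> real i"
        using i by (auto intro!: real_le_lsqrt simp: power2_eq_square)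
      then have "B * sqrt (real i) \<le> B * sqrt (real j)" "B * sqrt (real i) \<le> B * real i"
        using B by (auto intro: mult_left_mono)
      then show "0 \<le> f i" "f i \<le> B * sqrt (real j)" "f i \<le> B * real i"
        using f(1)[OF i(1)] f(2)[OF i(1)] by linarith+
    qed
    have fj: "0 \<le> f j" "f j \<le> B * sqrt (real j)" using f j by auto
    note diag = cov_diag_diff[OF ij] and off = cov_offdiag_diff[OF ij]
    have "\<bar>K j j - K i i\<bar> \<le> d + 2 * B * sqrt (real j)"
      using diag fi fj K[OF i(1) i(1)] K[OF j j] by (simp add: d_def abs_le_iff)
    also have "\<dots> \<le> c1 * sqrt (real j * d)"
    proof -
      have "2 * B * sqrt (real j) \<le> 2 * B * sqrt (real j * d)" using dj(2) B by (intro mult_left_mono) auto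
      then show ?thesis using dj(1) unfolding c1_def distrib_right by linarith
    qed
    also have "\<dots> \<le> C * sqrt (real j * d)" using C d by (intro mult_right_mono) auto
    finally show "\<bar>K j j - K i i\<bar> \<le> C * sqrt (real j * (real j - real i))" by (simp add: d_def)
    have v2: "cov i i - cov i j \<le> G * d" using off by (simp only: d_def G_def abs_le_iff)
    have "cov j j - cov i i \<le> 1 * d" using diag by (simp add: d_def)
    with v2 have v1: "cov j j - cov i j \<le> (1 + G) * d" unfolding distrib_right by linarith
    have ci: "0 \<le> cov i i" "cov i i \<le> real j" "0 \<le> cov i j" "cov i j \<le> real i" "cov i j \<le> real j"
      using cov_bounds[of i i] cov_bounds[of i j] ij by auto
    \<comment> \<open>The product \<open>f i * f j\<close> cancels; every remaining term has a
      covariance difference of order \<open>j - i\<close> as a factor.\<close>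
    have "K i i * K j j - K i j * K j i = cov i i * (cov j j - cov i j) + cov i j * (cov i i - cov i j)
        + f i * (cov j j - cov i j) + f j * (cov i i - cov i j)"
      using K i(1) j cov_sym[of j i] by (simp add: algebra_simps)
    also have "\<dots> \<le> real j * ((1 + G) * d) + real j * (G * d) + (B * sqrt (real j)) * ((1 + G) * d) + (B * sqrt (real j)) * (G * d)"
    proof -
      have m: "x * y \<le> X * Y" if "0 \<le> x" "x \<le> X" "y \<le> Y" "0 \<le> Y" for x y X Y :: real
        using mult_left_mono[OF that(3,1)] mult_right_mono[OF that(2,4)] by linarith
      have "0 \<le> (1 + G) * d" "0 \<le> G * d" using G d by auto
      then show ?thesis using ci fi fj v1 v2 by (intro add_mono m) auto
    qed
    also have "\<dots> = (1 + 2 * G) * (real j * d) + B * (1 + 2 * G) * (sqrt (real j) * d)"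
      by (simp add: algebra_simps)
    also have "\<dots> \<le> (1 + 2 * G) * (real j * d) + (2 * B * (1 + G)) * (real j * d)"
    proof -
      have "sqrt (real j) \<le> real j" using j by (auto intro!: real_le_lsqrt simp: power2_eq_square)
      then have 1: "sqrt (real j) * d \<le> real j * d" using d by (intro mult_right_mono) auto
      have 2: "B * (1 + 2 * G) \<le> 2 * B * (1 + G)" using B by (simp add: algebra_simps)
      have "0 \<le> 2 * B * (1 + G)" "0 \<le> sqrt (real j) * d" using B G d by simp_all
      then have "B * (1 + 2 * G) * (sqrt (real j) * d) \<le> 2 * B * (1 + G) * (real j * d)"
        by (rule mult_mono[OF 2 1])
      then show ?thesis by (rule add_left_mono)
    qed
    also have "\<dots> = c2 * (real j * d)" by (simp add: c2_def algebra_simps)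
    also have "\<dots> \<le> C\<^sup>2 * (real j * d)" using C2 d by (intro mult_right_mono) auto
    finally show "K i i * K j j - K i j * K j i \<le> C\<^sup>2 * (real j * (real j - real i))" by (simp add: d_def)
    \<comment> \<open>The entries are treated differently. In \<open>K i j\<close> the summand
      \<open>f j\<close> is of order \<open>sqrt j\<close>, the source of \<open>1 / sqrt j\<close>;
      in \<open>K j i\<close> the bound \<open>f i \<le> B * i\<close> preserves the factor
      \<open>i\<close> to be compared with \<open>K i i\<close>.\<close>
    have "K i j * K j i \<le> (real i + B * sqrt (real j)) * (real i + B * real i)"
      using K i(1) j ci fi fj cov_sym[of j i] by (auto intro!: mult_mono)
    also have "\<dots> \<le> ((1 + B) * (real i + sqrt (real j))) * ((1 + B) * real i)"
      using B by (intro mult_mono) (auto simp: algebra_simps)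
    also have "\<dots> = c3 * ((real i + sqrt (real j)) / real j) * ((c * real i) * (c * real j))"
      using c j by (simp add: c3_def power2_eq_square)
    also have "\<dots> \<le> c3 * ((real i + sqrt (real j)) / real j) * (K i i * K j j)"
    proof (intro mult_left_mono mult_mono)
      show "c * real i \<le> K i i" "c * real j \<le> K j j"
        using cov_lower[OF i(1)] cov_lower[OF j] K[OF i(1) i(1)] K[OF j j] fi fj by linarith+
    qed (use c cs K_pos i in \<open>auto intro: less_imp_le\<close>)
    also have "\<dots> \<le> C * ((real i + sqrt (real j)) / real j) * (K i i * K j j)"
      using C K_pos[OF i(1)] K_pos[OF j] by (intro mult_right_mono) auto
    also have "(real i + sqrt (real j)) / real j = real i / real j + 1 / sqrt (real j)"
    proof -
      have "sqrt (real j) / real j = 1 / sqrt (real j)"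
        using real_div_sqrt[of "real j"] j by (metis inverse_divide inverse_eq_divide of_nat_0_le_iff)
      then show ?thesis by (simp only: add_divide_distrib)
    qed
    finally show "K i j * K j i \<le> C * (real i / real j + 1 / sqrt (real j)) * (K i i * K j j)" .
  qed
  then show ?thesis unfolding s_def by blast
qed

theorem theorem1p10:
  fixes k :: nat
    and p h f :: "nat \<Rightarrow> real"
    and N :: "'b measure"
    and g :: "nat \<Rightarrow> 'b \<Rightarrow> real"
    and \<xi> :: "int \<Rightarrow> 'b \<Rightarrow> real"
    and V :: "nat \<Rightarrow> nat \<Rightarrow> real"
    and \<alpha> :: real
    and M :: "'a measure"
    and Y :: "nat \<Rightarrow> 'a \<Rightarrow> real"
  assumes k: "2 \<le> k"
    and p_decreasing: "\<And>l. 1 \<le> l \<Longrightarrow> l < k \<Longrightarrow> p (l + 1) \<le> p l"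
    and p_pos: "0 < p k"
    and p_sum: "(\<Sum>l=1..k. p l) = 1"
    and N: "prob_space N"
    and g_normal: "\<And>n. 1 \<le> n \<Longrightarrow> distributed N lborel (g n) std_normal_density"
    and g_indep: "prob_space.indep_vars N (\<lambda>_. borel) g {1..}"
    and xi_nonpos: "\<And>i \<omega>. i \<le> 0 \<Longrightarrow> \<omega> \<in> space N \<Longrightarrow> \<xi> i \<omega> = 0"
    and xi_1: "\<And>\<omega>. \<omega> \<in> space N \<Longrightarrow> \<xi> 1 \<omega> = g 1 \<omega>"
    and xi_rec: "\<And>n \<omega>. 2 \<le> n \<Longrightarrow> \<omega> \<in> space N \<Longrightarrow>
                   \<xi> (int n) \<omega> = (\<Sum>l=1..k. p l * \<xi> (int n - int l) \<omega>) + g n \<omega>"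
    and V: "\<And>m n. 1 \<le> m \<Longrightarrow> 1 \<le> n \<Longrightarrow> V m n = covariance N (\<xi> (int m)) (\<xi> (int n))"
    and h_nonneg: "\<And>n. 1 \<le> n \<Longrightarrow> 0 \<le> h n"
    and h_summable: "h summable_on {1..}"
    and f: "\<And>j. 1 \<le> j \<Longrightarrow> f j = (\<Sum>\<^sub>\<infinity>n\<in>{1..}. V j n * h n)"
    and f_small: "f \<in> o(\<lambda>j. real j powr (1 / 2))"
    and alpha: "0 < \<alpha>"
    and Y: "permanental_sequence M \<alpha> (\<lambda>i j. V i j + f j) Y"
  shows "AE \<omega> in M.
           limsup (\<lambda>j. ereal (Y j \<omega> / (real j * ln (ln (real j))))) =
           ereal (1 / (\<Sum>l=1..k. real l * p l)\<^sup>2)"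
proof -
  \<comment> \<open>The values of \<open>p\<close> outside \<open>{1..k}\<close> are arbitrary; the
    renewal recursion needs them to be 0.\<close>
  define w where "w l = (if l \<in> {1..k} then p l else 0)" for l
  have p_ge: "p k \<le> p l" if "1 \<le> l" "l \<le> k" for l
    using that(2,1)
  proof (induction l rule: inc_induct)
    case (step l)
    then show ?case using p_decreasing[of l] by simp
  qed simp
  interpret renewal_weights w k "p k"
    by unfold_locales (use k p_pos p_ge p_sum in \<open>auto simp: w_def\<close>)
  have mean_eq: "mean = (\<Sum>l=1..k. real l * p l)" by (simp add: mean_def w_def)
  have V_cov: "V m n = cov m n" if "1 \<le> m" "1 \<le> n" for m n
  proof -
    have "(\<Sum>l=1..k. p l * x l) = (\<Sum>l=1..k. w l * x l)" for x :: "nat \<Rightarrow> real" by (simp add: w_def)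
    note p_w = this
    have "covariance N (\<xi> (int m)) (\<xi> (int n)) = cov m n"
      by (rule covariance_autoregressive[OF N g_normal g_indep])
        (assumption | rule xi_nonpos xi_1 that | rule xi_rec[unfolded p_w])+
    then show ?thesis using V[OF that] by simp
  qed
  have f_nonneg: "0 \<le> f j" if "1 \<le> j" for j
    unfolding f[OF that] using that h_nonneg cov_bounds(1) by (intro infsum_nonneg) (simp add: V_cov)
  have "eventually (\<lambda>j. norm (f j) \<le> 1 * norm (real j powr (1 / 2))) sequentially"
    using landau_o.smallD[OF f_small, of 1] by simp
  then obtain J where J: "\<And>j. J \<le> j \<Longrightarrow> \<bar>f j\<bar> \<le> sqrt (real j)"
    by (auto simp: eventually_sequentially powr_half_sqrt)
  \<comment> \<open>The square-root bound on \<open>f\<close> holds from \<open>J\<close> on with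
    constant 1; the finite sum takes care of the earlier indices.\<close>
  define B where "B = 1 + (\<Sum>j=1..J. f j)"
  have B: "1 \<le> B" unfolding B_def using f_nonneg sum_nonneg[of "{1..J}" f] by simp
  have f_le: "f j \<le> B * sqrt (real j)" if j: "1 \<le> j" for j
  proof (cases "j \<le> J")
    case True
    have "f j \<le> (\<Sum>j=1..J. f j)" using True j f_nonneg by (intro member_le_sum) auto
    also have "\<dots> \<le> B * 1" by (simp add: B_def)
    also have "\<dots> \<le> B * sqrt (real j)" using B j by (intro mult_left_mono) auto
    finally show ?thesis .
  next
    case False
    then have "f j \<le> 1 * sqrt (real j)" using J[of j] by simp
    also have "\<dots> \<le> B * sqrt (real j)" using B by (intro mult_right_mono) auto
    finally show ?thesis .
  qed
  have "\<exists>C. lil_kernel M \<alpha> (\<lambda>i j. V i j + f j) Y (1 / mean\<^sup>2) C"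
  proof (rule lil_kernel_cov[OF Y alpha _ f_nonneg f_le])
    show "V i j + f j = cov i j + f j" if "1 \<le> i" "1 \<le> j" for i j
      using V_cov[OF that] by simp
  qed (use B in auto)
  then obtain C where "lil_kernel M \<alpha> (\<lambda>i j. V i j + f j) Y (1 / mean\<^sup>2) C" ..
  then show ?thesis
    unfolding mean_eq[symmetric] by (rule lil_kernel.law_of_iterated_logarithm)
qed

end
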